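(* Let $\mathbf{X}=(X_k)_{k\ge 0}$ be a $\beta$-null recurrent Markov chain ($\beta\in(0,1)$) on $(E,\mathcal{E})$ with an accessible atom $\boldsymbol{\alpha}$ and arbitrary initial distribution, and let $f:E\to\mathbb{R}$ be a $\pi_{\boldsymbol{\alpha}}$-integrable function such that $\mathbb{E}[f(\mathcal{B}_1)^2]<+\infty$ and $\operatorname{Var}(f(\mathcal{B}_1))>0$. Define $$\widehat{\mu}_{T(n)}=\frac{1}{T(n)}\sum_{i=1}^{T(n)}f(\mathcal{B}_i),\qquad \widehat{\sigma}^2_{T(n)}=\frac{1}{T(n)}\sum_{j=1}^{T(n)}\bigl(f(\mathcal{B}_j)-\widehat{\mu}_{T(n)}\bigr)^2 .$$ Let $\mathcal{B}^{\ast}_{1,T(n)},\ldots,\mathcal{B}^{\ast}_{T(n),T(n)}$ be $T(n)$ blocks which, conditionally on the data $\mathbf{X}^{(n)}=(X_0,\ldots,X_n)$, are drawn independently from the empirical distribution $T(n)^{-1}\sum_{j=1}^{T(n)}\delta_{\mathcal{B}_j}$ (regeneration-based bootstrap). Then for every $x\in\mathbb{R}$, $$\mathbb{P}^{\ast}\left(\frac{\sqrt{T(n)}}{\widehat{\sigma}_{T(n)}}\left(\frac{1}{T(n)}\sum_{j=1}^{T(n)}\bigl(f(\mathcal{B}^{\ast}_{j,T(n)})-\widehat{\mu}_{T(n)}\bigr)\right)\le x\right)\longrightarrow \Phi(x)\quad\text{almost surely as } n\to\infty,$$ where $\Phi$ is the standard normal distribution function and $\mathbb{P}^{\ast}(\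cdot)=\mathbb{P}(\cdot\mid\mathbf{X}^{(n)})$.
   Context: Standing assumptions. $\mathbf{X}=(X_k)_{k\ge0}$ is a homogeneous Markov chain with transition kernel $P$ on a countably generated state space $(E,\mathcal{E})$; it is aperiodic and irreducible with maximal irreducibility measure $\psi$. An accessible atom is a set $\boldsymbol{\alpha}\in\mathcal{E}$ with $\psi(\boldsymbol{\alpha})>0$ and $P(x,\cdot)=P(y,\cdot)$ for all $x,y\in\boldsymbol{\alpha}$. $\mathbb{P}_{\boldsymbol{\alpha}},\mathbb{E}_{\boldsymbol{\alpha}}$ denote probability and expectation given $X_0\in\boldsymbol{\alpha}$. The chain is recurrent, and from every starting point $x\in E$ it visits $\boldsymbol{\alpha}$ infinitely often with probability one. Return times: $\tau_{\boldsymbol{\alpha}}=\tau_{\boldsymbol{\alpha}}(1)=\inf\{n\ge1:X_n\in\boldsymbol{\alpha}\}$ and $\tau_{\boldsymbol{\alpha}}(k)=\min\{n>\tau_{\boldsymbol{\alpha}}(k-1):X_n\in\boldsymbol{\alpha}\}$ for $k\ge 2$. $\beta$-null recurrence: there are $\beta\in(0,1)$ and a function $L$ slowly varying at $+\infty$ such that $\mathbb{P}_{\boldsymbol{\alpha}}(\tau_{\boldsymbol{\alpha}}>n)\sim \dfrac{1}{\Gamma(1-\beta)\,n^{\beta}L(n)}$ as $n\to\infty$. Invariant measure: $\pi_{\boldsymbol{\alpha}}(A)=\mathbb{E}_{\boldsymbol{\alpha}}\bigl(\sum_{j=1}^{\tau_{\boldsymbol{\alpha}}}\mathbb{I}\{X_j\in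 A\}\bigr)$, $A\in\mathcal{E}$. Regeneration blocks: for $j\ge1$, $\mathcal{B}_j=(X_{\tau_{\boldsymbol{\alpha}}(j)+1},\ldots,X_{\tau_{\boldsymbol{\alpha}}(j+1)})$ and $f(\mathcal{B}_j)=\sum_{i=\tau_{\boldsymbol{\alpha}}(j)+1}^{\tau_{\boldsymbol{\alpha}}(j+1)}f(X_i)$; for a general finite block $\mathcal{B}$ of states, $f(\mathcal{B})$ is the sum of $f$ over its entries. The blocks $(\mathcal{B}_j)_{j\ge1}$ are i.i.d. $T(n)$ is the number of complete regeneration blocks $\mathcal{B}_1,\mathcal{B}_2,\ldots$ observed up to time $n$, i.e. $T(n)=\max\{k\ge0: k=0 \text{ or } \tau_{\boldsymbol{\alpha}}(k+1)\le n\}$; $T(n)\to\infty$ almost surely. Quantities that are undefined because $T(n)=0$ or $\widehat\sigma_{T(n)}=0$ may be assigned arbitrary values (almost surely this concerns only finitely many $n$). *)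

theory Defs
  imports "HOL-Probability.Probability"
begin

section \<open>Markov chains on a general state space\<close>

text \<open>The state space \<open>(E, \<E>)\<close> is the measurable space underlying a measure \<open>S\<close>; the measure
  carried by \<open>S\<close> itself plays no role.  A transition kernel is a function
  \<open>\<kappa> \<in> S \<rightarrow>\<^sub>M prob_algebra S\<close>.\<close>

definition countably_generated :: "'a measure \<Rightarrow> bool" where
  "countably_generated S \<longleftrightarrow>
     (\<exists>G. countable G \<and> G \<subseteq> Pow (space S) \<and> sets S = sigma_sets (space S) G)"

primrec kernel_power :: "'a measure \<Rightarrow> ('a \<Rightarrow> 'a measure) \<Rightarrow> nat \<Rightarrow> 'a \<Rightarrow> 'a measure" where
  "kernel_power S \<kappa> 0 x = return S x"
| "kernel_power S \<kappa> (Suc n) x = kernel_power S \<kappa> n x \<bind> \<kappa>"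

definition irreducibility_measure :: "'a measure \<Rightarrow> ('a \<Rightarrow> 'a measure) \<Rightarrow> 'a measure \<Rightarrow> bool" where
  "irreducibility_measure S \<kappa> \<phi> \<longleftrightarrow>
     sets \<phi> = sets S \<and> sigma_finite_measure \<phi> \<and> emeasure \<phi> (space S) > 0 \<and>
     (\<forall>A\<in>sets S. emeasure \<phi> A > 0 \<longrightarrow>
        (\<forall>x\<in>space S. \<exists>n\<ge>1. emeasure (kernel_power S \<kappa> n x) A > 0))"

definition maximal_irreducibility_measure ::
    "'a measure \<Rightarrow> ('a \<Rightarrow> 'a measure) \<Rightarrow> 'a measure \<Rightarrow> bool" where
  "maximal_irreducibility_measure S \<kappa> \<psi> \<longleftrightarrow>
     irreducibility_measure S \<kappa> \<psi> \<and>
     (\<forall>\<phi>. irreducibility_measure S \<kappa> \<phi> \<longrightarrow> absolutely_continuous \<psi> \<phi>)"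

text \<open>The period of an irreducible kernel is the largest length of a cycle of disjoint sets, taken
  up to a \<open>\<psi>\<close>-null set; the chain is aperiodic if the period is 1.\<close>

definition cycle :: "'a measure \<Rightarrow> ('a \<Rightarrow> 'a measure) \<Rightarrow> 'a measure \<Rightarrow> nat \<Rightarrow> (nat \<Rightarrow> 'a set) \<Rightarrow> bool" where
  "cycle S \<kappa> \<psi> d D \<longleftrightarrow>
     1 \<le> d \<and> (\<forall>i<d. D i \<in> sets S) \<and> disjoint_family_on D {..<d} \<and>
     (\<forall>i<d. \<forall>x\<in>D i. emeasure (\<kappa> x) (D (Suc i mod d)) = 1) \<and>
     emeasure \<psi> (space S - (\<Union>i<d. D i)) = 0"

definition aperiodic :: "'a measure \<Rightarrow> ('a \<Rightarrow> 'a measure) \<Rightarrow> 'a measure \<Rightarrow> bool" where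
  "aperiodic S \<kappa> \<psi> \<longleftrightarrow> (\<forall>d D. cycle S \<kappa> \<psi> d D \<longrightarrow> d = 1)"

definition recurrent :: "'a measure \<Rightarrow> ('a \<Rightarrow> 'a measure) \<Rightarrow> 'a measure \<Rightarrow> bool" where
  "recurrent S \<kappa> \<psi> \<longleftrightarrow>
     (\<forall>A\<in>sets S. emeasure \<psi> A > 0 \<longrightarrow>
        (\<forall>x\<in>space S. (\<Sum>n. emeasure (kernel_power S \<kappa> (Suc n) x) A) = \<infinity>))"

definition accessible_atom ::
    "'a measure \<Rightarrow> ('a \<Rightarrow> 'a measure) \<Rightarrow> 'a measure \<Rightarrow> 'a set \<Rightarrow> bool" where
  "accessible_atom S \<kappa> \<psi> \<alpha> \<longleftrightarrow>
     \<alpha> \<in> sets S \<and> emeasure \<psi> \<alpha> > 0 \<and> (\<forall>x\<in>\<alpha>. \<forall>y\<in>\<alpha>. \<kappa> x = \<kappa> y)"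

text \<open>The law on path space of the chain with initial distribution \<open>\<nu>\<close>, from the
  Ionescu-Tulcea theorem.\<close>

definition path_law :: "'a measure \<Rightarrow> ('a \<Rightarrow> 'a measure) \<Rightarrow> 'a measure \<Rightarrow> (nat \<Rightarrow> 'a) measure" where
  "path_law S \<kappa> \<nu> =
     projective_family.lim UNIV
       (Ionescu_Tulcea.CI (\<lambda>i w. case i of 0 \<Rightarrow> \<nu> | Suc j \<Rightarrow> \<kappa> (w j)) (\<lambda>_. S)) (\<lambda>_. S)"

text \<open>The choice of the starting point in \<open>\<alpha>\<close> is irrelevant for events that depend on
  \<open>X\<^sub>1, X\<^sub>2, \<dots>\<close> only, and the law is used for such events only.\<close>

definition atom_law :: "'a measure \<Rightarrow> ('a \<Rightarrow> 'a measure) \<Rightarrow> 'a set \<Rightarrow> (nat \<Rightarrow> 'a) measure" where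
  "atom_law S \<kappa> \<alpha> = path_law S \<kappa> (return S (SOME x. x \<in> \<alpha>))"

text \<open>The \<open>\<sigma>\<close>-algebra generated by \<open>X\<^sub>0, \<dots>, X\<^sub>n\<close>.\<close>

definition history ::
    "'w measure \<Rightarrow> 'a measure \<Rightarrow> (nat \<Rightarrow> 'w \<Rightarrow> 'a) \<Rightarrow> nat \<Rightarrow> 'w measure" where
  "history M S X n = vimage_algebra (space M) (\<lambda>\<omega>. \<lambda>i\<in>{..n}. X i \<omega>) (PiM {..n} (\<lambda>_. S))"

definition markov_chain ::
    "'w measure \<Rightarrow> 'a measure \<Rightarrow> ('a \<Rightarrow> 'a measure) \<Rightarrow> (nat \<Rightarrow> 'w \<Rightarrow> 'a) \<Rightarrow> bool" where
  "markov_chain M S \<kappa> X \<longleftrightarrow>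
     prob_space M \<and> \<kappa> \<in> S \<rightarrow>\<^sub>M prob_algebra S \<and> (\<forall>n. X n \<in> M \<rightarrow>\<^sub>M S) \<and>
     (\<forall>n. \<forall>A\<in>sets S. AE \<omega> in M.
        real_cond_exp M (history M S X n) (indicator (X (Suc n) -` A \<inter> space M)) \<omega>
          = measure (\<kappa> (X n \<omega>)) A)"

section \<open>Return times, regeneration blocks and null recurrence\<close>

text \<open>Functions of a path \<open>w = (x\<^sub>0, x\<^sub>1, \<dots>)\<close>.  With the convention \<open>\<tau>(0) = 0\<close>, the recursion gives
  \<open>\<tau>(1) = inf {n \<ge> 1. x\<^sub>n \<in> \<alpha>}\<close>; the infimum of the empty set is \<open>\<infinity>\<close>.\<close>

primrec return_time :: "'a set \<Rightarrow> (nat \<Rightarrow> 'a) \<Rightarrow> nat \<Rightarrow> enat" where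
  "return_time \<alpha> w 0 = 0"
| "return_time \<alpha> w (Suc k) = Inf {enat n |n. return_time \<alpha> w k < enat n \<and> w n \<in> \<alpha>}"

text \<open>Blocks are lists of states.  The value of a block is meaningless if its end point is
  infinite.\<close>

definition block :: "'a set \<Rightarrow> (nat \<Rightarrow> 'a) \<Rightarrow> nat \<Rightarrow> 'a list" where
  "block \<alpha> w j =
     map w [Suc (the_enat (return_time \<alpha> w j)) ..< Suc (the_enat (return_time \<alpha> w (Suc j)))]"

definition block_sum :: "('a \<Rightarrow> real) \<Rightarrow> 'a list \<Rightarrow> real" where
  "block_sum f b = sum_list (map f b)"

definition num_blocks :: "'a set \<Rightarrow> (nat \<Rightarrow> 'a) \<Rightarrow> nat \<Rightarrow> nat" where
  "num_blocks \<alpha> w n = Max {k. k = 0 \<or> return_time \<alpha> w (k + 1) \<le> enat n}"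

definition invariant_measure :: "'a measure \<Rightarrow> ('a \<Rightarrow> 'a measure) \<Rightarrow> 'a set \<Rightarrow> 'a measure" where
  "invariant_measure S \<kappa> \<alpha> = measure_of (space S) (sets S)
     (\<lambda>A. \<integral>\<^sup>+w. (\<Sum>j. if 1 \<le> j \<and> enat j \<le> return_time \<alpha> w 1 then indicator A (w j) else 0)
            \<partial>atom_law S \<kappa> \<alpha>)"

definition slowly_varying :: "(real \<Rightarrow> real) \<Rightarrow> bool" where
  "slowly_varying L \<longleftrightarrow>
     (\<exists>a. L \<in> borel_measurable (restrict_space borel {a..}) \<and> (\<forall>x\<ge>a. L x > 0)) \<and>
     (\<forall>c>0. ((\<lambda>x. L (c * x) / L x) \<longlongrightarrow> 1) at_top)"

definition beta_null_recurrent ::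
    "real \<Rightarrow> 'a measure \<Rightarrow> ('a \<Rightarrow> 'a measure) \<Rightarrow> 'a set \<Rightarrow> bool" where
  "beta_null_recurrent \<beta> S \<kappa> \<alpha> \<longleftrightarrow>
     0 < \<beta> \<and> \<beta> < 1 \<and>
     (\<exists>L. slowly_varying L \<and>
        (\<lambda>n. measure (atom_law S \<kappa> \<alpha>)
               {w \<in> space (atom_law S \<kappa> \<alpha>). return_time \<alpha> w 1 > enat n})
        \<sim>[sequentially] (\<lambda>n. 1 / (Gamma (1 - \<beta>) * real n powr \<beta> * L (real n))))"

section \<open>The regeneration-based bootstrap\<close>

text \<open>The measurable space of finite blocks is the disjoint union of the products \<open>E\<^sup>k\<close>.\<close>

definition block_space :: "'a measure \<Rightarrow> 'a list measure" where
  "block_space S = sigma (lists (space S))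
     {{b. length b = k \<and> (\<forall>i<k. b ! i \<in> A i)} |k A. \<forall>i<k. A i \<in> sets S}"

definition mu_hat :: "'a set \<Rightarrow> ('a \<Rightarrow> real) \<Rightarrow> (nat \<Rightarrow> 'a) \<Rightarrow> nat \<Rightarrow> real" where
  "mu_hat \<alpha> f w n =
     1 / real (num_blocks \<alpha> w n) * (\<Sum>i=1..num_blocks \<alpha> w n. block_sum f (block \<alpha> w i))"

definition sigma_hat :: "'a set \<Rightarrow> ('a \<Rightarrow> real) \<Rightarrow> (nat \<Rightarrow> 'a) \<Rightarrow> nat \<Rightarrow> real" where
  "sigma_hat \<alpha> f w n = sqrt
     (1 / real (num_blocks \<alpha> w n) *
        (\<Sum>j=1..num_blocks \<alpha> w n. (block_sum f (block \<alpha> w j) - mu_hat \<alpha> f w n)\<^sup>2))"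

text \<open>The empirical distribution of the observed blocks, for \<open>T(n) \<ge> 1\<close>: the law of the block with
  uniformly distributed index.\<close>

definition empirical_block_law :: "'a measure \<Rightarrow> 'a set \<Rightarrow> (nat \<Rightarrow> 'a) \<Rightarrow> nat \<Rightarrow> 'a list measure" where
  "empirical_block_law S \<alpha> w n =
     distr (uniform_count_measure {1..num_blocks \<alpha> w n}) (block_space S) (block \<alpha> w)"

text \<open>\<open>B n j\<close> is the \<open>j\<close>-th bootstrap block drawn from the data up to time \<open>n\<close>; only the indices
  \<open>1 \<le> j \<le> T(n)\<close> are constrained.  Given \<open>X\<^sub>0, \<dots>, X\<^sub>n\<close>, on the event \<open>T(n) = k\<close> the conditional
  law of the first \<open>k\<close> blocks is the \<open>k\<close>-fold product of the empirical distribution.\<close>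

definition regeneration_bootstrap ::
    "'w measure \<Rightarrow> 'a measure \<Rightarrow> 'a set \<Rightarrow> (nat \<Rightarrow> 'w \<Rightarrow> 'a) \<Rightarrow> (nat \<Rightarrow> nat \<Rightarrow> 'w \<Rightarrow> 'a list) \<Rightarrow> bool" where
  "regeneration_bootstrap M S \<alpha> X B \<longleftrightarrow>
     (\<forall>n j. B n j \<in> M \<rightarrow>\<^sub>M block_space S) \<and>
     (\<forall>n. \<forall>k\<ge>1. \<forall>C\<in>sets (PiM {1..k} (\<lambda>_. block_space S)). AE \<omega> in M.
        num_blocks \<alpha> (\<lambda>i. X i \<omega>) n = k \<longrightarrow>
          real_cond_exp M (history M S X n)
            (indicator {\<omega>'\<in>space M. (\<lambda>j\<in>{1..k}. B n j \<omega>') \<in> C}) \<omega>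
          = measure (PiM {1..k} (\<lambda>_. empirical_block_law S \<alpha> (\<lambda>i. X i \<omega>) n)) C)"

definition bootstrap_statistic ::
    "'a set \<Rightarrow> ('a \<Rightarrow> real) \<Rightarrow> (nat \<Rightarrow> 'a) \<Rightarrow> nat \<Rightarrow> (nat \<Rightarrow> 'a list) \<Rightarrow> real" where
  "bootstrap_statistic \<alpha> f w n b =
     sqrt (real (num_blocks \<alpha> w n)) / sigma_hat \<alpha> f w n *
       (1 / real (num_blocks \<alpha> w n) *
          (\<Sum>j=1..num_blocks \<alpha> w n. block_sum f (b j) - mu_hat \<alpha> f w n))"

end

(* By the strong Markov property at the visits to the atom, the block sums y_1, y_2, ... are i.i.d.
   with finite second moment, so the strong law gives almost surely convergence of their empirical
   mean and variance, the latter to a positive limit; in particular max(|y_1|, ..., |y_k|) is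
   o(sqrt k).  Along a fixed path with these properties, the k-fold resampling from y_1, ..., y_k is a
   row of a triangular array to which a central limit theorem applies, by Levy continuity and a Taylor
   bound for the characteristic function.  Since T(n) tends to infinity, the limit survives the random
   row index.

   The centring and scaling in the statistic are random but known given the first n states.  Instead
   of disintegrating the conditional law, the conditional probability is squeezed between values of
   the resampling distribution function at rational thresholds, where the hypothesis on the bootstrap
   blocks applies, outside one null set. *)
theory Submission
  imports Defs
begin

section \<open>The strong law of large numbers\<close>

text \<open>The hypotheses give the block sums a second moment and no more, so the strong law
  applied to their squares must work under a finite first moment. This is why it rests on a maximal
  inequality and a zero-one law instead of variance estimates.

  Two processes occur: the given one on \<open>M\<close>, known through conditional expectations,
  and the coordinate process under \<open>path_law\<close>, for which the visits to the atom are
  assumed. Both satisfy the same one-step property, and the law of the future of the first is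
  expressed through the second. The strong Markov property is obtained by splitting over the values
  \<open>m\<close> of a return time, so that only fixed times occur.

  The bootstrap hypothesis holds, for each fixed set of block vectors, outside a null set that
  depends on the set. The event of interest has a data-dependent threshold with uncountably many
  possible values; this is what forces rational thresholds. The squeeze only reaches levels strictly
  below and above \<open>x\<close>, and continuity of the normal distribution function closes the
  gap.\<close>

primrec prefix_max :: "nat \<Rightarrow> (nat \<Rightarrow> real) \<Rightarrow> real" where
  "prefix_max 0 x = 0"
| "prefix_max (Suc n) x = max 0 (x 0 + prefix_max n (\<lambda>i. x (Suc i)))"

lemma prefix_max_nonneg: "0 \<le> prefix_max n x"
  by (cases n) auto

lemma prefix_max_mono: "prefix_max n x \<le> prefix_max (Suc n) x"
proof (induction n arbitrary: x)
  case (Suc n)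
  show ?case using Suc[of "\<lambda>i. x (Suc i)"] by simp
qed simp

text \<open>\<open>prefix_max n x\<close> is the largest partial sum over at most \<open>n\<close>
  terms, the empty sum included. Its recursion peels off the first term rather than the last,
  because Garsia's argument compares the sequence with its shift.\<close>

lemma sum_le_prefix_max: "k \<le> n \<Longrightarrow> (\<Sum>i<k. x i) \<le> prefix_max n x"
proof (induction n arbitrary: k x)
  case (Suc n)
  show ?case
  proof (cases k)
    case (Suc l)
    have "(\<Sum>i<k. x i) = x 0 + (\<Sum>i<l. x (Suc i))"
      unfolding Suc by (rule sum.lessThan_Suc_shift)
    also have "(\<Sum>i<l. x (Suc i)) \<le> prefix_max n (\<lambda>i. x (Suc i))"
      using Suc.IH[of l "\<lambda>i. x (Suc i)"] Suc.prems Suc by simp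
    finally show ?thesis by simp
  qed (use prefix_max_nonneg[of "Suc n" x] in simp)
qed simp

lemma measurable_prefix_max [measurable (raw)]:
  "(\<And>i. (\<lambda>\<omega>. Y i \<omega>) \<in> borel_measurable N) \<Longrightarrow> (\<lambda>\<omega>. prefix_max n (\<lambda>i. Y i \<omega>)) \<in> borel_measurable N"
  by (induction n arbitrary: Y) simp_all

lemma measurable_paths:
  "(\<And>i. Y i \<in> M \<rightarrow>\<^sub>M N) \<Longrightarrow> (\<lambda>\<omega> i. Y i \<omega>) \<in> M \<rightarrow>\<^sub>M PiM UNIV (\<lambda>_. N)"
  by (intro measurable_PiM_single') (auto dest: measurable_space)

context prob_space
begin

definition iid :: "(nat \<Rightarrow> 'a \<Rightarrow> real) \<Rightarrow> bool" where
  "iid Y \<longleftrightarrow> indep_vars (\<lambda>_. borel) Y UNIV \<and> (\<forall>i. distr M borel (Y i) = distr M borel (Y 0))"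

lemma iid_measurable: "iid Y \<Longrightarrow> Y i \<in> borel_measurable M"
  unfolding iid_def indep_vars_def by auto

lemma iid_compose:
  assumes "iid Y" and [measurable]: "g \<in> borel_measurable borel"
  shows "iid (\<lambda>i \<omega>. g (Y i \<omega>))"
proof -
  note [measurable] = iid_measurable[OF assms(1)]
  have *: "distr M borel (\<lambda>\<omega>. g (Y i \<omega>)) = distr (distr M borel (Y i)) borel g" for i
    by (simp add: distr_distr comp_def)
  have ind: "indep_vars (\<lambda>_. borel) Y UNIV" and d: "\<And>i. distr M borel (Y i) = distr M borel (Y 0)"
    using assms unfolding iid_def by blast+
  have "distr M borel (\<lambda>\<omega>. g (Y i \<omega>)) = distr M borel (\<lambda>\<omega>. g (Y 0 \<omega>))" for i
    unfolding * by (simp only: d[of i])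
  moreover have "indep_vars (\<lambda>_. borel) (\<lambda>i \<omega>. g (Y i \<omega>)) UNIV"
    by (rule indep_vars_compose2[OF ind]) simp
  ultimately show ?thesis unfolding iid_def by blast
qed

lemma iid_integral:
  assumes "iid Y"
  shows "integrable M (Y i) \<longleftrightarrow> integrable M (Y 0)" "expectation (Y i) = expectation (Y 0)"
proof -
  note [measurable] = iid_measurable[OF assms]
  have d: "distr M borel (Y i) = distr M borel (Y 0)" using assms unfolding iid_def by blast
  have "integrable M (Y j) \<longleftrightarrow> integrable (distr M borel (Y j)) (\<lambda>x. x)" for j
    by (rule integrable_distr_eq[symmetric]) simp_all
  then show "integrable M (Y i) \<longleftrightarrow> integrable M (Y 0)"
    by (simp only: d)
  have "expectation (Y j) = integral\<^sup>L (distr M borel (Y j)) (\<lambda>x. x)" for j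
    by (rule integral_distr[symmetric]) simp_all
  then show "expectation (Y i) = expectation (Y 0)"
    by (simp only: d)
qed

text \<open>Stationarity: by independence the joint law is the product of the marginals, and a
  product of equal factors is unchanged when its coordinates are reindexed along
  \<open>Suc\<close>.\<close>

lemma iid_shift_law:
  assumes "iid Y"
  shows "distr M (PiM UNIV (\<lambda>_. borel)) (\<lambda>\<omega> i. Y (Suc i) \<omega>) = distr M (PiM UNIV (\<lambda>_. borel)) (\<lambda>\<omega> i. Y i \<omega>)"
proof -
  note [measurable] = iid_measurable[OF assms]
  have d: "distr M borel (Y i) = distr M borel (Y 0)" for i
    using assms unfolding iid_def by blast
  have ind: "indep_vars (\<lambda>_. borel) Y UNIV" using assms unfolding iid_def by blast
  let ?P = "PiM UNIV (\<lambda>_::nat. borel :: real measure)"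
  have [measurable]: "(\<lambda>\<omega> i. Y i \<omega>) \<in> M \<rightarrow>\<^sub>M ?P" "(\<lambda>\<omega> i. \<omega> (Suc i)) \<in> ?P \<rightarrow>\<^sub>M ?P"
    by (rule measurable_paths, simp)+
  have joint: "distr M ?P (\<lambda>\<omega> i. Y i \<omega>) = PiM UNIV (\<lambda>i. distr M borel (Y i))"
    using ind by (subst (asm) indep_vars_iff_distr_eq_PiM) (simp_all add: restrict_UNIV)
  have [measurable_cong]: "sets (PiM UNIV (\<lambda>i. distr M borel (Y i))) = sets ?P"
    by (intro sets_PiM_cong) simp_all
  have "distr M ?P (\<lambda>\<omega> i. Y (Suc i) \<omega>) = distr (distr M ?P (\<lambda>\<omega> i. Y i \<omega>)) ?P (\<lambda>\<omega> i. \<omega> (Suc i))"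
    by (simp add: distr_distr comp_def)
  also have "\<dots> = distr (PiM UNIV (\<lambda>i. distr M borel (Y i))) (PiM UNIV (\<lambda>i. distr M borel (Y (Suc i)))) (\<lambda>\<omega> i. \<omega> (Suc i))"
    unfolding joint by (intro distr_cong refl sets_PiM_cong) simp_all
  also have "\<dots> = PiM UNIV (\<lambda>i. distr M borel (Y (Suc i)))"
    using distr_PiM_reindex[of UNIV "\<lambda>i. distr M borel (Y i)" Suc UNIV]
    by (simp add: prob_space_distr restrict_UNIV)
  finally have "distr M ?P (\<lambda>\<omega> i. Y (Suc i) \<omega>) = PiM UNIV (\<lambda>i. distr M borel (Y (Suc i)))" .
  moreover have "distr M borel (Y (Suc i)) = distr M borel (Y i)" for i
    using d[of "Suc i"] d[of i] by simp
  ultimately show ?thesis using joint by simp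
qed

text \<open>Garsia's argument: the running maximum of the shifted sequence has the same expectation as that of
  the original one, and where the longer maximum is positive their difference is \<open>Y\<^sub>0\<close>.\<close>

lemma maximal_inequality:
  assumes "iid Y" and int: "integrable M (Y 0)"
  shows "0 \<le> expectation (\<lambda>\<omega>. Y 0 \<omega> * indicator {\<omega>. 0 < prefix_max (Suc n) (\<lambda>i. Y i \<omega>)} \<omega>)"
proof -
  note [measurable] = iid_measurable[OF assms(1)]
  have inti: "integrable M (Y i)" for i using iid_integral[OF assms(1)] int by blast
  have intm: "integrable M (\<lambda>\<omega>. prefix_max n (\<lambda>i. Y (i + m) \<omega>))" for n m
  proof (induction n arbitrary: m)
    case (Suc n)
    show ?case using Suc[of "Suc m"] inti[of m] by simp
  qed simp
  let ?p = "\<lambda>n \<omega>. prefix_max n (\<lambda>i. Y i \<omega>)" and ?q = "\<lambda>\<omega>. prefix_max n (\<lambda>i. Y (Suc i) \<omega>)"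
  have ip: "integrable M (?p k)" for k using intm[of k 0] by simp
  have iq: "integrable M ?q" using intm[of n 1] by simp
  have "expectation ?q = integral\<^sup>L (distr M (PiM UNIV (\<lambda>_. borel)) (\<lambda>\<omega> i. Y (Suc i) \<omega>)) (prefix_max n)"
    by (subst integral_distr) (auto intro!: measurable_paths)
  also have "\<dots> = integral\<^sup>L (distr M (PiM UNIV (\<lambda>_. borel)) (\<lambda>\<omega> i. Y i \<omega>)) (prefix_max n)"
    by (simp only: iid_shift_law[OF assms(1)])
  also have "\<dots> = expectation (?p n)"
    by (subst integral_distr) (auto intro!: measurable_paths)
  also have "\<dots> \<le> expectation (?p (Suc n))"
    by (intro integral_mono ip prefix_max_mono)
  finally have "0 \<le> expectation (\<lambda>\<omega>. ?p (Suc n) \<omega> - ?q \<omega>)"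
    by (subst Bochner_Integration.integral_diff) (use ip[of "Suc n"] iq in auto)
  also have "\<dots> \<le> expectation (\<lambda>\<omega>. Y 0 \<omega> * indicator {\<omega>. 0 < prefix_max (Suc n) (\<lambda>i. Y i \<omega>)} \<omega>)"
  proof (intro integral_mono)
    show "integrable M (\<lambda>\<omega>. Y 0 \<omega> * indicator {\<omega>. 0 < prefix_max (Suc n) (\<lambda>i. Y i \<omega>)} \<omega>)"
      by (rule Bochner_Integration.integrable_bound[OF int]) (auto split: split_indicator)
    \<comment> \<open>Where the longer maximum vanishes, the left side is minus \<open>?q\<close>,
      which is at most 0.\<close>
    show "?p (Suc n) \<omega> - ?q \<omega> \<le> Y 0 \<omega> * indicator {\<omega>. 0 < prefix_max (Suc n) (\<lambda>i. Y i \<omega>)} \<omega>" for \<omega>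
      using prefix_max_nonneg[of n "\<lambda>i. Y (Suc i) \<omega>"] by (auto split: split_indicator)
  qed (use ip[of "Suc n"] iq in auto)
  finally show ?thesis .
qed

text \<open>Unboundedness of the partial sums is a tail event, so it has probability 0 or 1. If it
  were almost sure, the indicators in the maximal inequality would tend to 1, and dominated
  convergence would force a nonnegative mean.\<close>

lemma partial_sums_bounded_above:
  assumes "iid Y" and int: "integrable M (Y 0)" and neg: "expectation (Y 0) < 0"
  shows "AE \<omega> in M. \<exists>B::nat. \<forall>k. (\<Sum>i<k. Y i \<omega>) \<le> real B"
proof -
  note [measurable] = iid_measurable[OF assms(1)]
  define U where "U = {\<omega>\<in>space M. \<forall>B::nat. \<exists>k. real B < (\<Sum>i<k. Y i \<omega>)}"
  define A where "A i = {Y i -` C \<inter> space M |C. C \<in> sets borel}" for i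
  have [measurable]: "U \<in> sets M" unfolding U_def by measurable
  have "prob U = 0 \<or> prob U = 1"
  proof (rule kolmogorov_0_1_law[of A])
    show "sigma_algebra (space M) (A i)" for i
      unfolding A_def sets_vimage_algebra2[of "Y i" "space M" borel, simplified, symmetric]
      using sets.sigma_algebra_axioms[of "vimage_algebra (space M) (Y i) borel"] by simp
    show "indep_sets A UNIV"
      using assms(1) unfolding iid_def indep_vars_def2 A_def by blast
    show "U \<in> tail_events A"
      unfolding tail_events_def
    proof
      fix n
      define T where "T = sigma (space M) (\<Union>(A ` {n..}))"
      have sub: "\<Union>(A ` {n..}) \<subseteq> Pow (space M)" unfolding A_def by auto
      have sT: "space T = space M" "sets T = sigma_sets (space M) (\<Union>(A ` {n..}))"
        unfolding T_def using sub by (simp_all add: space_measure_of sets_measure_of)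
      have [measurable]: "Y (i + n) \<in> borel_measurable T" for i
      proof (rule measurableI)
        fix C :: "real set" assume "C \<in> sets borel"
        then show "Y (i + n) -` C \<inter> space T \<in> sets T"
          unfolding sT by (intro sigma_sets.Basic) (auto simp: A_def intro!: bexI[of _ "i + n"])
      qed simp
      have "U = {\<omega>\<in>space T. \<forall>B::nat. \<exists>k. real B < (\<Sum>i<k. Y (i + n) \<omega>)}"
      proof -
        have "(\<forall>B::nat. \<exists>k. real B < (\<Sum>i<k. Y i \<omega>)) \<longleftrightarrow> (\<forall>B::nat. \<exists>k. real B < (\<Sum>i<k. Y (i + n) \<omega>))" for \<omega>
        proof -
          \<comment> \<open>Dropping the first \<open>n\<close> terms changes a partial sum by at
            most \<open>c\<close>. The same \<open>c\<close> bounds the partial sums of length at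
            most \<open>n\<close>, so a sum exceeding \<open>real D\<close> must have more than
            \<open>n\<close> terms.\<close>
          define c where "c = (\<Sum>i<n. \<bar>Y i \<omega>\<bar>)"
          have split: "(\<Sum>i<k + n. Y i \<omega>) = (\<Sum>i<n. Y i \<omega>) + (\<Sum>i<k. Y (i + n) \<omega>)" for k
            by (induction k) (auto simp: add.commute)
          have c0: "\<bar>\<Sum>i<j. Y i \<omega>\<bar> \<le> c" if "j \<le> n" for j
          proof -
            have "\<bar>\<Sum>i<j. Y i \<omega>\<bar> \<le> (\<Sum>i<j. \<bar>Y i \<omega>\<bar>)" by (rule sum_abs)
            also have "\<dots> \<le> c" unfolding c_def using that by (intro sum_mono2) auto
            finally show ?thesis .
          qed
          have c: "\<bar>\<Sum>i<n. Y i \<omega>\<bar> \<le> c" by (rule c0) simp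
          show ?thesis
          proof safe
            fix B :: nat assume *: "\<forall>B::nat. \<exists>k. real B < (\<Sum>i<k. Y i \<omega>)"
            obtain D :: nat where D: "real B + c \<le> real D" using real_arch_simple by blast
            obtain k where k: "real D < (\<Sum>i<k. Y i \<omega>)" using * by blast
            have "\<not> k \<le> n" using c0[of k] k D by auto
            then have "k = (k - n) + n" by simp
            then have "(\<Sum>i<k. Y i \<omega>) = (\<Sum>i<n. Y i \<omega>) + (\<Sum>i<k - n. Y (i + n) \<omega>)" using split by metis
            then show "\<exists>k. real B < (\<Sum>i<k. Y (i + n) \<omega>)" using k D c by (intro exI[of _ "k - n"]) linarith
          next
            fix B :: nat assume *: "\<forall>B::nat. \<exists>k. real B < (\<Sum>i<k. Y (i + n) \<omega>)"
            obtain D :: nat where D: "real B + c \<le> real D" using real_arch_simple by blast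
            obtain k where k: "real D < (\<Sum>i<k. Y (i + n) \<omega>)" using * by blast
            show "\<exists>k. real B < (\<Sum>i<k. Y i \<omega>)" using k D c split[of k] by (intro exI[of _ "k + n"]) linarith
          qed
        qed
        then show ?thesis unfolding U_def sT by blast
      qed
      also have "\<dots> \<in> sets T" by measurable
      finally show "U \<in> sigma_sets (space M) (\<Union>(A ` {n..}))" unfolding sT .
    qed
  qed
  moreover have "prob U \<noteq> 1"
  proof
    assume "prob U = 1"
    then have AEU: "AE \<omega> in M. \<omega> \<in> U" using prob_eq_1[of U] by simp
    let ?I = "\<lambda>n \<omega>. Y 0 \<omega> * indicator {\<omega>. 0 < prefix_max (Suc n) (\<lambda>i. Y i \<omega>)} \<omega>"
    have "(\<lambda>n. expectation (?I n)) \<longlonglongrightarrow> expectation (Y 0)"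
    proof (rule integral_dominated_convergence[where w="\<lambda>\<omega>. \<bar>Y 0 \<omega>\<bar>"])
      show "AE \<omega> in M. (\<lambda>n. ?I n \<omega>) \<longlonglongrightarrow> Y 0 \<omega>"
        using AEU
      proof eventually_elim
        case (elim \<omega>)
        then obtain k where k: "real 0 < (\<Sum>i<k. Y i \<omega>)" unfolding U_def by blast
        have "\<forall>\<^sub>F n in sequentially. ?I n \<omega> = Y 0 \<omega>"
          using eventually_ge_at_top[of k]
        proof eventually_elim
          case (elim n)
          then have "0 < prefix_max (Suc n) (\<lambda>i. Y i \<omega>)"
            using k sum_le_prefix_max[of k "Suc n" "\<lambda>i. Y i \<omega>"] by linarith
          then show ?case by (simp del: prefix_max.simps)
        qed
        then show ?case by (rule tendsto_eventually)
      qed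
      show "integrable M (\<lambda>\<omega>. \<bar>Y 0 \<omega>\<bar>)" using int by simp
    qed (auto split: split_indicator)
    moreover have "0 \<le> expectation (?I n)" for n by (rule maximal_inequality[OF assms(1,2)])
    ultimately have "0 \<le> expectation (Y 0)" by (intro LIMSEQ_le_const) auto
    with neg show False by simp
  qed
  ultimately have "prob U = 0" by simp
  then have "AE \<omega> in M. \<omega> \<notin> U"
    using prob_eq_0 by simp
  then show ?thesis using AE_space
    by eventually_elim (auto simp: U_def not_less)
qed

text \<open>Centring at the mean plus \<open>e / 2\<close> makes the drift negative, so the centred
  partial sums stay below a random constant; division by \<open>k\<close> makes this constant
  smaller than the other \<open>e / 2\<close>.\<close>

lemma limsup_mean_le:
  assumes "iid Y" "integrable M (Y 0)" and "0 < e"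
  shows "AE \<omega> in M. \<forall>\<^sub>F k in sequentially. (\<Sum>i<k. Y i \<omega>) / real k < expectation (Y 0) + e"
proof -
  let ?c = "expectation (Y 0) + e / 2"
  have "iid (\<lambda>i \<omega>. Y i \<omega> - ?c)" by (rule iid_compose[OF assms(1)]) simp
  then have "AE \<omega> in M. \<exists>B::nat. \<forall>k. (\<Sum>i<k. Y i \<omega> - ?c) \<le> real B"
    by (rule partial_sums_bounded_above) (use assms in \<open>simp_all add: prob_space\<close>)
  then show ?thesis
  proof eventually_elim
    case (elim \<omega>)
    then obtain B :: nat where B: "\<And>k. (\<Sum>i<k. Y i \<omega> - ?c) \<le> real B" by blast
    obtain K :: nat where K: "real B / (e / 2) < real K" using reals_Archimedean2 by blast
    show ?case
      using eventually_ge_at_top[of "Suc K"]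
    proof eventually_elim
      case (elim k)
      have k: "0 < real k" using elim by simp
      have "real B < e / 2 * real K" using K assms(3) by (simp add: field_simps)
      also have "\<dots> \<le> e / 2 * real k" using elim assms(3) by (intro mult_left_mono) auto
      finally have "(\<Sum>i<k. Y i \<omega>) < real k * ?c + e / 2 * real k"
        using B[of k] by (simp add: sum_subtractf)
      also have "\<dots> = (expectation (Y 0) + e) * real k" by (simp add: algebra_simps)
      finally show ?case using k by (simp add: divide_less_eq)
    qed
  qed
qed

text \<open>The one-sided bound is applied to \<open>Y\<close> and to its negative. The tolerances
  \<open>1 / real (Suc m)\<close> keep the number of exceptional null sets countable.\<close>

theorem strong_law_of_large_numbers:
  assumes "iid Y" "integrable M (Y 0)"
  shows "AE \<omega> in M. (\<lambda>k. (\<Sum>i<k. Y i \<omega>) / real k) \<longlonglongrightarrow> expectation (Y 0)"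
proof -
  have "iid (\<lambda>i \<omega>. - Y i \<omega>)" by (rule iid_compose[OF assms(1)]) simp
  then have neg: "AE \<omega> in M. \<forall>\<^sub>F k in sequentially. (\<Sum>i<k. - Y i \<omega>) / real k < expectation (\<lambda>\<omega>. - Y 0 \<omega>) + 1 / real (Suc m)" for m
    by (rule limsup_mean_le) (use assms in auto)
  have "AE \<omega> in M. \<forall>m. (\<forall>\<^sub>F k in sequentially. (\<Sum>i<k. Y i \<omega>) / real k < expectation (Y 0) + 1 / real (Suc m)) \<and>
     (\<forall>\<^sub>F k in sequentially. (\<Sum>i<k. - Y i \<omega>) / real k < expectation (\<lambda>\<omega>. - Y 0 \<omega>) + 1 / real (Suc m))"
    unfolding AE_all_countable
  proof
    fix m
    show "AE \<omega> in M. (\<forall>\<^sub>F k in sequentially. (\<Sum>i<k. Y i \<omega>) / real k < expectation (Y 0) + 1 / real (Suc m)) \<and>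
     (\<forall>\<^sub>F k in sequentially. (\<Sum>i<k. - Y i \<omega>) / real k < expectation (\<lambda>\<omega>. - Y 0 \<omega>) + 1 / real (Suc m))"
      using limsup_mean_le[OF assms, of "1 / real (Suc m)"] neg[of m] by simp
  qed
  then show ?thesis
  proof eventually_elim
    case (elim \<omega>)
    show ?case
    proof (rule tendstoI)
      fix e :: real assume "0 < e"
      then obtain m where m: "1 / real (Suc m) < e" using nat_approx_posE by blast
      show "\<forall>\<^sub>F k in sequentially. dist ((\<Sum>i<k. Y i \<omega>) / real k) (expectation (Y 0)) < e"
        using elim[rule_format, of m, THEN conjunct1] elim[rule_format, of m, THEN conjunct2]
      proof eventually_elim
        case (elim k)
        then show ?case using m by (simp add: dist_real_def sum_negf abs_less_iff)
      qed
    qed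
  qed
qed

end

section \<open>A central limit theorem for resampling\<close>

lemma isCont_cdf_std_normal: "isCont (cdf std_normal_distribution) x"
proof -
  interpret real_distribution std_normal_distribution by (rule real_dist_normal_dist)
  have "AE y in lborel. y \<in> {x} \<longrightarrow> ennreal (std_normal_density y) = 0"
    using AE_lborel_singleton[of x] by eventually_elim auto
  then have "{x} \<in> null_sets std_normal_distribution"
    by (subst null_sets_density_iff) auto
  then show ?thesis by (simp add: isCont_cdf measure_def null_sets_def)
qed

text \<open>The uniform bound by \<open>\<delta> * sqrt (r k)\<close> takes the place of Lindeberg's
  condition: it turns the third-order Taylor remainder into a small multiple of the variance. The
  row length \<open>r k\<close> is kept apart from the row index so that an initial stretch of rows
  can be cut off.\<close>

theorem triangular_array_clt:
  fixes P :: "nat \<Rightarrow> 'b measure" and g :: "nat \<Rightarrow> 'b \<Rightarrow> real" and r :: "nat \<Rightarrow> nat"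
  assumes P: "\<And>k. prob_space (P k)" and meas: "\<And>k. g k \<in> borel_measurable (P k)"
    and int2: "\<And>k. integrable (P k) (\<lambda>x. (g k x)\<^sup>2)"
    and mean: "\<And>k. integral\<^sup>L (P k) (g k) = 0" and var: "\<And>k. (\<integral>x. (g k x)\<^sup>2 \<partial>P k) = 1"
    and negligible: "\<And>\<delta>. 0 < \<delta> \<Longrightarrow> \<forall>\<^sub>F k in sequentially. AE x in P k. \<bar>g k x\<bar> \<le> \<delta> * sqrt (r k)"
    and r: "filterlim r at_top sequentially" "\<And>k. 1 \<le> r k"
  shows "(\<lambda>k. measure (PiM {1..r k} (\<lambda>_. P k))
      {b\<in>space (PiM {1..r k} (\<lambda>_. P k)). (\<Sum>j=1..r k. g k (b j)) / sqrt (r k) \<le> x})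
    \<longlonglongrightarrow> cdf std_normal_distribution x"
proof -
  note [measurable] = meas and [simp del] = One_nat_def
  interpret P: prob_space "P k" for k by (rule P)
  interpret PP: product_prob_space "\<lambda>_. P k" "{1..r k}" for k
    by unfold_locales
  define W where "W k b = (\<Sum>j=1..r k. g k (b j)) / sqrt (r k)" for k b
  have [measurable]: "W k \<in> borel_measurable (PiM {1..r k} (\<lambda>_. P k))" for k
    unfolding W_def by measurable
  define \<mu> where "\<mu> k = distr (PiM {1..r k} (\<lambda>_. P k)) borel (W k)" for k
  have dist: "real_distribution (\<mu> k)" for k
    unfolding \<mu>_def by (rule PP.P.real_distribution_distr) measurable
  define \<psi> where "\<psi> k = char (distr (P k) borel (g k))" for k
  have int1: "integrable (P k) (g k)" for k
    by (rule P.square_integrable_imp_integrable[OF _ int2]) simp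
  have norm_\<psi>: "cmod (\<psi> k t) \<le> 1" for k t
    unfolding \<psi>_def by (intro real_distribution.cmod_char_le_1 P.real_distribution_distr) simp
  have char_\<mu>: "char (\<mu> k) t = \<psi> k (t / sqrt (r k)) ^ r k" for k t
  proof -
    have "char (\<mu> k) t = (\<integral>b. iexp (t * W k b) \<partial>PiM {1..r k} (\<lambda>_. P k))"
      unfolding char_def \<mu>_def by (subst integral_distr) simp_all
    also have "\<dots> = (\<integral>b. (\<Prod>j\<in>{1..r k}. iexp (t / sqrt (r k) * g k (b j))) \<partial>PiM {1..r k} (\<lambda>_. P k))"
      unfolding W_def
      by (simp add: exp_sum[symmetric] sum_distrib_left sum_divide_distrib)
    also have "\<dots> = (\<Prod>j\<in>{1..r k}. \<integral>x. iexp (t / sqrt (r k) * g k x) \<partial>P k)"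
      by (intro PP.product_integral_prod P.integrable_iexp) (simp_all add: mult.commute)
    also have "\<dots> = \<psi> k (t / sqrt (r k)) ^ r k"
      unfolding \<psi>_def char_def by (subst integral_distr) simp_all
    finally show ?thesis .
  qed
  have conv: "(\<lambda>k. char (\<mu> k) t) \<longlonglongrightarrow> char std_normal_distribution t" for t
  proof -
    define q where "q k = (1 + (- (t\<^sup>2) / 2) / real (r k)) ^ r k" for k
    have bound: "cmod (char (\<mu> k) t - q k) \<le> \<bar>t\<bar> ^ 3 * \<delta> / 6"
      if AE: "AE x in P k. \<bar>g k x\<bar> \<le> \<delta> * sqrt (r k)" and n: "t\<^sup>2 / 4 \<le> r k" and "0 < \<delta>" for k \<delta>
    proof -
      let ?n = "real (r k)" and ?t = "t / sqrt (r k)"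
      have n0: "0 < ?n" using r(2)[of k] by simp
      have t2: "?t\<^sup>2 = t\<^sup>2 / ?n" by (simp add: power_divide)
      have "cmod (\<psi> k ?t - (1 - ?t\<^sup>2 * 1 / 2)) \<le>
          ?t\<^sup>2 / 6 * (\<integral>x. min (6 * (g k x)\<^sup>2) (\<bar>?t\<bar> * \<bar>g k x\<bar> ^ 3) \<partial>P k)"
        unfolding \<psi>_def by (intro P.char_approx3'[OF meas int1 int2 mean]) (simp_all add: mean var)
      \<comment> \<open>Of the minimum only the cubic term matters: one factor
        \<open>\<bar>g k x\<bar>\<close> is replaced by its uniform bound, which leaves the second
        moment, equal to 1.\<close>
      also have "(\<integral>x. min (6 * (g k x)\<^sup>2) (\<bar>?t\<bar> * \<bar>g k x\<bar> ^ 3) \<partial>P k)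
          \<le> (\<integral>x. (\<bar>?t\<bar> * (\<delta> * sqrt (r k))) * (g k x)\<^sup>2 \<partial>P k)"
      proof (rule integral_mono_AE)
        show "integrable (P k) (\<lambda>x. min (6 * (g k x)\<^sup>2) (\<bar>?t\<bar> * \<bar>g k x\<bar> ^ 3))"
          by (rule Bochner_Integration.integrable_bound[OF integrable_mult_right[OF int2[of k], of 6]]) auto
        show "AE x in P k. min (6 * (g k x)\<^sup>2) (\<bar>?t\<bar> * \<bar>g k x\<bar> ^ 3) \<le> (\<bar>?t\<bar> * (\<delta> * sqrt (r k))) * (g k x)\<^sup>2"
          using AE
        proof eventually_elim
          case (elim x)
          have "\<bar>g k x\<bar> ^ 3 = \<bar>g k x\<bar> * (g k x)\<^sup>2" by (simp add: power3_eq_cube power2_eq_square)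
          also have "\<dots> \<le> \<delta> * sqrt (r k) * (g k x)\<^sup>2" by (intro mult_right_mono elim) simp
          finally have "\<bar>?t\<bar> * \<bar>g k x\<bar> ^ 3 \<le> \<bar>?t\<bar> * (\<delta> * sqrt (r k) * (g k x)\<^sup>2)"
            by (intro mult_left_mono) auto
          then show ?case by (simp only: mult.assoc min_le_iff_disj simp_thms)
        qed
      qed (use int2 in simp)
      also have "\<dots> = \<bar>t\<bar> * \<delta>" using var[of k] n0 by (simp add: abs_divide)
      finally have "cmod (\<psi> k ?t - (1 - ?t\<^sup>2 * 1 / 2)) \<le> ?t\<^sup>2 / 6 * (\<bar>t\<bar> * \<delta>)"
        by (simp add: mult_left_mono)
      then have 1: "cmod (\<psi> k ?t - complex_of_real (1 + (- (t\<^sup>2) / 2) / ?n)) \<le> t\<^sup>2 / ?n / 6 * (\<bar>t\<bar> * \<delta>)"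
        unfolding t2 by (simp add: field_simps)
      \<comment> \<open>For bases of modulus at most 1, the difference of two powers is at most the
        exponent times the difference of the bases. For the real base
        \<open>1 - t\<^sup>2 / (2 * r k)\<close> the modulus condition is ensured by
        \<open>t\<^sup>2 / 4 \<le> r k\<close>.\<close>
      have "cmod (char (\<mu> k) t - q k) \<le> ?n * cmod (\<psi> k ?t - complex_of_real (1 + (- (t\<^sup>2) / 2) / ?n))"
        unfolding char_\<mu> q_def of_real_power
        using n n0
        by (intro norm_power_diff norm_\<psi>) (auto simp del: of_real_diff of_real_add simp: norm_of_real divide_le_eq intro!: abs_leI)
      also have "\<dots> \<le> ?n * (t\<^sup>2 / ?n / 6 * (\<bar>t\<bar> * \<delta>))"
        by (intro mult_left_mono 1) simp
      also have "\<dots> = \<bar>t\<bar> ^ 3 * \<delta> / 6"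
        using n0 by (simp add: power3_eq_cube power2_eq_square)
      finally show ?thesis .
    qed
    have "(\<lambda>k. char (\<mu> k) t - q k) \<longlonglongrightarrow> 0"
    proof (rule tendstoI)
      fix e :: real assume "0 < e"
      \<comment> \<open>The summand 1 in the denominator covers \<open>t = 0\<close>.\<close>
      define \<delta> where "\<delta> = e / (\<bar>t\<bar> ^ 3 + 1)"
      have t0: "0 < \<bar>t\<bar> ^ 3 + 1" by (intro add_nonneg_pos) auto
      have d: "0 < \<delta>" unfolding \<delta>_def using \<open>0 < e\<close> t0 by simp
      have "\<bar>t\<bar> ^ 3 * \<delta> \<le> (\<bar>t\<bar> ^ 3 + 1) * \<delta>" using d by simp
      also have "\<dots> = e" unfolding \<delta>_def using t0 by simp
      finally have *: "\<bar>t\<bar> ^ 3 * \<delta> / 6 < e" using \<open>0 < e\<close> by simp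
      have "\<forall>\<^sub>F k in sequentially. nat \<lceil>t\<^sup>2 / 4\<rceil> \<le> r k"
        using r(1) unfolding filterlim_at_top by blast
      with negligible[OF d] show "\<forall>\<^sub>F k in sequentially. dist (char (\<mu> k) t - q k) 0 < e"
      proof eventually_elim
        case (elim k)
        have "t\<^sup>2 / 4 \<le> r k" using elim(2) by linarith
        with bound[OF elim(1) _ d] * show ?case by simp
      qed
    qed
    moreover have "(\<lambda>k. q k) \<longlonglongrightarrow> exp (- (t\<^sup>2) / 2)"
      unfolding q_def
      by (rule filterlim_compose[OF tendsto_exp_limit_sequentially r(1)])
    then have "(\<lambda>k. complex_of_real (q k)) \<longlonglongrightarrow> complex_of_real (exp (- (t\<^sup>2) / 2))"
      by (rule tendsto_of_real)
    ultimately have "(\<lambda>k. (char (\<mu> k) t - q k) + q k) \<longlonglongrightarrow> 0 + complex_of_real (exp (- (t\<^sup>2) / 2))"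
      by (rule tendsto_add)
    then show ?thesis by (simp add: char_std_normal_distribution)
  qed
  have "weak_conv_m \<mu> std_normal_distribution"
    by (rule levy_continuity[OF dist real_dist_normal_dist conv])
  then have "(\<lambda>k. cdf (\<mu> k) x) \<longlonglongrightarrow> cdf std_normal_distribution x"
    unfolding weak_conv_m_def weak_conv_def using isCont_cdf_std_normal by blast
  moreover have "cdf (\<mu> k) x = measure (PiM {1..r k} (\<lambda>_. P k)) {b\<in>space (PiM {1..r k} (\<lambda>_. P k)). W k b \<le> x}" for k
    unfolding cdf_def \<mu>_def
    by (subst measure_distr) (auto intro!: arg_cong[where f="measure _"])
  ultimately show ?thesis unfolding W_def by simp
qed

section \<open>Resampling from a fixed sequence\<close>

lemma mean_tendsto_imp_last_negligible:
  fixes y :: "nat \<Rightarrow> real"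
  assumes "(\<lambda>k. (\<Sum>j=1..k. y j) / real k) \<longlonglongrightarrow> m"
  shows "(\<lambda>k. y k / real k) \<longlonglongrightarrow> 0"
proof -
  let ?A = "\<lambda>k. (\<Sum>j=1..k. y j) / real k"
  \<comment> \<open>The last summand is recovered from two consecutive averages, which have the same
    limit.\<close>
  have "(\<lambda>k. ?A (Suc k) - ?A k * (real k / real (Suc k))) \<longlonglongrightarrow> m - m * 1"
    by (intro tendsto_diff tendsto_mult LIMSEQ_Suc assms LIMSEQ_n_over_Suc_n)
  moreover have "?A (Suc k) - ?A k * (real k / real (Suc k)) = y (Suc k) / real (Suc k)" for k
    by (cases "k = 0") (simp_all add: add_divide_distrib)
  ultimately have "(\<lambda>k. y (Suc k) / real (Suc k)) \<longlonglongrightarrow> 0" by simp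
  then show ?thesis by (rule LIMSEQ_imp_Suc)
qed

text \<open>From some index \<open>J\<close> on, each term is small compared with the root of its
  own index, hence with \<open>sqrt k\<close>; the finitely many earlier terms are bounded by a
  constant, which \<open>sqrt k\<close> eventually outgrows.\<close>

lemma running_max_negligible:
  fixes y :: "nat \<Rightarrow> real"
  assumes "(\<lambda>k. (y k)\<^sup>2 / real k) \<longlonglongrightarrow> 0" "0 < \<delta>"
  shows "\<forall>\<^sub>F k in sequentially. \<forall>j\<in>{1..k}. \<bar>y j\<bar> \<le> \<delta> * sqrt k"
proof -
  have "\<forall>\<^sub>F k in sequentially. (y k)\<^sup>2 / real k < \<delta>\<^sup>2"
    using assms by (intro order_tendstoD(2)[OF assms(1)]) simp
  then obtain J where J: "\<And>k. J \<le> k \<Longrightarrow> (y k)\<^sup>2 / real k < \<delta>\<^sup>2"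
    unfolding eventually_sequentially by blast
  define C where "C = (\<Sum>j\<le>J. \<bar>y j\<bar>)"
  have "filterlim (\<lambda>k. sqrt (real k)) at_top sequentially"
    by (rule filterlim_compose[OF sqrt_at_top filterlim_real_sequentially])
  then have "\<forall>\<^sub>F k in sequentially. C / \<delta> \<le> sqrt (real k)"
    by (simp add: filterlim_at_top)
  then show ?thesis
  proof eventually_elim
    case (elim k)
    show ?case
    proof
      fix j assume j: "j \<in> {1..k}"
      show "\<bar>y j\<bar> \<le> \<delta> * sqrt k"
      proof (cases "J \<le> j")
        case True
        have "(y j)\<^sup>2 \<le> \<delta>\<^sup>2 * real j" using J[OF True] j by (simp add: divide_less_eq)
        then have "\<bar>y j\<bar> \<le> sqrt (\<delta>\<^sup>2 * real j)" by (intro real_le_rsqrt) simp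
        also have "\<dots> = \<delta> * sqrt (real j)" using assms(2) by (simp add: real_sqrt_mult)
        also have "\<dots> \<le> \<delta> * sqrt (real k)" using assms(2) j by (intro mult_left_mono) auto
        finally show ?thesis .
      next
        case False
        then have "\<bar>y j\<bar> \<le> C" unfolding C_def by (intro member_le_sum) auto
        also have "\<dots> \<le> \<delta> * sqrt k" using elim assms(2) by (simp add: divide_le_eq mult.commute)
        finally show ?thesis .
      qed
    qed
  qed
qed

text \<open>The sample size \<open>k\<close> is an explicit argument, so that the limit along a
  fixed sequence can be taken before the random number of blocks is substituted for it.
  \<open>empirical_block_law\<close> is the instance with
  \<open>k = num_blocks \<alpha> w n\<close>.\<close>

definition empirical_law :: "'b measure \<Rightarrow> (nat \<Rightarrow> 'b) \<Rightarrow> nat \<Rightarrow> 'b measure" where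
  "empirical_law N b k = distr (uniform_count_measure {1..k}) N b"

definition empirical_mean :: "(nat \<Rightarrow> real) \<Rightarrow> nat \<Rightarrow> real" where
  "empirical_mean y k = 1 / real k * (\<Sum>j=1..k. y j)"

definition empirical_sd :: "(nat \<Rightarrow> real) \<Rightarrow> nat \<Rightarrow> real" where
  "empirical_sd y k = sqrt (1 / real k * (\<Sum>j=1..k. (y j - empirical_mean y k)\<^sup>2))"

text \<open>Reduces convergence of the empirical deviation to that of the first two empirical
  moments.\<close>

lemma empirical_sd_eq:
  assumes "1 \<le> k"
  shows "empirical_sd y k = sqrt (empirical_mean (\<lambda>j. (y j)\<^sup>2) k - (empirical_mean y k)\<^sup>2)"
proof -
  let ?m = "empirical_mean y k"
  have m: "(\<Sum>j=1..k. y j) = real k * ?m" using assms by (simp add: empirical_mean_def)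
  have "(\<Sum>j=1..k. (y j - ?m)\<^sup>2) = (\<Sum>j=1..k. (y j)\<^sup>2) - 2 * ?m * (\<Sum>j=1..k. y j) + real k * ?m\<^sup>2"
    by (simp add: power2_diff sum.distrib sum_subtractf sum_distrib_left mult.commute mult.left_commute)
  also have "\<dots> = (\<Sum>j=1..k. (y j)\<^sup>2) - real k * ?m\<^sup>2"
    unfolding m by (simp add: power2_eq_square)
  finally show ?thesis
    using assms by (simp add: empirical_sd_def empirical_mean_def[of "\<lambda>j. (y j)\<^sup>2"] right_diff_distrib)
qed

context
  fixes N :: "'b measure" and b :: "nat \<Rightarrow> 'b"
  assumes b: "\<And>j. b j \<in> space N"
begin

lemma measurable_uniform_count: "b \<in> uniform_count_measure A \<rightarrow>\<^sub>M N"
  using b by (auto simp: measurable_def space_uniform_count_measure sets_uniform_count_measure)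

lemma sets_empirical_law [measurable_cong]: "sets (empirical_law N b k) = sets N"
  by (simp add: empirical_law_def)

lemma prob_space_empirical_law: "1 \<le> k \<Longrightarrow> prob_space (empirical_law N b k)"
  unfolding empirical_law_def
  by (intro prob_space.prob_space_distr prob_space_uniform_count_measure measurable_uniform_count) auto

lemma integral_empirical_law:
  fixes F :: "'b \<Rightarrow> real"
  assumes "F \<in> borel_measurable N"
  shows "integral\<^sup>L (empirical_law N b k) F = empirical_mean (\<lambda>j. F (b j)) k"
    and "integrable (empirical_law N b k) F"
proof -
  have fin: "finite {1..k}" by simp
  show "integral\<^sup>L (empirical_law N b k) F = empirical_mean (\<lambda>j. F (b j)) k"
    unfolding empirical_law_def empirical_mean_def
    by (subst integral_distr[OF measurable_uniform_count assms])
       (simp add: uniform_count_measure_def lebesgue_integral_point_measure_finite sum_distrib_left)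
  show "integrable (empirical_law N b k) F"
    unfolding empirical_law_def
    by (subst integrable_distr_eq[OF measurable_uniform_count assms])
       (simp add: uniform_count_measure_def integrable_point_measure_finite)
qed

lemma AE_empirical_law:
  assumes [measurable]: "Measurable.pred N Q" and "\<And>j. j \<in> {1..k} \<Longrightarrow> Q (b j)"
  shows "AE x in empirical_law N b k. Q x"
proof -
  have "AE j in uniform_count_measure {1..k}. Q (b j)"
    by (rule AE_I2) (simp add: space_uniform_count_measure assms(2))
  then show ?thesis
    unfolding empirical_law_def by (subst AE_distr_iff[OF measurable_uniform_count]) (auto simp: space_uniform_count_measure)
qed

text \<open>Standardizing with the empirical mean and deviation gives each row mean 0 and variance 1
  exactly, so only the uniform smallness of the summands remains. It follows from the convergence of
  the second moments, because the limiting deviation is positive.\<close>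

theorem resampling_clt:
  fixes F :: "'b \<Rightarrow> real"
  defines "y \<equiv> \<lambda>j. F (b j)"
  assumes [measurable]: "F \<in> borel_measurable N"
    and mean: "empirical_mean y \<longlonglongrightarrow> m1" and square: "empirical_mean (\<lambda>j. (y j)\<^sup>2) \<longlonglongrightarrow> m2"
    and var: "0 < m2 - m1\<^sup>2"
  shows "(\<lambda>k. measure (PiM {1..k} (\<lambda>_. empirical_law N b k))
      {c\<in>space (PiM {1..k} (\<lambda>_. N)).
         sqrt (real k) / empirical_sd y k * (1 / real k * (\<Sum>j=1..k. F (c j) - empirical_mean y k)) \<le> x})
    \<longlonglongrightarrow> cdf std_normal_distribution x"
    and "empirical_sd y \<longlonglongrightarrow> sqrt (m2 - m1\<^sup>2)"
proof -
  have "(\<lambda>k. sqrt (empirical_mean (\<lambda>j. (y j)\<^sup>2) k - (empirical_mean y k)\<^sup>2)) \<longlonglongrightarrow> sqrt (m2 - m1\<^sup>2)"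
    by (intro tendsto_intros mean square)
  then show sd: "empirical_sd y \<longlonglongrightarrow> sqrt (m2 - m1\<^sup>2)"
    by (rule Lim_transform_eventually)
       (use eventually_ge_at_top[of 1] in eventually_elim, simp add: empirical_sd_eq)
  define s0 where "s0 = sqrt (m2 - m1\<^sup>2)"
  have s0: "0 < s0" unfolding s0_def using var by simp
  have "\<forall>\<^sub>F k in sequentially. s0 / 2 < empirical_sd y k"
    using s0 by (intro order_tendstoD(1)[OF sd]) (simp add: s0_def[symmetric])
  then obtain K0 where K0: "\<And>k. K0 \<le> k \<Longrightarrow> s0 / 2 < empirical_sd y k"
    unfolding eventually_sequentially by blast
  \<comment> \<open>The central limit theorem asks for variance 1 in every row. Rows before
    \<open>K\<close> may be empty or have deviation 0, so the index is shifted by \<open>K\<close>;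
    \<open>LIMSEQ_offset\<close> undoes the shift.\<close>
  define K where "K = max K0 1"
  have sdK: "s0 / 2 < empirical_sd y (k + K)" for k using K0[of "k + K"] unfolding K_def by simp
  then have sdK0: "0 < empirical_sd y (k + K)" for k using s0 by (meson half_gt_zero order_less_trans)
  have K1: "1 \<le> k + K" for k unfolding K_def by simp
  have small: "(\<lambda>k. (y k)\<^sup>2 / real k) \<longlonglongrightarrow> 0"
    using square unfolding empirical_mean_def by (intro mean_tendsto_imp_last_negligible) simp
  define P where "P k = empirical_law N b (k + K)" for k
  define g where "g k u = (F u - empirical_mean y (k + K)) / empirical_sd y (k + K)" for k u
  have [measurable]: "g k \<in> borel_measurable N" for k unfolding g_def by measurable
  have [measurable_cong]: "sets (P k) = sets N" for k unfolding P_def by (rule sets_empirical_law)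
  have spPi: "space (PiM {1..k} (\<lambda>_. empirical_law N b l)) = space (PiM {1..k} (\<lambda>_. N))" for k l :: nat
    by (intro sets_eq_imp_space_eq sets_PiM_cong refl sets_empirical_law)
  have "(\<lambda>k. measure (PiM {1..k + K} (\<lambda>_. P k))
      {c\<in>space (PiM {1..k + K} (\<lambda>_. P k)). (\<Sum>j=1..k + K. g k (c j)) / sqrt (k + K) \<le> x})
    \<longlonglongrightarrow> cdf std_normal_distribution x"
  proof (rule triangular_array_clt)
    fix k
    show "prob_space (P k)" unfolding P_def by (rule prob_space_empirical_law[OF K1])
    show "integrable (P k) (\<lambda>x. (g k x)\<^sup>2)" unfolding P_def by (rule integral_empirical_law) simp
    have k0: "real (k + K) \<noteq> 0" using K1[of k] by linarith
    have "(\<Sum>j=1..k + K. y j - empirical_mean y (k + K)) = 0"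
      using k0 by (simp add: sum_subtractf empirical_mean_def)
    then have "empirical_mean (\<lambda>j. g k (b j)) (k + K) = 0"
      unfolding empirical_mean_def[of "\<lambda>j. g k (b j)"] unfolding g_def sum_divide_distrib[symmetric] y_def by simp
    then show "integral\<^sup>L (P k) (g k) = 0"
      unfolding P_def by (subst integral_empirical_law) simp_all
    have "(\<integral>x. (g k x)\<^sup>2 \<partial>P k) = 1 / real (k + K) * (\<Sum>j=1..k + K. (y j - empirical_mean y (k + K))\<^sup>2) / (empirical_sd y (k + K))\<^sup>2"
      unfolding P_def
      by (subst integral_empirical_law)
         (measurable, simp only: empirical_mean_def[of "\<lambda>j. (g k (b j))\<^sup>2"],
          simp only: g_def power_divide sum_divide_distrib[symmetric] y_def times_divide_eq_right)
    also have "1 / real (k + K) * (\<Sum>j=1..k + K. (y j - empirical_mean y (k + K))\<^sup>2) = (empirical_sd y (k + K))\<^sup>2"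
      unfolding empirical_sd_def by (subst real_sqrt_pow2) (simp_all add: sum_nonneg)
    finally show "(\<integral>x. (g k x)\<^sup>2 \<partial>P k) = 1" using sdK0[of k] by simp
    show "1 \<le> k + K" by (rule K1)
  next
    fix \<delta> :: real assume d: "0 < \<delta>"
    \<comment> \<open>Both \<open>\<bar>y j\<bar>\<close> and the empirical mean will be at most
      \<open>?d * sqrt (k + K)\<close> in modulus. Dividing the sum of the two bounds by a deviation
      above \<open>s0 / 2\<close> leaves at most \<open>\<delta> * sqrt (k + K)\<close>.\<close>
    let ?d = "\<delta> * s0 / 4"
    have d': "0 < ?d" using d s0 by simp
    have inf: "filterlim (\<lambda>k. k + K) at_top sequentially"
      by (rule filterlim_add_const_nat_at_top)
    have ev1: "\<forall>\<^sub>F k in sequentially. \<forall>j\<in>{1..k + K}. \<bar>y j\<bar> \<le> ?d * sqrt (k + K)"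
      using running_max_negligible[OF small d'] inf by (rule eventually_compose_filterlim)
    have "(\<lambda>k. \<bar>empirical_mean y (k + K)\<bar>) \<longlonglongrightarrow> \<bar>m1\<bar>"
      by (intro tendsto_rabs filterlim_compose[OF mean inf])
    then have "\<forall>\<^sub>F k in sequentially. \<bar>empirical_mean y (k + K)\<bar> < \<bar>m1\<bar> + 1"
      by (rule order_tendstoD) simp
    moreover have "filterlim (\<lambda>k. sqrt (real (k + K))) at_top sequentially"
      by (intro filterlim_compose[OF sqrt_at_top] filterlim_compose[OF filterlim_real_sequentially] inf)
    then have "\<forall>\<^sub>F k in sequentially. (\<bar>m1\<bar> + 1) / ?d \<le> sqrt (real (k + K))"
      unfolding filterlim_at_top by blast
    ultimately have "\<forall>\<^sub>F k in sequentially. \<bar>empirical_mean y (k + K)\<bar> \<le> ?d * sqrt (k + K)"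
    proof eventually_elim
      case (elim k)
      have "\<bar>m1\<bar> + 1 \<le> ?d * sqrt (k + K)"
        using elim(2) d' by (metis mult.commute pos_divide_le_eq)
      with elim(1) show ?case by linarith
    qed
    with ev1 show "\<forall>\<^sub>F k in sequentially. AE x in P k. \<bar>g k x\<bar> \<le> \<delta> * sqrt (k + K)"
    proof eventually_elim
      case (elim k)
      show ?case unfolding P_def
      proof (rule AE_empirical_law)
        fix j assume j: "j \<in> {1..k + K}"
        have "\<bar>y j - empirical_mean y (k + K)\<bar> \<le> 2 * (?d * sqrt (k + K))"
          using elim(1)[rule_format, OF j] elim(2) by linarith
        also have "\<dots> = \<delta> * sqrt (k + K) * (s0 / 2)" by simp
        also have "\<dots> \<le> \<delta> * sqrt (k + K) * empirical_sd y (k + K)"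
          using d sdK[of k] by (intro mult_left_mono) auto
        finally show "\<bar>g k (b j)\<bar> \<le> \<delta> * sqrt (k + K)"
          using sdK0[of k] by (simp add: g_def y_def abs_divide divide_le_eq)
      qed measurable
    qed
  next
    show "filterlim (\<lambda>k. k + K) at_top sequentially"
      by (rule filterlim_add_const_nat_at_top)
  qed measurable
  also have "(\<lambda>k. measure (PiM {1..k + K} (\<lambda>_. P k))
      {c\<in>space (PiM {1..k + K} (\<lambda>_. P k)). (\<Sum>j=1..k + K. g k (c j)) / sqrt (k + K) \<le> x}) =
    (\<lambda>k. measure (PiM {1..k + K} (\<lambda>_. empirical_law N b (k + K)))
      {c\<in>space (PiM {1..k + K} (\<lambda>_. N)).
         sqrt (real (k + K)) / empirical_sd y (k + K) * (1 / real (k + K) * (\<Sum>j=1..k + K. F (c j) - empirical_mean y (k + K))) \<le> x})"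
  proof
    fix k
    have "real (k + K) = sqrt (real (k + K)) * sqrt (real (k + K))" by simp
    then have "sqrt (real (k + K)) * (1 / real (k + K)) = 1 / sqrt (real (k + K))"
      using K1[of k] by (metis nonzero_mult_divide_mult_cancel_left2 mult.right_neutral times_divide_eq_right of_nat_0_less_iff real_sqrt_gt_0_iff less_numeral_extra(3) zero_less_one order_less_le_trans)
    then have "sqrt (real (k + K)) / empirical_sd y (k + K) * (1 / real (k + K) * z) = z / empirical_sd y (k + K) / sqrt (k + K)" for z
      by (metis (no_types, opaque_lifting) mult.commute mult.left_commute times_divide_eq_left mult_1)
    then show "measure (PiM {1..k + K} (\<lambda>_. P k))
      {c\<in>space (PiM {1..k + K} (\<lambda>_. P k)). (\<Sum>j=1..k + K. g k (c j)) / sqrt (k + K) \<le> x} =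
     measure (PiM {1..k + K} (\<lambda>_. empirical_law N b (k + K)))
      {c\<in>space (PiM {1..k + K} (\<lambda>_. N)).
         sqrt (real (k + K)) / empirical_sd y (k + K) * (1 / real (k + K) * (\<Sum>j=1..k + K. F (c j) - empirical_mean y (k + K))) \<le> x}"
      unfolding P_def g_def spPi sum_divide_distrib[symmetric] by simp
  qed
  finally show "(\<lambda>k. measure (PiM {1..k} (\<lambda>_. empirical_law N b k))
      {c\<in>space (PiM {1..k} (\<lambda>_. N)).
         sqrt (real k) / empirical_sd y k * (1 / real k * (\<Sum>j=1..k. F (c j) - empirical_mean y k)) \<le> x})
    \<longlonglongrightarrow> cdf std_normal_distribution x"
    by (rule LIMSEQ_offset)
qed

end

section \<open>Return times and blocks as functionals of the path\<close>

text \<open>The counting process whose inverse is \<open>return_time\<close>. Time 0 is not counted,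
  in line with the first return happening at time 1 or later.\<close>

primrec visits :: "'a set \<Rightarrow> (nat \<Rightarrow> 'a) \<Rightarrow> nat \<Rightarrow> nat" where
  "visits \<alpha> w 0 = 0"
| "visits \<alpha> w (Suc n) = (if w (Suc n) \<in> \<alpha> then Suc (visits \<alpha> w n) else visits \<alpha> w n)"

lemma visits_mono: "m \<le> n \<Longrightarrow> visits \<alpha> w m \<le> visits \<alpha> w n"
  by (rule lift_Suc_mono_le) auto

lemma Inf_enat_le_iff: "Inf A \<le> enat n \<longleftrightarrow> (\<exists>m\<le>n. enat m \<in> A)"
proof
  assume le: "Inf A \<le> enat n"
  then have "A \<noteq> {}" by (auto simp: Inf_enat_def)
  then have "Inf A \<in> A" by (auto simp: Inf_enat_def intro: LeastI)
  with le show "\<exists>m\<le>n. enat m \<in> A" by (cases "Inf A") auto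
next
  assume "\<exists>m\<le>n. enat m \<in> A"
  then obtain m where "m \<le> n" "enat m \<in> A" by blast
  then show "Inf A \<le> enat n" using Inf_lower[of "enat m" A] order_trans by fastforce
qed

lemma return_time_Suc_le_iff:
  "return_time \<alpha> w (Suc k) \<le> enat n \<longleftrightarrow> (\<exists>m\<le>n. return_time \<alpha> w k < enat m \<and> w m \<in> \<alpha>)"
  unfolding return_time.simps Inf_enat_le_iff by blast

declare return_time.simps(2) [simp del]

text \<open>This duality replaces infima in \<open>enat\<close> by a count that is recursive in
  time, from which locality and measurability of the return times can be read off.\<close>

lemma return_time_le_iff: "return_time \<alpha> w k \<le> enat n \<longleftrightarrow> k \<le> visits \<alpha> w n"
proof (induction k arbitrary: n)
  case 0
  then show ?case by (simp flip: zero_enat_def)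
next
  case (Suc k)
  have *: "return_time \<alpha> w k < enat m \<longleftrightarrow> (\<exists>l. m = Suc l \<and> k \<le> visits \<alpha> w l)" for m
  proof (cases m)
    case (Suc l)
    have "return_time \<alpha> w k < enat (Suc l) \<longleftrightarrow> return_time \<alpha> w k \<le> enat l"
      by (cases "return_time \<alpha> w k") auto
    then show ?thesis using Suc.IH[of l] Suc by simp
  qed (simp flip: zero_enat_def)
  have "(\<exists>m\<le>n. (\<exists>l. m = Suc l \<and> k \<le> visits \<alpha> w l) \<and> w m \<in> \<alpha>) \<longleftrightarrow> Suc k \<le> visits \<alpha> w n"
  proof
    assume "\<exists>m\<le>n. (\<exists>l. m = Suc l \<and> k \<le> visits \<alpha> w l) \<and> w m \<in> \<alpha>"
    then obtain l where l: "Suc l \<le> n" "k \<le> visits \<alpha> w l" "w (Suc l) \<in> \<alpha>" by blast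
    then show "Suc k \<le> visits \<alpha> w n" using visits_mono[OF l(1), of \<alpha> w] by simp
  next
    assume "Suc k \<le> visits \<alpha> w n"
    then show "\<exists>m\<le>n. (\<exists>l. m = Suc l \<and> k \<le> visits \<alpha> w l) \<and> w m \<in> \<alpha>"
    proof (induction n)
      case (Suc n)
      show ?case
      proof (cases "w (Suc n) \<in> \<alpha>")
        case False
        with Suc show ?thesis by (auto intro: le_SucI)
      qed (use Suc.prems in auto)
    qed simp
  qed
  then show ?case unfolding return_time_Suc_le_iff * .
qed

lemma eq_enat_iff: "t = enat n \<longleftrightarrow> t \<le> enat n \<and> (\<forall>m<n. \<not> t \<le> enat m)"
proof (cases t)
  case (enat x)
  have "x = n \<longleftrightarrow> x \<le> n \<and> (\<forall>m<n. \<not> x \<le> m)" by (cases "x < n") auto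
  then show ?thesis using enat by simp
qed simp

lemma enat_eqI:
  assumes *: "\<And>n. a \<le> enat n \<longleftrightarrow> b \<le> enat n"
  shows "a = b"
proof (cases a)
  case (enat x)
  then show ?thesis using eq_enat_iff[of a x] eq_enat_iff[of b x] * by simp
next
  case infinity
  then show ?thesis using * by (cases b) auto
qed

lemma return_time_eq_iff:
  "return_time \<alpha> w k = enat n \<longleftrightarrow> k \<le> visits \<alpha> w n \<and> (\<forall>m<n. \<not> k \<le> visits \<alpha> w m)"
  unfolding eq_enat_iff return_time_le_iff ..

lemma return_time_Suc_eq_iff:
  "return_time \<alpha> w (Suc k) = enat n \<longleftrightarrow>
    return_time \<alpha> w k < enat n \<and> w n \<in> \<alpha> \<and> (\<forall>l<n. return_time \<alpha> w k < enat l \<longrightarrow> w l \<notin> \<alpha>)"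
proof -
  have *: "(\<exists>m\<le>n. P m) \<and> (\<forall>m<n. \<not> (\<exists>l\<le>m. P l)) \<longleftrightarrow> P n \<and> (\<forall>l<n. \<not> P l)" for P
  proof
    assume *: "(\<exists>m\<le>n. P m) \<and> (\<forall>m<n. \<not> (\<exists>l\<le>m. P l))"
    then obtain m where "m \<le> n" "P m" by blast
    moreover have no: "\<forall>l<n. \<not> P l" using * by blast
    ultimately have "P n" by (cases "m < n") auto
    with no show "P n \<and> (\<forall>l<n. \<not> P l)" by blast
  qed (auto dest: le_less_trans)
  then show ?thesis
    unfolding eq_enat_iff[of "return_time \<alpha> w (Suc k)"] return_time_Suc_le_iff * by blast
qed

text \<open>The stretch up to the first visit is not a block, so there is one block fewer than
  visits; truncated subtraction covers the case of no visit.\<close>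

lemma num_blocks_eq: "num_blocks \<alpha> w n = visits \<alpha> w n - 1"
proof -
  have "{k. k = 0 \<or> return_time \<alpha> w (k + 1) \<le> enat n} = {..visits \<alpha> w n - 1}"
    unfolding return_time_le_iff by auto
  then show ?thesis unfolding num_blocks_def by (simp add: Max_eq_iff)
qed

text \<open>A block counted at time \<open>n\<close> ends by time \<open>n\<close>. This locality is
  what makes the statistics measurable with respect to \<open>history\<close>.\<close>

lemma block_local:
  assumes "\<And>i. i \<le> n \<Longrightarrow> w i = w' i"
  shows "num_blocks \<alpha> w n = num_blocks \<alpha> w' n"
    and "j \<in> {1..num_blocks \<alpha> w n} \<Longrightarrow> block \<alpha> w j = block \<alpha> w' j"
proof -
  have v: "visits \<alpha> w m = visits \<alpha> w' m" if "m \<le> n" for m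
    using that by (induction m) (auto simp: assms)
  have r: "return_time \<alpha> w k = return_time \<alpha> w' k \<and> return_time \<alpha> w k \<le> enat n" if k: "k \<le> visits \<alpha> w n" for k
  proof -
    have "return_time \<alpha> w k \<le> enat n" using k by (simp add: return_time_le_iff)
    then obtain m where m: "return_time \<alpha> w k = enat m" "m \<le> n" by (cases "return_time \<alpha> w k") auto
    then have "return_time \<alpha> w' k = enat m" unfolding return_time_eq_iff by (simp add: v)
    with m show ?thesis by simp
  qed
  show nb: "num_blocks \<alpha> w n = num_blocks \<alpha> w' n" unfolding num_blocks_eq v[OF order_refl] ..
  assume "j \<in> {1..num_blocks \<alpha> w n}"
  then have "Suc j \<le> visits \<alpha> w n" unfolding num_blocks_eq by auto
  then have "return_time \<alpha> w (Suc j) = return_time \<alpha> w' (Suc j)" "return_time \<alpha> w (Suc j) \<le> enat n"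
    "return_time \<alpha> w j = return_time \<alpha> w' j"
    using r[of j] r[of "Suc j"] by auto
  moreover from this(2) have "the_enat (return_time \<alpha> w (Suc j)) \<le> n"
    by (cases "return_time \<alpha> w (Suc j)") auto
  ultimately show "block \<alpha> w j = block \<alpha> w' j" unfolding block_def by (auto simp: assms)
qed

lemma mu_hat_eq:
  "mu_hat \<alpha> f w n = empirical_mean (\<lambda>j. block_sum f (block \<alpha> w j)) (num_blocks \<alpha> w n)"
  unfolding mu_hat_def empirical_mean_def ..

lemma sigma_hat_eq:
  "sigma_hat \<alpha> f w n = empirical_sd (\<lambda>j. block_sum f (block \<alpha> w j)) (num_blocks \<alpha> w n)"
  unfolding sigma_hat_def empirical_sd_def mu_hat_eq ..

lemma hat_local:
  assumes "\<And>i. i \<le> n \<Longrightarrow> w i = w' i"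
  shows "mu_hat \<alpha> f w n = mu_hat \<alpha> f w' n" "sigma_hat \<alpha> f w n = sigma_hat \<alpha> f w' n"
proof -
  have *: "(\<Sum>j=1..num_blocks \<alpha> w' n. g (block \<alpha> w j)) = (\<Sum>j=1..num_blocks \<alpha> w' n. g (block \<alpha> w' j))"
    for g :: "'a list \<Rightarrow> real"
    using block_local[where n=n and w=w and w'=w' and \<alpha>=\<alpha>] assms by (intro sum.cong) simp_all
  have nb: "num_blocks \<alpha> w n = num_blocks \<alpha> w' n"
    using block_local(1)[where n=n and w=w and w'=w' and \<alpha>=\<alpha>] assms by simp
  show mu: "mu_hat \<alpha> f w n = mu_hat \<alpha> f w' n"
    unfolding mu_hat_def nb * ..
  show "sigma_hat \<alpha> f w n = sigma_hat \<alpha> f w' n"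
    unfolding sigma_hat_def mu nb *[of "\<lambda>b. (block_sum f b - mu_hat \<alpha> f w' n)\<^sup>2"] ..
qed

lemma return_time_finite:
  assumes "\<exists>\<^sub>\<infinity>n. w n \<in> \<alpha>"
  shows "return_time \<alpha> w k \<noteq> \<infinity>"
proof (induction k)
  case (Suc k)
  then obtain m where m: "return_time \<alpha> w k = enat m" by auto
  obtain n where "m < n" "w n \<in> \<alpha>" using assms unfolding INFM_nat by blast
  then have "return_time \<alpha> w (Suc k) \<le> enat n"
    unfolding return_time_Suc_le_iff m by auto
  then show ?case by (cases "return_time \<alpha> w (Suc k)") auto
qed simp

lemma num_blocks_tendsto_infinity:
  assumes "\<exists>\<^sub>\<infinity>n. w n \<in> \<alpha>"
  shows "filterlim (num_blocks \<alpha> w) at_top sequentially"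
  unfolding filterlim_at_top
proof
  fix k
  obtain m where "return_time \<alpha> w (Suc k) = enat m" using return_time_finite[OF assms] by fastforce
  then have m: "Suc k \<le> visits \<alpha> w m" using return_time_le_iff[of \<alpha> w "Suc k" m] by simp
  show "\<forall>\<^sub>F n in sequentially. k \<le> num_blocks \<alpha> w n"
    using eventually_ge_at_top[of m]
  proof eventually_elim
    case (elim n)
    then show ?case using m visits_mono[of m n \<alpha> w] unfolding num_blocks_eq by linarith
  qed
qed

text \<open>Restarting at the \<open>j\<close>-th visit turns block \<open>j\<close> into block 0,
  which by the convention \<open>return_time \<alpha> w 0 = 0\<close> begins right after time 0.
  Finiteness of the end point gives \<open>the_enat\<close> its meaning.\<close>

lemma block_shift:
  assumes m: "return_time \<alpha> w j = enat m" and fin: "return_time \<alpha> w (Suc j) \<noteq> \<infinity>"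
  shows "block \<alpha> w j = block \<alpha> (\<lambda>i. w (m + i)) 0"
proof -
  obtain n where n: "return_time \<alpha> w (Suc j) = enat n" using fin by auto
  then have *: "m < n" "w n \<in> \<alpha>" "\<And>l. m < l \<Longrightarrow> l < n \<Longrightarrow> w l \<notin> \<alpha>"
    unfolding return_time_Suc_eq_iff m by auto
  have "return_time \<alpha> (\<lambda>i. w (m + i)) (Suc 0) = enat (n - m)"
    unfolding return_time_Suc_eq_iff using * by (auto simp: zero_enat_def)
  moreover have "[Suc m..<Suc n] = map (\<lambda>i. m + i) [Suc 0..<Suc (n - m)]"
    using *(1) map_add_upt[of m "n - m"] by (auto simp: list_eq_iff_nth_eq simp del: upt_Suc)
  ultimately show ?thesis unfolding block_def m n
    by (simp add: zero_enat_def comp_def del: upt_Suc)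
qed

text \<open>Neither the first return nor block 0 looks at time 0. Hence the law of this block will
  depend on the starting state only through its transition kernel.\<close>

lemma block_0_cong:
  assumes "\<And>i. 1 \<le> i \<Longrightarrow> w i = w' i"
  shows "block \<alpha> w 0 = block \<alpha> w' 0"
proof -
  have "return_time \<alpha> w (Suc 0) \<le> enat n \<longleftrightarrow> return_time \<alpha> w' (Suc 0) \<le> enat n" for n
    unfolding return_time_Suc_le_iff using assms by (auto simp: zero_enat_def Suc_le_eq)
  then have "return_time \<alpha> w (Suc 0) = return_time \<alpha> w' (Suc 0)"
    by (rule enat_eqI)
  then show ?thesis unfolding block_def using assms by auto
qed

lemma block_sum_block:
  "block_sum f (block \<alpha> w j) =
    (\<Sum>i = Suc (the_enat (return_time \<alpha> w j))..<Suc (the_enat (return_time \<alpha> w (Suc j))). f (w i))"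
  unfolding block_sum_def block_def
  by (simp add: interv_sum_list_conv_sum_set_nat comp_def del: upt_Suc)

section \<open>Measurability of return times and block sums\<close>

lemma measurable_count_spaceI:
  fixes g :: "'b \<Rightarrow> 'c :: countable"
  assumes "\<And>a. g -` {a} \<inter> space M \<in> sets M"
  shows "g \<in> M \<rightarrow>\<^sub>M count_space UNIV"
  using assms by (auto simp: measurable_count_space_eq_countable)

context
  fixes S :: "'a measure" and \<alpha> :: "'a set"
  assumes \<alpha> [measurable]: "\<alpha> \<in> sets S"
begin

lemma measurable_visits [measurable]:
  "(\<lambda>w. visits \<alpha> w n) \<in> PiM UNIV (\<lambda>_. S) \<rightarrow>\<^sub>M count_space UNIV"
proof (induction n)
  case (Suc n)
  have [measurable]: "(\<lambda>w. Suc (visits \<alpha> w n)) \<in> PiM UNIV (\<lambda>_. S) \<rightarrow>\<^sub>M count_space UNIV"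
    using measurable_compose[OF Suc, of Suc] by simp
  note [measurable] = Suc
  show ?case unfolding visits.simps by measurable
qed simp

lemma measurable_num_blocks [measurable]:
  "(\<lambda>w. num_blocks \<alpha> w n) \<in> PiM UNIV (\<lambda>_. S) \<rightarrow>\<^sub>M count_space UNIV"
  unfolding num_blocks_eq using measurable_compose[OF measurable_visits, of "\<lambda>x. x - 1"] by simp

lemma measurable_return_time [measurable]:
  "(\<lambda>w. return_time \<alpha> w k) \<in> PiM UNIV (\<lambda>_. S) \<rightarrow>\<^sub>M count_space UNIV"
proof (rule measurable_count_spaceI)
  fix t :: enat
  have "(\<lambda>w. return_time \<alpha> w k) -` {t} \<inter> space (PiM UNIV (\<lambda>_. S)) =
    {w \<in> space (PiM UNIV (\<lambda>_. S)). return_time \<alpha> w k = t}" by auto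
  also have "\<dots> \<in> sets (PiM UNIV (\<lambda>_. S))"
  proof (cases t)
    case (enat n)
    show ?thesis unfolding enat return_time_eq_iff by measurable
  next
    case infinity
    have "return_time \<alpha> w k = \<infinity> \<longleftrightarrow> (\<forall>n. \<not> return_time \<alpha> w k \<le> enat n)" for w
      by (cases "return_time \<alpha> w k") auto
    then show ?thesis unfolding infinity return_time_le_iff by simp
  qed
  finally show "(\<lambda>w. return_time \<alpha> w k) -` {t} \<inter> space (PiM UNIV (\<lambda>_. S)) \<in> sets (PiM UNIV (\<lambda>_. S))" .
qed

text \<open>Both summation limits are random but take countably many values, so it suffices to fix
  one of them at a time.\<close>

lemma measurable_block_sum_block [measurable]:
  assumes [measurable]: "f \<in> borel_measurable S"
  shows "(\<lambda>w. block_sum f (block \<alpha> w j)) \<in> borel_measurable (PiM UNIV (\<lambda>_. S))"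
proof -
  have [measurable]: "(\<lambda>w. the_enat (return_time \<alpha> w k)) \<in> PiM UNIV (\<lambda>_. S) \<rightarrow>\<^sub>M count_space UNIV" for k
    using measurable_compose[OF measurable_return_time, of the_enat] by simp
  have "(\<lambda>w. \<Sum>i = Suc a..<Suc (the_enat (return_time \<alpha> w (Suc j))). f (w i))
      \<in> borel_measurable (PiM UNIV (\<lambda>_. S))" for a
    by (rule measurable_compose_countable[where f="\<lambda>b w. \<Sum>i = Suc a..<Suc b. f (w i)"
          and g="\<lambda>w. the_enat (return_time \<alpha> w (Suc j))"]) measurable
  then show ?thesis
    unfolding block_sum_block
    by (rule measurable_compose_countable[where g="\<lambda>w. the_enat (return_time \<alpha> w j)" and
          f="\<lambda>a w. \<Sum>i = Suc a..<Suc (the_enat (return_time \<alpha> w (Suc j))). f (w i)"]) measurable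
qed

lemma measurable_hat [measurable]:
  assumes [measurable]: "f \<in> borel_measurable S"
  shows "(\<lambda>w. mu_hat \<alpha> f w n) \<in> borel_measurable (PiM UNIV (\<lambda>_. S))"
    and "(\<lambda>w. sigma_hat \<alpha> f w n) \<in> borel_measurable (PiM UNIV (\<lambda>_. S))"
proof -
  have m: "(\<lambda>w. empirical_mean (\<lambda>j. block_sum f (block \<alpha> w j)) k) \<in> borel_measurable (PiM UNIV (\<lambda>_. S))" for k
    unfolding empirical_mean_def by measurable
  note [measurable] = m
  have s: "(\<lambda>w. empirical_sd (\<lambda>j. block_sum f (block \<alpha> w j)) k) \<in> borel_measurable (PiM UNIV (\<lambda>_. S))" for k
    unfolding empirical_sd_def by measurable
  show "(\<lambda>w. mu_hat \<alpha> f w n) \<in> borel_measurable (PiM UNIV (\<lambda>_. S))"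
    unfolding mu_hat_eq by (rule measurable_compose_countable[OF m measurable_num_blocks])
  show "(\<lambda>w. sigma_hat \<alpha> f w n) \<in> borel_measurable (PiM UNIV (\<lambda>_. S))"
    unfolding sigma_hat_eq by (rule measurable_compose_countable[OF s measurable_num_blocks])
qed

end

section \<open>The measurable space of finite blocks\<close>

lemma space_block_space: "space (block_space S) = lists (space S)"
  unfolding block_space_def by (rule space_measure_of_conv)

lemma cylinder_in_block_space:
  assumes "\<And>i. i < k \<Longrightarrow> A i \<in> sets S"
  shows "{b. length b = k \<and> (\<forall>i<k. b ! i \<in> A i)} \<in> sets (block_space S)"
proof -
  have "{{b. length b = k \<and> (\<forall>i<k. b ! i \<in> A i)} |k A. \<forall>i<k. A i \<in> sets S} \<subseteq> Pow (lists (space S))"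
    by (fastforce simp: in_set_conv_nth dest: sets.sets_into_space)
  then show ?thesis
    unfolding block_space_def using assms
    by (subst sets_measure_of) (auto intro!: sigma_sets.Basic)
qed

lemma measurable_length: "length \<in> block_space S \<rightarrow>\<^sub>M count_space UNIV"
proof (rule measurable_count_spaceI)
  fix k :: nat
  have "length -` {k} \<inter> space (block_space S) = {b. length b = k \<and> (\<forall>i<k. b ! i \<in> space S)}"
    unfolding space_block_space lists_eq_set subset_code(1) all_set_conv_all_nth by auto
  then show "length -` {k} \<inter> space (block_space S) \<in> sets (block_space S)"
    using cylinder_in_block_space[of k "\<lambda>_. space S" S] by simp
qed

lemma measurable_block_sum:
  assumes f: "f \<in> borel_measurable S"
  shows "block_sum f \<in> borel_measurable (block_space S)"
proof -
  \<comment> \<open>\<open>b ! i\<close> is meaningful only for \<open>i < length b\<close>, so the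
    summands are cut off outside the lists of length \<open>k\<close>. The cut-off value 0 is why
    the lists of other lengths join the preimage when \<open>0 \<in> D\<close>.\<close>
  define H where "H k i b = (if length b = k \<and> i < k then f (b ! i) else 0)" for k i and b :: "'a list"
  note [measurable] = measurable_length
  have H: "H k i \<in> borel_measurable (block_space S)" for k i
  proof (cases "i < k")
    case True
    show ?thesis
    proof (rule measurableI)
      fix D :: "real set" assume D: "D \<in> sets borel"
      let ?L = "{b \<in> space (block_space S). length b \<noteq> k}"
      let ?C = "{b. length b = k \<and> (\<forall>l<k. b ! l \<in> (if l = i then f -` D \<inter> space S else space S))}"
      have L: "?L \<in> sets (block_space S)" by measurable
      have C: "?C \<in> sets (block_space S)"
        using measurable_sets[OF f D] by (intro cylinder_in_block_space) auto
      have "H k i -` D \<inter> space (block_space S) = ?C \<union> (if 0 \<in> D then ?L else {})"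
        using True by (fastforce simp: H_def space_block_space in_set_conv_nth split: if_splits)
      then show "H k i -` D \<inter> space (block_space S) \<in> sets (block_space S)" using L C by auto
    qed simp
  next
    case False
    then have "H k i = (\<lambda>_. 0)" by (simp add: H_def fun_eq_iff)
    then show ?thesis by simp
  qed
  have "(\<lambda>b. (\<lambda>k. \<Sum>i<k. H k i b) (length b)) \<in> borel_measurable (block_space S)"
    by (rule measurable_compose_countable) (use H in measurable)
  moreover have "block_sum f b = (\<lambda>k. \<Sum>i<k. H k i b) (length b)" for b
    unfolding block_sum_def H_def by (simp add: sum_list_sum_nth lessThan_atLeast0)
  ultimately show ?thesis by (simp add: fun_eq_iff cong: measurable_cong)
qed

lemma block_in_space: "(\<And>i. w i \<in> space S) \<Longrightarrow> block \<alpha> w j \<in> space (block_space S)"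
  unfolding block_def space_block_space by auto

section \<open>The sigma-algebra of the first states\<close>

lemma space_history [simp]: "space (history M S X n) = space M"
  unfolding history_def by simp

context
  fixes M :: "'w measure" and S :: "'a measure" and X :: "nat \<Rightarrow> 'w \<Rightarrow> 'a"
  assumes X [measurable]: "\<And>n. X n \<in> M \<rightarrow>\<^sub>M S"
begin

lemma subalgebra_history: "subalgebra M (history M S X n)"
proof -
  have "(\<lambda>\<omega>. \<lambda>i\<in>{..n}. X i \<omega>) \<in> M \<rightarrow>\<^sub>M PiM {..n} (\<lambda>_. S)"
    by (rule measurable_restrict) simp
  from sets_image_in_sets[OF refl this] show ?thesis
    unfolding subalgebra_def history_def by simp
qed

text \<open>Freezing the path at time \<open>n\<close> gives a path that is a function of the first
  states only. A functional that is local up to \<open>n\<close> cannot distinguish it from the true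
  path.\<close>

lemma measurable_history:
  assumes G: "G \<in> PiM UNIV (\<lambda>_. S) \<rightarrow>\<^sub>M N"
    and local: "\<And>w w'. (\<And>i. i \<le> n \<Longrightarrow> w i = w' i) \<Longrightarrow> G w = G w'"
  shows "(\<lambda>\<omega>. G (\<lambda>i. X i \<omega>)) \<in> history M S X n \<rightarrow>\<^sub>M N"
proof -
  have "(\<lambda>\<omega>. \<lambda>i\<in>{..n}. X i \<omega>) \<in> M \<rightarrow>\<^sub>M PiM {..n} (\<lambda>_. S)"
    by (rule measurable_restrict) simp
  then have h: "(\<lambda>\<omega>. \<lambda>i\<in>{..n}. X i \<omega>) \<in> history M S X n \<rightarrow>\<^sub>M PiM {..n} (\<lambda>_. S)"
    unfolding history_def
    by (intro measurable_vimage_algebra1 funcsetI) (rule measurable_space)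
  have "(\<lambda>\<omega>. X (min i n) \<omega>) \<in> history M S X n \<rightarrow>\<^sub>M S" for i
    using measurable_compose[OF h measurable_component_singleton[of "min i n" "{..n}"]]
    by simp
  then have "(\<lambda>\<omega> i. X (min i n) \<omega>) \<in> history M S X n \<rightarrow>\<^sub>M PiM UNIV (\<lambda>_. S)"
    by (rule measurable_paths)
  then have "(\<lambda>\<omega>. G (\<lambda>i. X (min i n) \<omega>)) \<in> history M S X n \<rightarrow>\<^sub>M N"
    by (rule measurable_compose[OF _ G])
  moreover have "G (\<lambda>i. X (min i n) \<omega>) = G (\<lambda>i. X i \<omega>)" for \<omega>
    by (rule local) (simp add: min_def)
  ultimately show ?thesis by simp
qed

end

section \<open>The Markov property on path space\<close>

abbreviation paths :: "'a measure \<Rightarrow> (nat \<Rightarrow> 'a) measure" where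
  "paths S \<equiv> PiM UNIV (\<lambda>_. S)"

definition cylinder :: "'a measure \<Rightarrow> (nat \<Rightarrow> 'a set) \<Rightarrow> nat \<Rightarrow> (nat \<Rightarrow> 'a) set" where
  "cylinder S A n = {w\<in>space (paths S). \<forall>i\<le>n. w i \<in> A i}"

text \<open>The length is \<open>Suc n\<close>, so that coordinate 1 is always within range;
  overwriting coordinate 0 by coordinate 1 in \<open>path_law_atom\<close> relies on this.\<close>

lemma prod_algebra_cylinder:
  assumes "C \<in> prod_algebra UNIV (\<lambda>_::nat. S)"
  obtains A n where "\<And>i. A i \<in> sets S" "C = cylinder S A (Suc n)"
proof (rule prod_algebraE[OF assms])
  fix J E assume J: "C = prod_emb UNIV (\<lambda>_. S) J (\<Pi>\<^sub>E j\<in>J. E j)" "finite J"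
    "\<And>i. i \<in> J \<Longrightarrow> E i \<in> sets S"
  define n where "n = Max J"
  have n: "j \<le> Suc n" if "j \<in> J" for j unfolding n_def using Max_ge[OF J(2) that] by simp
  show thesis
  proof (rule that[of "\<lambda>i. if i \<in> J then E i else space S" n])
    show "C = cylinder S (\<lambda>i. if i \<in> J then E i else space S) (Suc n)"
      unfolding J(1) cylinder_def using n
      by (auto simp: prod_emb_def space_PiM PiE_iff split: if_splits)
  qed (use J(3) in auto)
qed

lemma cylinder_sets:
  assumes [measurable]: "\<And>i. A i \<in> sets S"
  shows "cylinder S A n \<in> sets (paths S)"
  unfolding cylinder_def by measurable

lemma sets_paths: "sets (paths S) = sigma_sets (\<Pi>\<^sub>E i\<in>UNIV. space S) (prod_algebra UNIV (\<lambda>_::nat. S))"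
  by (rule sets_PiM)

lemma paths_measure_eqI:
  assumes P: "sets P = sets (paths S)" "finite_measure P" and Q: "sets Q = sets (paths S)"
    and eq: "\<And>A n. (\<And>i. A i \<in> sets S) \<Longrightarrow> emeasure P (cylinder S A (Suc n)) = emeasure Q (cylinder S A (Suc n))"
  shows "P = Q"
proof (rule measure_eqI_generator_eq[OF Int_stable_prod_algebra prod_algebra_sets_into_space])
  interpret finite_measure P by fact
  fix C assume "C \<in> prod_algebra UNIV (\<lambda>_::nat. S)"
  then show "emeasure P C = emeasure Q C" by (elim prod_algebra_cylinder) (simp add: eq)
next
  show "range (\<lambda>_::nat. space (paths S)) \<subseteq> prod_algebra UNIV (\<lambda>_::nat. S)"
  proof -
    have "space (paths S) = prod_emb UNIV (\<lambda>_. S) {0} (\<Pi>\<^sub>E j\<in>{0}. space S)"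
      by (auto simp: prod_emb_def space_PiM PiE_iff)
    then show ?thesis using prod_algebraI[of "{0::nat}" UNIV "\<lambda>_. space S" "\<lambda>_. S"] by auto
  qed
  show "emeasure P (space (paths S)) \<noteq> \<infinity>" using finite_measure.emeasure_finite[OF P(2)] by simp
qed (simp_all only: P Q sets_paths space_PiM UN_constant UNIV_not_empty if_False)

text \<open>The finite-dimensional distributions of the chain started at \<open>x\<close>, as
  iterated integrals obtained by conditioning on the first step.\<close>

primrec cylinder_prob :: "'a measure \<Rightarrow> ('a \<Rightarrow> 'a measure) \<Rightarrow> nat \<Rightarrow> (nat \<Rightarrow> 'a set) \<Rightarrow> 'a \<Rightarrow> ennreal" where
  "cylinder_prob S \<kappa> 0 A x = indicator (A 0) x"
| "cylinder_prob S \<kappa> (Suc n) A x = indicator (A 0) x * (\<integral>\<^sup>+y. cylinder_prob S \<kappa> n (\<lambda>i. A (Suc i)) y \<partial>\<kappa> x)"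

lemma measurable_cylinder_prob:
  assumes [measurable]: "\<kappa> \<in> S \<rightarrow>\<^sub>M prob_algebra S" and "\<And>i. A i \<in> sets S"
  shows "cylinder_prob S \<kappa> n A \<in> borel_measurable S"
  using assms(2)
proof (induction n arbitrary: A)
  case 0
  then show ?case by simp
next
  case (Suc n)
  have [measurable]: "\<kappa> \<in> S \<rightarrow>\<^sub>M subprob_algebra S" by (rule measurable_prob_algebraD) measurable
  have [measurable]: "cylinder_prob S \<kappa> n (\<lambda>i. A (Suc i)) \<in> borel_measurable S" "A 0 \<in> sets S"
    using Suc by auto
  show ?case unfolding cylinder_prob.simps by measurable
qed

text \<open>The one-step property is kept in integrated form, over events of the past. In this form
  it is shared by the given process and by the coordinate process under \<open>path_law\<close>, so
  that one set of lemmas serves both.\<close>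

locale markov = prob_space M for M :: "'w measure" +
  fixes S :: "'a measure" and \<kappa> :: "'a \<Rightarrow> 'a measure" and X :: "nat \<Rightarrow> 'w \<Rightarrow> 'a"
  assumes \<kappa>: "\<kappa> \<in> S \<rightarrow>\<^sub>M prob_algebra S" and X [measurable]: "\<And>n. X n \<in> M \<rightarrow>\<^sub>M S"
    and step: "\<And>n D A. D \<in> sets (history M S X n) \<Longrightarrow> A \<in> sets S \<Longrightarrow>
      emeasure M (D \<inter> (X (Suc n) -` A \<inter> space M)) = (\<integral>\<^sup>+\<omega>. indicator D \<omega> * emeasure (\<kappa> (X n \<omega>)) A \<partial>M)"
begin

lemma \<kappa>_sub [measurable]: "\<kappa> \<in> S \<rightarrow>\<^sub>M subprob_algebra S"
  by (rule measurable_prob_algebraD[OF \<kappa>])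

lemma history_sets: "D \<in> sets (history M S X n) \<Longrightarrow> D \<in> sets M"
  using subalgebra_history[of X M S n] X unfolding subalgebra_def by auto

lemma measurable_X_history: "i \<le> n \<Longrightarrow> X i \<in> history M S X n \<rightarrow>\<^sub>M S"
  by (rule measurable_history[OF X, of "\<lambda>w. w i"]) auto

lemma history_mono: "sets (history M S X n) \<subseteq> sets (history M S X (Suc n))"
proof -
  have "(\<lambda>\<omega>. \<lambda>i\<in>{..n}. X i \<omega>) \<in> history M S X (Suc n) \<rightarrow>\<^sub>M PiM {..n} (\<lambda>_. S)"
    by (rule measurable_restrict) (rule measurable_X_history, simp)
  from sets_image_in_sets[OF space_history this] show ?thesis
    by (simp add: history_def[of M S X n])
qed

text \<open>Restricting \<open>M\<close> to \<open>D\<close> turns the one-step property into an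
  equality of two measures on the state space, and equal measures give \<open>g\<close> equal
  integrals.\<close>

lemma step_nn_integral:
  assumes D: "D \<in> sets (history M S X n)" and g [measurable]: "g \<in> borel_measurable S"
  shows "(\<integral>\<^sup>+\<omega>. indicator D \<omega> * g (X (Suc n) \<omega>) \<partial>M) = (\<integral>\<^sup>+\<omega>. indicator D \<omega> * (\<integral>\<^sup>+y. g y \<partial>\<kappa> (X n \<omega>)) \<partial>M)"
proof -
  have [measurable]: "D \<in> sets M" by (rule history_sets[OF D])
  define N where "N = density M (indicator D)"
  have [measurable_cong]: "sets N = sets M" unfolding N_def by simp
  have ne: "space N \<noteq> {}" unfolding N_def using not_empty by simp
  have bind_meas [measurable]: "(\<lambda>\<omega>. \<kappa> (X n \<omega>)) \<in> N \<rightarrow>\<^sub>M subprob_algebra S" by measurable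
  have "distr N S (X (Suc n)) = N \<bind> (\<lambda>\<omega>. \<kappa> (X n \<omega>))"
  proof (rule measure_eqI)
    show "sets (distr N S (X (Suc n))) = sets (N \<bind> (\<lambda>\<omega>. \<kappa> (X n \<omega>)))"
      by (subst sets_bind[where N=S]) (use ne measurable_space[OF bind_meas] in \<open>auto simp: space_subprob_algebra\<close>)
    fix A assume "A \<in> sets (distr N S (X (Suc n)))"
    then have A [measurable]: "A \<in> sets S" by simp
    have "emeasure (distr N S (X (Suc n))) A = emeasure N (X (Suc n) -` A \<inter> space M)"
      by (subst emeasure_distr) (simp_all add: N_def)
    also have "\<dots> = emeasure M (D \<inter> (X (Suc n) -` A \<inter> space M))"
      unfolding N_def by (subst emeasure_density) (auto simp flip: indicator_inter_arith)
    also have "\<dots> = (\<integral>\<^sup>+\<omega>. indicator D \<omega> * emeasure (\<kappa> (X n \<omega>)) A \<partial>M)" by (rule step[OF D A])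
    also have "\<dots> = emeasure (N \<bind> (\<lambda>\<omega>. \<kappa> (X n \<omega>))) A"
      unfolding emeasure_bind[OF ne bind_meas A] unfolding N_def
      by (subst nn_integral_density) (auto intro!: measurable_emeasure_subprob_algebra[THEN measurable_compose[rotated]])
    finally show "emeasure (distr N S (X (Suc n))) A = emeasure (N \<bind> (\<lambda>\<omega>. \<kappa> (X n \<omega>))) A" .
  qed
  then have "(\<integral>\<^sup>+y. g y \<partial>distr N S (X (Suc n))) = (\<integral>\<^sup>+y. g y \<partial>(N \<bind> (\<lambda>\<omega>. \<kappa> (X n \<omega>))))" by simp
  also have "\<dots> = (\<integral>\<^sup>+\<omega>. \<integral>\<^sup>+y. g y \<partial>\<kappa> (X n \<omega>) \<partial>N)"
    by (rule nn_integral_bind[OF g bind_meas])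
  also have "\<dots> = (\<integral>\<^sup>+\<omega>. indicator D \<omega> * (\<integral>\<^sup>+y. g y \<partial>\<kappa> (X n \<omega>)) \<partial>M)"
    unfolding N_def by (subst nn_integral_density) measurable
  also have "(\<integral>\<^sup>+y. g y \<partial>distr N S (X (Suc n))) = (\<integral>\<^sup>+\<omega>. indicator D \<omega> * g (X (Suc n) \<omega>) \<partial>M)"
    unfolding N_def by (subst nn_integral_distr) (auto simp: nn_integral_density)
  finally show ?thesis .
qed

text \<open>Induction on the number of coordinates: the constraint at time \<open>m\<close> is
  absorbed into the past event, which then also belongs to the history at \<open>Suc m\<close>. The
  one-step property brings the result for \<open>Suc m\<close> back to time
  \<open>m\<close>.\<close>

lemma cylinder_history:
  assumes "D \<in> sets (history M S X m)" and "\<And>i. A i \<in> sets S"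
  shows "emeasure M (D \<inter> {\<omega>\<in>space M. \<forall>i\<le>n. X (m + i) \<omega> \<in> A i}) =
    (\<integral>\<^sup>+\<omega>. indicator D \<omega> * cylinder_prob S \<kappa> n A (X m \<omega>) \<partial>M)"
  using assms
proof (induction n arbitrary: D A m)
  case 0
  have [measurable]: "D \<in> sets M" "A 0 \<in> sets S" using history_sets 0 by auto
  have "emeasure M (D \<inter> {\<omega>\<in>space M. \<forall>i\<le>0. X (m + i) \<omega> \<in> A i}) = (\<integral>\<^sup>+\<omega>. indicator (D \<inter> {\<omega>\<in>space M. X m \<omega> \<in> A 0}) \<omega> \<partial>M)"
    by (subst nn_integral_indicator) auto
  also have "\<dots> = (\<integral>\<^sup>+\<omega>. indicator D \<omega> * cylinder_prob S \<kappa> 0 A (X m \<omega>) \<partial>M)"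
    by (rule nn_integral_cong) (auto split: split_indicator)
  finally show ?case .
next
  case (Suc n)
  have A [measurable]: "A i \<in> sets S" for i using Suc.prems by blast
  note [measurable] = measurable_X_history[OF order_refl, of m]
  define D' where "D' = D \<inter> {\<omega>\<in>space M. X m \<omega> \<in> A 0}"
  have "{\<omega>\<in>space (history M S X m). X m \<omega> \<in> A 0} \<in> sets (history M S X m)" by measurable
  then have D': "D' \<in> sets (history M S X m)" unfolding D'_def using Suc.prems(1) by auto
  then have D'': "D' \<in> sets (history M S X (Suc m))" using history_mono by blast
  let ?g = "cylinder_prob S \<kappa> n (\<lambda>i. A (Suc i))"
  have g: "?g \<in> borel_measurable S" by (rule measurable_cylinder_prob[OF \<kappa>]) simp
  have "D \<inter> {\<omega>\<in>space M. \<forall>i\<le>Suc n. X (m + i) \<omega> \<in> A i} = D' \<inter> {\<omega>\<in>space M. \<forall>i\<le>n. X (Suc m + i) \<omega> \<in> A (Suc i)}"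
  proof -
    have "(\<forall>i\<le>Suc n. P i) \<longleftrightarrow> P 0 \<and> (\<forall>i\<le>n. P (Suc i))" for P
      using All_less_Suc2[of "Suc n" P] by (simp only: less_Suc_eq_le)
    from this[of "\<lambda>i. X (m + i) _ \<in> A i"] show ?thesis unfolding D'_def by auto
  qed
  also have "emeasure M \<dots> = (\<integral>\<^sup>+\<omega>. indicator D' \<omega> * ?g (X (Suc m) \<omega>) \<partial>M)"
    by (rule Suc.IH[OF D'']) simp
  also have "\<dots> = (\<integral>\<^sup>+\<omega>. indicator D' \<omega> * (\<integral>\<^sup>+y. ?g y \<partial>\<kappa> (X m \<omega>)) \<partial>M)"
    by (rule step_nn_integral[OF D' g])
  also have "\<dots> = (\<integral>\<^sup>+\<omega>. indicator D \<omega> * cylinder_prob S \<kappa> (Suc n) A (X m \<omega>) \<partial>M)"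
    by (rule nn_integral_cong) (auto simp: D'_def split: split_indicator)
  finally show ?case .
qed

end

text \<open>Integrating the conditional probability over \<open>D\<close> gives the integrated form
  of the one-step property.\<close>

lemma markov_chain_imp_markov:
  assumes "markov_chain M S \<kappa> X"
  shows "markov M S \<kappa> X"
proof -
  from assms interpret prob_space M unfolding markov_chain_def by blast
  have \<kappa>: "\<kappa> \<in> S \<rightarrow>\<^sub>M prob_algebra S" and X [measurable]: "\<And>n. X n \<in> M \<rightarrow>\<^sub>M S"
    and ce: "\<And>n A. A \<in> sets S \<Longrightarrow> AE \<omega> in M. real_cond_exp M (history M S X n) (indicator (X (Suc n) -` A \<inter> space M)) \<omega>
          = measure (\<kappa> (X n \<omega>)) A"
    using assms unfolding markov_chain_def by auto
  note [measurable] = \<kappa>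
  show ?thesis
  proof (unfold_locales)
    fix n D A assume D: "D \<in> sets (history M S X n)" and A [measurable]: "A \<in> sets S"
    interpret F: finite_measure_subalgebra M "history M S X n"
      by unfold_locales (rule subalgebra_history[OF X])
    have [measurable]: "D \<in> sets M" using D subalgebra_history[where X=X and n=n, OF X] unfolding subalgebra_def by auto
    let ?B = "X (Suc n) -` A \<inter> space M"
    have [measurable]: "?B \<in> sets M" by measurable
    have pr: "prob_space (\<kappa> (X n \<omega>))" if "\<omega> \<in> space M" for \<omega>
      using measurable_space[OF \<kappa> measurable_space[OF X that]] by (simp add: space_prob_algebra)
    have "measure M (D \<inter> ?B) = (\<integral>\<omega>\<in>D. indicator ?B \<omega> \<partial>M)"
      unfolding set_lebesgue_integral_def by (simp flip: indicator_inter_arith add: Int_absorb2)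
    also have "\<dots> = (\<integral>\<omega>\<in>D. real_cond_exp M (history M S X n) (indicator ?B) \<omega> \<partial>M)"
      by (rule F.real_cond_exp_intA[OF _ D]) (auto simp: integrable_indicator_iff less_top[symmetric] simp del: vimage_Int)
    also have "\<dots> = (\<integral>\<omega>. indicator D \<omega> * measure (\<kappa> (X n \<omega>)) A \<partial>M)"
      unfolding set_lebesgue_integral_def using ce[OF A, of n] by (intro integral_cong_AE) auto
    finally have "emeasure M (D \<inter> ?B) = ennreal (\<integral>\<omega>. indicator D \<omega> * measure (\<kappa> (X n \<omega>)) A \<partial>M)"
      by (simp add: emeasure_eq_measure)
    also have "\<dots> = (\<integral>\<^sup>+\<omega>. ennreal (indicator D \<omega> * measure (\<kappa> (X n \<omega>)) A) \<partial>M)"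
    proof (rule nn_integral_eq_integral[symmetric])
      show "integrable M (\<lambda>\<omega>. indicator D \<omega> * measure (\<kappa> (X n \<omega>)) A)"
        by (rule integrable_const_bound[where B=1])
           (auto intro!: AE_I2 prob_space.prob_le_1 pr split: split_indicator)
    qed auto
    also have "\<dots> = (\<integral>\<^sup>+\<omega>. indicator D \<omega> * emeasure (\<kappa> (X n \<omega>)) A \<partial>M)"
      by (rule nn_integral_cong)
         (auto simp: finite_measure.emeasure_eq_measure[OF prob_space.finite_measure[OF pr]] split: split_indicator)
    finally show "emeasure M (D \<inter> ?B) = (\<integral>\<^sup>+\<omega>. indicator D \<omega> * emeasure (\<kappa> (X n \<omega>)) A \<partial>M)" .
  qed (use \<kappa> X in auto)
qed

section \<open>The path law and its finite-dimensional distributions\<close>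

context
  fixes S :: "'a measure" and \<kappa> :: "'a \<Rightarrow> 'a measure" and \<nu> :: "'a measure"
  assumes \<kappa>: "\<kappa> \<in> S \<rightarrow>\<^sub>M prob_algebra S" and \<nu>: "prob_space \<nu>" "sets \<nu> = sets S"
begin

interpretation IT: Ionescu_Tulcea "\<lambda>i w. case i of 0 \<Rightarrow> \<nu> | Suc j \<Rightarrow> \<kappa> (w j)" "\<lambda>_. S"
proof (rule Ionescu_Tulcea.intro)
  note [measurable] = measurable_prob_algebraD[OF \<kappa>]
  show "(\<lambda>w. case i of 0 \<Rightarrow> \<nu> | Suc j \<Rightarrow> \<kappa> (w j)) \<in> PiM {0..<i} (\<lambda>_. S) \<rightarrow>\<^sub>M subprob_algebra S" for i
    by (cases i) (auto simp: space_subprob_algebra \<nu> prob_space_imp_subprob_space)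
  fix i and w :: "nat \<Rightarrow> 'a" assume "w \<in> space (PiM {0..<i} (\<lambda>_. S))"
  then show "prob_space (case i of 0 \<Rightarrow> \<nu> | Suc j \<Rightarrow> \<kappa> (w j))"
    using \<nu> measurable_space[OF \<kappa>]
    by (cases i) (auto simp: space_prob_algebra space_PiM PiE_iff)
qed

lemma path_law_eq: "path_law S \<kappa> \<nu> = IT.PF.lim"
  unfolding path_law_def ..

lemma sets_path_law: "sets (path_law S \<kappa> \<nu>) = sets (paths S)"
  unfolding path_law_eq by simp

text \<open>\<open>IT.C 0 n\<close> is the law of the first \<open>n\<close> coordinates built by
  iterating the kernels, so events of finite length can be computed without the projective
  limit.\<close>

lemma path_law_restrict:
  "distr (path_law S \<kappa> \<nu>) (PiM {0..<n} (\<lambda>_. S)) (\<lambda>w. restrict w {0..<n}) = IT.C 0 n (\<lambda>_. undefined)"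
proof (rule measure_eqI)
  have u: "(\<lambda>_. undefined) \<in> space (PiM {0..<0::nat} (\<lambda>_. S))" by (simp add: space_PiM)
  show "sets (distr (path_law S \<kappa> \<nu>) (PiM {0..<n} (\<lambda>_. S)) (\<lambda>w. restrict w {0..<n})) = sets (IT.C 0 n (\<lambda>_. undefined))"
    using IT.sets_C[OF u, of n] by simp
  fix Z assume "Z \<in> sets (distr (path_law S \<kappa> \<nu>) (PiM {0..<n} (\<lambda>_. S)) (\<lambda>w. restrict w {0..<n}))"
  then have Z: "Z \<in> sets (PiM {0..<n} (\<lambda>_. S))" by simp
  have restr: "(\<lambda>w. restrict w {0..<n}) \<in> path_law S \<kappa> \<nu> \<rightarrow>\<^sub>M PiM {0..<n} (\<lambda>_. S)"
    unfolding measurable_cong_sets[OF sets_path_law refl] by (rule measurable_restrict_subset) simp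
  have "emeasure (distr (path_law S \<kappa> \<nu>) (PiM {0..<n} (\<lambda>_. S)) (\<lambda>w. restrict w {0..<n})) Z =
      emeasure IT.PF.lim (prod_emb UNIV (\<lambda>_. S) {0..<n} Z)"
    using Z restr by (subst emeasure_distr) (auto simp: prod_emb_def path_law_eq space_PiM PiE_iff
        intro!: arg_cong[where f="emeasure _"])
  also have "\<dots> = emeasure (IT.CI {0..<n}) Z" by (rule IT.lim[OF _ Z]) simp
  also have "\<dots> = emeasure (IT.C 0 n (\<lambda>_. undefined)) Z"
    using IT.emeasure_CI[OF order_refl Z] sets.sets_into_space[OF Z] by (simp add: prod_emb_id space_PiM)
  finally show "emeasure (distr (path_law S \<kappa> \<nu>) (PiM {0..<n} (\<lambda>_. S)) (\<lambda>w. restrict w {0..<n})) Z =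
      emeasure (IT.C 0 n (\<lambda>_. undefined)) Z" .
qed

lemma emeasure_path_law_restrict:
  assumes Z: "Z \<in> sets (PiM {0..<n} (\<lambda>_. S))"
  shows "emeasure (path_law S \<kappa> \<nu>) {w\<in>space (paths S). restrict w {0..<n} \<in> Z} = emeasure (IT.C 0 n (\<lambda>_. undefined)) Z"
proof -
  have restr: "(\<lambda>w. restrict w {0..<n}) \<in> path_law S \<kappa> \<nu> \<rightarrow>\<^sub>M PiM {0..<n} (\<lambda>_. S)"
    unfolding measurable_cong_sets[OF sets_path_law refl] by (rule measurable_restrict_subset) simp
  have "(\<lambda>w. restrict w {0..<n}) -` Z \<inter> space (path_law S \<kappa> \<nu>) = {w\<in>space (paths S). restrict w {0..<n} \<in> Z}"
    unfolding sets_eq_imp_space_eq[OF sets_path_law] by auto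
  then show ?thesis
    unfolding path_law_restrict[symmetric] emeasure_distr[OF restr Z] by simp
qed

lemma emeasure_C_Suc:
  assumes Z: "Z \<in> sets (PiM {0..<Suc n} (\<lambda>_. S))"
  shows "emeasure (IT.C 0 (Suc n) (\<lambda>_. undefined)) Z = (\<integral>\<^sup>+z. emeasure (IT.eP n z) Z \<partial>IT.C 0 n (\<lambda>_. undefined))"
proof -
  have u: "(\<lambda>_. undefined) \<in> space (PiM {0..<0::nat} (\<lambda>_. S))" by (simp add: space_PiM)
  interpret C: prob_space "IT.C 0 n (\<lambda>_. undefined)" by (rule IT.prob_space_C[OF u])
  have "IT.eP n \<in> IT.C 0 n (\<lambda>_. undefined) \<rightarrow>\<^sub>M subprob_algebra (PiM {0..<Suc n} (\<lambda>_. S))"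
    using IT.measurable_eP[of n] by (simp add: measurable_cong_sets[OF IT.sets_C[OF u] refl])
  then show ?thesis using Z by (simp add: emeasure_bind[OF C.not_empty])
qed

lemma path_law_initial: "distr (path_law S \<kappa> \<nu>) S (\<lambda>w. w 0) = \<nu>"
proof (rule measure_eqI)
  fix A assume "A \<in> sets (distr (path_law S \<kappa> \<nu>) S (\<lambda>w. w 0))"
  then have A: "A \<in> sets S" by simp
  have u: "(\<lambda>_. undefined) \<in> space (PiM {0..<0::nat} (\<lambda>_. S))" by (simp add: space_PiM)
  define Z where "Z = {z\<in>space (PiM {0..<Suc 0} (\<lambda>_. S)). z 0 \<in> A}"
  have Z: "Z \<in> sets (PiM {0..<Suc 0} (\<lambda>_. S))"
  proof -
    note [measurable] = A
    show ?thesis unfolding Z_def by measurable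
  qed
  have m: "(\<lambda>w. w 0) \<in> path_law S \<kappa> \<nu> \<rightarrow>\<^sub>M S"
    unfolding measurable_cong_sets[OF sets_path_law refl] by simp
  have "emeasure (distr (path_law S \<kappa> \<nu>) S (\<lambda>w. w 0)) A = emeasure (path_law S \<kappa> \<nu>) {w\<in>space (paths S). restrict w {0..<Suc 0} \<in> Z}"
    unfolding emeasure_distr[OF m A] sets_eq_imp_space_eq[OF sets_path_law]
    by (intro arg_cong[where f="emeasure _"]) (auto simp: Z_def space_PiM PiE_iff)
  also have "\<dots> = emeasure (IT.C 0 (Suc 0) (\<lambda>_. undefined)) Z"
    by (rule emeasure_path_law_restrict[OF Z])
  also have "\<dots> = emeasure (IT.eP 0 (\<lambda>_. undefined)) Z"
  proof -
    have "(\<lambda>z. emeasure (IT.eP 0 z) Z) \<in> borel_measurable (PiM {0..<0} (\<lambda>_. S))"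
      using IT.measurable_eP[of 0] measurable_emeasure_subprob_algebra[OF Z] by (rule measurable_compose)
    then show ?thesis by (subst emeasure_C_Suc[OF Z], subst IT.C.simps(1), subst nn_integral_return) (use u in auto)
  qed
  also have "\<dots> = emeasure \<nu> ((\<lambda>x. (\<lambda>_. undefined)(0 := x)) -` Z \<inter> space S)"
    using IT.emeasure_eP[OF u Z] by simp
  also have "(\<lambda>x. (\<lambda>_. undefined)(0 := x)) -` Z \<inter> space S = A"
    using sets.sets_into_space[OF A] by (auto simp: Z_def space_PiM PiE_iff extensional_def)
  finally show "emeasure (distr (path_law S \<kappa> \<nu>) S (\<lambda>w. w 0)) A = emeasure \<nu> A" .
qed (simp add: \<nu>)

text \<open>An event of the past is a set \<open>Z\<close> of initial segments. Appending one
  coordinate drawn from the kernel multiplies its indicator by the transition probability into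
  \<open>A\<close>, and integrating this is the one-step property.\<close>

lemma markov_path_law: "markov (path_law S \<kappa> \<nu>) S \<kappa> (\<lambda>n w. w n)"
proof (intro markov.intro markov_axioms.intro)
  let ?L = "path_law S \<kappa> \<nu>" and ?C = "\<lambda>n. IT.C 0 n (\<lambda>_. undefined)"
  have sL: "space ?L = space (paths S)" by (rule sets_eq_imp_space_eq[OF sets_path_law])
  show "prob_space ?L" 
  proof (rule prob_space_distrD)
    show "(\<lambda>w. w 0) \<in> ?L \<rightarrow>\<^sub>M S" unfolding measurable_cong_sets[OF sets_path_law refl] by simp
    show "prob_space (distr ?L S (\<lambda>w. w 0))" unfolding path_law_initial by (rule \<nu>)
  qed
  show "\<kappa> \<in> S \<rightarrow>\<^sub>M prob_algebra S" by (rule \<kappa>)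
  show "(\<lambda>w. w n) \<in> ?L \<rightarrow>\<^sub>M S" for n
    unfolding measurable_cong_sets[OF sets_path_law refl] by simp
  fix n D A assume "D \<in> sets (history ?L S (\<lambda>n w. w n) n)" and A: "A \<in> sets S"
  moreover have "{..n} = {0..<Suc n}" by auto
  ultimately obtain Z where Z: "Z \<in> sets (PiM {0..<Suc n} (\<lambda>_. S))"
    and D: "D = {w\<in>space (paths S). restrict w {0..<Suc n} \<in> Z}"
    unfolding history_def sL by (subst (asm) sets_vimage_algebra2) (auto simp: space_PiM PiE_iff)
  have u: "(\<lambda>_. undefined) \<in> space (PiM {0..<0::nat} (\<lambda>_. S))" by (simp add: space_PiM)
  define Z' where "Z' = {z\<in>space (PiM {0..<Suc (Suc n)} (\<lambda>_. S)). restrict z {0..<Suc n} \<in> Z \<and> z (Suc n) \<in> A}"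
  have Z': "Z' \<in> sets (PiM {0..<Suc (Suc n)} (\<lambda>_. S))"
  proof -
    have [measurable]: "(\<lambda>z. restrict z {0..<Suc n}) \<in> PiM {0..<Suc (Suc n)} (\<lambda>_. S) \<rightarrow>\<^sub>M PiM {0..<Suc n} (\<lambda>_. S)"
      by (rule measurable_restrict_subset) auto
    note [measurable] = Z A
    show ?thesis unfolding Z'_def by measurable
  qed
  have eP: "emeasure (IT.eP (Suc n) z) Z' = indicator Z z * emeasure (\<kappa> (z n)) A"
    if z: "z \<in> space (PiM {0..<Suc n} (\<lambda>_. S))" for z
  proof -
    have r: "restrict (z(Suc n := x)) {0..<Suc n} = z" for x
      using z by (auto simp: space_PiM PiE_iff extensional_def fun_eq_iff)
    have "z(Suc n := x) \<in> space (PiM {0..<Suc (Suc n)} (\<lambda>_. S))" if "x \<in> space S" for x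
      using z that by (auto simp: space_PiM PiE_iff extensional_def)
    then have "(\<lambda>x. z(Suc n := x)) -` Z' \<inter> space S = (if z \<in> Z then A else {})"
      unfolding Z'_def using r sets.sets_into_space[OF A] by auto
    then show ?thesis using IT.emeasure_eP[OF z Z'] by simp
  qed
  have "D \<inter> ((\<lambda>w. w (Suc n)) -` A \<inter> space ?L) = {w\<in>space (paths S). restrict w {0..<Suc (Suc n)} \<in> Z'}"
  proof -
    have r: "restrict (restrict w {0..<Suc (Suc n)}) {0..<Suc n} = restrict w {0..<Suc n}" for w :: "nat \<Rightarrow> 'a"
      by (auto simp: fun_eq_iff)
    show ?thesis unfolding D Z'_def sL by (auto simp: r space_PiM PiE_iff)
  qed
  then have "emeasure ?L (D \<inter> ((\<lambda>w. w (Suc n)) -` A \<inter> space ?L)) = (\<integral>\<^sup>+z. emeasure (IT.eP (Suc n) z) Z' \<partial>?C (Suc n))"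
    using emeasure_path_law_restrict[OF Z'] emeasure_C_Suc[OF Z'] by simp
  also have "\<dots> = (\<integral>\<^sup>+z. indicator Z z * emeasure (\<kappa> (z n)) A \<partial>?C (Suc n))"
    using IT.space_C[OF u, of "Suc n"] by (intro nn_integral_cong eP) simp
  also have "\<dots> = (\<integral>\<^sup>+w. indicator Z (restrict w {0..<Suc n}) * emeasure (\<kappa> (restrict w {0..<Suc n} n)) A \<partial>?L)"
  proof -
    have [measurable]: "\<kappa> \<in> S \<rightarrow>\<^sub>M subprob_algebra S" by (rule measurable_prob_algebraD[OF \<kappa>])
    note [measurable] = Z A
    have "(\<lambda>z. indicator Z z * emeasure (\<kappa> (z n)) A) \<in> borel_measurable (PiM {0..<Suc n} (\<lambda>_. S))"
      by (intro borel_measurable_times_ennreal measurable_compose[OF _ measurable_emeasure_subprob_algebra[OF A]]) measurable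
    moreover have "(\<lambda>w. restrict w {0..<Suc n}) \<in> ?L \<rightarrow>\<^sub>M PiM {0..<Suc n} (\<lambda>_. S)"
      unfolding measurable_cong_sets[OF sets_path_law refl] by (rule measurable_restrict_subset) simp
    ultimately show ?thesis
      unfolding path_law_restrict[symmetric] by (subst nn_integral_distr) simp_all
  qed
  also have "\<dots> = (\<integral>\<^sup>+w. indicator D w * emeasure (\<kappa> (w n)) A \<partial>?L)"
    by (rule nn_integral_cong) (auto simp: D sL split: split_indicator)
  finally show "emeasure ?L (D \<inter> ((\<lambda>w. w (Suc n)) -` A \<inter> space ?L)) = (\<integral>\<^sup>+w. indicator D w * emeasure (\<kappa> (w n)) A \<partial>?L)" .
qed

end

text \<open>The coordinate process is itself an instance of \<open>markov\<close>, so this is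
  \<open>cylinder_history\<close> at time 0 with a trivial past and a deterministic start.\<close>

lemma cylinder_path_law:
  assumes \<kappa>: "\<kappa> \<in> S \<rightarrow>\<^sub>M prob_algebra S" and x: "x \<in> space S" and A: "\<And>i. A i \<in> sets S"
  shows "emeasure (path_law S \<kappa> (return S x)) (cylinder S A n) = cylinder_prob S \<kappa> n A x"
proof -
  let ?K = "path_law S \<kappa> (return S x)"
  have r: "prob_space (return S x)" "sets (return S x) = sets S" using x by (simp_all add: prob_space_return)
  interpret K: markov ?K S \<kappa> "\<lambda>n w. w n" by (rule markov_path_law[OF \<kappa> r])
  have [measurable]: "cylinder_prob S \<kappa> n A \<in> borel_measurable S"
    by (rule measurable_cylinder_prob[OF \<kappa>]) (rule A)
  have sp: "space ?K = space (paths S)" by (rule sets_eq_imp_space_eq[OF sets_path_law[OF \<kappa> r]])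
  have D: "space ?K \<in> sets (history ?K S (\<lambda>n w. w n) 0)"
    using sets.top[of "history ?K S (\<lambda>n w. w n) 0"] by simp
  have "cylinder S A n = space ?K \<inter> {w\<in>space ?K. \<forall>i\<le>n. w (0 + i) \<in> A i}"
    unfolding cylinder_def sp by (simp add: Int_def)
  then have "emeasure ?K (cylinder S A n) = (\<integral>\<^sup>+w. indicator (space ?K) w * cylinder_prob S \<kappa> n A (w 0) \<partial>?K)"
    using K.cylinder_history[OF D, of A n] A by simp
  also have "\<dots> = (\<integral>\<^sup>+w. cylinder_prob S \<kappa> n A (w 0) \<partial>?K)"
    by (rule nn_integral_cong) simp
  also have "\<dots> = (\<integral>\<^sup>+y. cylinder_prob S \<kappa> n A y \<partial>distr ?K S (\<lambda>w. w 0))"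
    by (subst nn_integral_distr) (use K.X[of 0] in auto)
  also have "\<dots> = cylinder_prob S \<kappa> n A x"
    unfolding path_law_initial[OF \<kappa> r] by (subst nn_integral_return) (use x in auto)
  finally show ?thesis .
qed

text \<open>Measurability in the starting point can be checked on cylinders, where the law is given
  by \<open>cylinder_prob\<close>.\<close>

lemma measurable_path_law:
  assumes \<kappa>: "\<kappa> \<in> S \<rightarrow>\<^sub>M prob_algebra S"
  shows "(\<lambda>x. path_law S \<kappa> (return S x)) \<in> S \<rightarrow>\<^sub>M prob_algebra (paths S)"
proof (rule measurable_prob_algebra_generated[OF sets_paths Int_stable_prod_algebra prod_algebra_sets_into_space])
  fix x assume x: "x \<in> space S"
  have r: "prob_space (return S x)" "sets (return S x) = sets S" using x by (simp_all add: prob_space_return)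
  interpret K: markov "path_law S \<kappa> (return S x)" S \<kappa> "\<lambda>n w. w n" by (rule markov_path_law[OF \<kappa> r])
  show "prob_space (path_law S \<kappa> (return S x))" by unfold_locales
  show "sets (path_law S \<kappa> (return S x)) = sets (paths S)" by (rule sets_path_law[OF \<kappa> r])
next
  fix C assume "C \<in> prod_algebra UNIV (\<lambda>_::nat. S)"
  then show "(\<lambda>x. emeasure (path_law S \<kappa> (return S x)) C) \<in> borel_measurable S"
  proof (rule prod_algebra_cylinder)
    fix A n assume A: "\<And>i. A i \<in> sets S" and C: "C = cylinder S A (Suc n)"
    have "cylinder_prob S \<kappa> (Suc n) A \<in> borel_measurable S"
      by (rule measurable_cylinder_prob[OF \<kappa>]) (rule A)
    moreover have "emeasure (path_law S \<kappa> (return S x)) C = cylinder_prob S \<kappa> (Suc n) A x" if "x \<in> space S" for x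
      unfolding C by (rule cylinder_path_law[OF \<kappa> that]) (rule A)
    ultimately show ?thesis by (simp cong: measurable_cong)
  qed
qed

section \<open>The Markov property for general path events\<close>

context markov
begin

lemma measurable_shift: "(\<lambda>\<omega> i. X (m + i) \<omega>) \<in> M \<rightarrow>\<^sub>M paths S"
  by (rule measurable_paths) simp

text \<open>Both sides are finite measures in \<open>B\<close> that agree on cylinders: with
  \<open>M\<close> restricted to \<open>D\<close>, one is the image under the shifted path and the
  other the composition with the kernel \<open>path_law\<close>.\<close>

theorem markov_property:
  assumes D: "D \<in> sets (history M S X m)" and B: "B \<in> sets (paths S)"
  shows "emeasure M (D \<inter> {\<omega>\<in>space M. (\<lambda>i. X (m + i) \<omega>) \<in> B}) =
    (\<integral>\<^sup>+\<omega>. indicator D \<omega> * emeasure (path_law S \<kappa> (return S (X m \<omega>))) B \<partial>M)"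
proof -
  let ?K = "\<lambda>x. path_law S \<kappa> (return S x)"
  have [measurable]: "D \<in> sets M" by (rule history_sets[OF D])
  define N where "N = density M (indicator D)"
  have sN [measurable_cong]: "sets N = sets M" unfolding N_def by simp
  have ne: "space N \<noteq> {}" unfolding N_def using not_empty by simp
  have K [measurable]: "?K \<in> S \<rightarrow>\<^sub>M subprob_algebra (paths S)"
    by (rule measurable_prob_algebraD[OF measurable_path_law[OF \<kappa>]])
  have KX: "(\<lambda>\<omega>. ?K (X m \<omega>)) \<in> N \<rightarrow>\<^sub>M subprob_algebra (paths S)" by measurable
  have sh: "(\<lambda>\<omega> i. X (m + i) \<omega>) \<in> N \<rightarrow>\<^sub>M paths S"
    using measurable_shift[of m] by (simp add: measurable_cong_sets[OF sN refl])
  have lhs: "emeasure (distr N (paths S) (\<lambda>\<omega> i. X (m + i) \<omega>)) C = emeasure M (D \<inter> {\<omega>\<in>space M. (\<lambda>i. X (m + i) \<omega>) \<in> C})"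
    if C: "C \<in> sets (paths S)" for C
  proof -
    have m: "{\<omega>\<in>space M. (\<lambda>i. X (m + i) \<omega>) \<in> C} \<in> sets M"
      using measurable_sets[OF measurable_shift C] by (simp add: vimage_def Int_def conj_commute)
    have "emeasure (distr N (paths S) (\<lambda>\<omega> i. X (m + i) \<omega>)) C = emeasure N {\<omega>\<in>space M. (\<lambda>i. X (m + i) \<omega>) \<in> C}"
      by (subst emeasure_distr[OF sh C]) (auto simp: N_def intro!: arg_cong2[where f=emeasure])
    then show ?thesis
      unfolding N_def using m by (simp add: emeasure_density flip: indicator_inter_arith)
  qed
  have rhs: "emeasure (N \<bind> (\<lambda>\<omega>. ?K (X m \<omega>))) C = (\<integral>\<^sup>+\<omega>. indicator D \<omega> * emeasure (?K (X m \<omega>)) C \<partial>M)"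
    if C: "C \<in> sets (paths S)" for C
    unfolding emeasure_bind[OF ne KX C] unfolding N_def
    by (subst nn_integral_density)
       (use measurable_emeasure_subprob_algebra[OF C] in \<open>auto intro: measurable_compose[OF measurable_compose[OF X K]]\<close>)
  have "distr N (paths S) (\<lambda>\<omega> i. X (m + i) \<omega>) = N \<bind> (\<lambda>\<omega>. ?K (X m \<omega>))"
  proof (rule paths_measure_eqI)
    show "finite_measure (distr N (paths S) (\<lambda>\<omega> i. X (m + i) \<omega>))"
    proof
      have "emeasure N (space N) \<le> 1" unfolding N_def by (simp add: emeasure_density emeasure_eq_measure)
      then show "emeasure (distr N (paths S) (\<lambda>\<omega> i. X (m + i) \<omega>)) (space (distr N (paths S) (\<lambda>\<omega> i. X (m + i) \<omega>))) \<noteq> \<infinity>"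
        using lhs[of "space (paths S)"] by (simp add: emeasure_eq_measure)
    qed
    show "sets (N \<bind> (\<lambda>\<omega>. ?K (X m \<omega>))) = sets (paths S)"
      by (subst sets_bind[where N="paths S"]) (use ne measurable_space[OF KX] in \<open>auto simp: space_subprob_algebra\<close>)
    fix A :: "nat \<Rightarrow> 'a set" and n assume A: "\<And>i. A i \<in> sets S"
    have "{\<omega>\<in>space M. (\<lambda>i. X (m + i) \<omega>) \<in> cylinder S A (Suc n)} = {\<omega>\<in>space M. \<forall>i\<le>Suc n. X (m + i) \<omega> \<in> A i}"
      unfolding cylinder_def using measurable_space[OF measurable_shift] by auto
    then show "emeasure (distr N (paths S) (\<lambda>\<omega> i. X (m + i) \<omega>)) (cylinder S A (Suc n)) =
        emeasure (N \<bind> (\<lambda>\<omega>. ?K (X m \<omega>))) (cylinder S A (Suc n))"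
      using A by (simp add: lhs rhs cylinder_sets cylinder_history[OF D]
        cylinder_path_law[OF \<kappa> measurable_space[OF X] A] cong: nn_integral_cong_simp)
  qed simp
  then show ?thesis using lhs[OF B] rhs[OF B] by simp
qed

end

lemma path_law_atom:
  assumes \<kappa>: "\<kappa> \<in> S \<rightarrow>\<^sub>M prob_algebra S" and x: "x \<in> space S" and y: "y \<in> space S" and eq: "\<kappa> x = \<kappa> y"
    and B: "B \<in> sets (paths S)" and tail: "\<And>w w'. w \<in> space (paths S) \<Longrightarrow> w' \<in> space (paths S) \<Longrightarrow> (\<And>i. 1 \<le> i \<Longrightarrow> w i = w' i) \<Longrightarrow> w \<in> B \<longleftrightarrow> w' \<in> B"
  shows "emeasure (path_law S \<kappa> (return S x)) B = emeasure (path_law S \<kappa> (return S y)) B"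
proof -
  let ?K = "\<lambda>x. path_law S \<kappa> (return S x)"
  \<comment> \<open>Overwriting \<open>w 0\<close> by \<open>w 1\<close> does not affect membership in \<open>B\<close>, and makes the law depend on
    the starting point through \<open>\<kappa>\<close> only.\<close>
  define \<sigma> where "\<sigma> w i = w (max 1 i)" for w :: "nat \<Rightarrow> 'a" and i
  have sK: "sets (?K z) = sets (paths S)" "prob_space (?K z)" if "z \<in> space S" for z
    using measurable_space[OF measurable_path_law[OF \<kappa>] that] by (auto simp: space_prob_algebra)
  have spK: "space (?K z) = space (paths S)" if "z \<in> space S" for z
    by (rule sets_eq_imp_space_eq[OF sK(1)[OF that]])
  have \<sigma>: "\<sigma> \<in> ?K z \<rightarrow>\<^sub>M paths S" if "z \<in> space S" for z
    unfolding measurable_cong_sets[OF sK(1)[OF that] refl] \<sigma>_def by (intro measurable_paths) simp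
  have emb: "emeasure (distr (?K z) (paths S) \<sigma>) C = emeasure (?K z) {w\<in>space (paths S). \<sigma> w \<in> C}"
    if "z \<in> space S" "C \<in> sets (paths S)" for z C
    using that \<sigma> spK[OF that(1)] by (subst emeasure_distr) (auto simp: vimage_def Int_def conj_commute)
  have "distr (?K x) (paths S) \<sigma> = distr (?K y) (paths S) \<sigma>"
  proof (rule paths_measure_eqI)
    show "finite_measure (distr (?K x) (paths S) \<sigma>)"
      by (intro prob_space.finite_measure prob_space.prob_space_distr sK \<sigma> x)
    fix A :: "nat \<Rightarrow> 'a set" and n assume A: "\<And>i. A i \<in> sets S"
    \<comment> \<open>After overwriting, coordinates 0 and 1 both carry \<open>w 1\<close>, so
      \<open>w 1\<close> has to satisfy both constraints while \<open>w 0\<close> is left free. The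
      first factor of \<open>cylinder_prob\<close> is then 1, and the starting point enters through
      \<open>\<kappa>\<close> alone.\<close>
    define A' where "A' i = (if i = 0 then space S else if i = 1 then A 0 \<inter> A 1 else A i)" for i
    have A': "A' i \<in> sets S" for i unfolding A'_def using A by auto
    have "{w\<in>space (paths S). \<sigma> w \<in> cylinder S A (Suc n)} = cylinder S A' (Suc n)"
    proof -
      have "(\<forall>i\<le>Suc n. w (max 1 i) \<in> A i) \<longleftrightarrow> (\<forall>i\<le>Suc n. w i \<in> A' i)" if w: "\<And>i. w i \<in> space S" for w
      proof safe
        fix i assume *: "\<forall>i\<le>Suc n. w (max 1 i) \<in> A i" and i: "i \<le> Suc n"
        show "w i \<in> A' i" using w *[rule_format, of i] *[rule_format, of 0] i by (auto simp: A'_def max_def split: if_splits)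
      next
        fix i assume *: "\<forall>i\<le>Suc n. w i \<in> A' i" and i: "i \<le> Suc n"
        show "w (max 1 i) \<in> A i" using *[rule_format, of i] *[rule_format, of 1] i
          by (cases "i = 0"; cases "i = 1") (auto simp: A'_def max_def split: if_splits)
      qed
      then show ?thesis unfolding cylinder_def \<sigma>_def by (auto simp: space_PiM PiE_iff)
    qed
    then show "emeasure (distr (?K x) (paths S) \<sigma>) (cylinder S A (Suc n)) = emeasure (distr (?K y) (paths S) \<sigma>) (cylinder S A (Suc n))"
      using x y by (simp add: emb A A' cylinder_sets cylinder_path_law[OF \<kappa>] eq) (simp add: A'_def)
  qed simp_all
  moreover have "{w\<in>space (paths S). \<sigma> w \<in> B} = B"
  proof -
    have "\<sigma> w \<in> B \<longleftrightarrow> w \<in> B" if w: "w \<in> space (paths S)" for w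
      by (rule tail) (use w in \<open>auto simp: \<sigma>_def max_def space_PiM PiE_iff\<close>)
    then show ?thesis using sets.sets_into_space[OF B] by blast
  qed
  ultimately show ?thesis using emb[OF x B] emb[OF y B] by simp
qed

section \<open>Regeneration at the atom\<close>

text \<open>A finite index set is enlarged to an initial segment, with \<open>UNIV\<close> as the
  constraint at the added indices; \<open>q UNIV = 1\<close> removes the extra factors. One-element
  index sets then show that \<open>q\<close> is the common law.\<close>

lemma (in prob_space) iidI:
  fixes Y :: "nat \<Rightarrow> 'a \<Rightarrow> real" and q :: "real set \<Rightarrow> real"
  assumes Y [measurable]: "\<And>i. Y i \<in> borel_measurable M" and q: "q UNIV = 1"
    and prod: "\<And>n C. (\<And>i. C i \<in> sets borel) \<Longrightarrow> prob {\<omega>\<in>space M. \<forall>i<n. Y i \<omega> \<in> C i} = (\<Prod>i<n. q (C i))"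
  shows "iid Y"
proof -
  have joint: "prob {\<omega>\<in>space M. \<forall>j\<in>J. Y j \<omega> \<in> C j} = (\<Prod>j\<in>J. q (C j))"
    if J: "finite J" and C: "\<And>j. j \<in> J \<Longrightarrow> C j \<in> sets borel" for J C
  proof -
    define n where "n = Suc (Max J)"
    have n: "j < n" if "j \<in> J" for j unfolding n_def using Max_ge[OF J that] by simp
    define C' where "C' i = (if i \<in> J then C i else UNIV)" for i
    have "{\<omega>\<in>space M. \<forall>j\<in>J. Y j \<omega> \<in> C j} = {\<omega>\<in>space M. \<forall>i<n. Y i \<omega> \<in> C' i}"
      using n by (auto simp: C'_def)
    also have "prob \<dots> = (\<Prod>i<n. q (C' i))" by (rule prod) (use C in \<open>auto simp: C'_def\<close>)
    also have "\<dots> = (\<Prod>i\<in>J. q (C' i))"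
      by (rule prod.mono_neutral_right) (use n q in \<open>auto simp: C'_def\<close>)
    also have "\<dots> = (\<Prod>j\<in>J. q (C j))" by (rule prod.cong) (auto simp: C'_def)
    finally show ?thesis .
  qed
  have marginal: "prob {\<omega>\<in>space M. Y j \<omega> \<in> C} = q C" if "C \<in> sets borel" for j C
    using joint[of "{j}" "\<lambda>_. C"] that by simp
  have "distr M borel (Y i) = distr M borel (Y 0)" for i
  proof (rule measure_eqI)
    fix C assume "C \<in> sets (distr M borel (Y i))"
    then have C: "C \<in> sets borel" by simp
    have "emeasure (distr M borel (Y j)) C = ennreal (q C)" for j
      using marginal[OF C, of j] C
      by (simp add: emeasure_distr emeasure_eq_measure vimage_def Int_def conj_commute)
    then show "emeasure (distr M borel (Y i)) C = emeasure (distr M borel (Y 0)) C" by simp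
  qed simp
  moreover have "indep_vars (\<lambda>_. borel) Y UNIV"
    unfolding indep_vars_def2
  proof (intro conjI ballI indep_setsI)
    fix A J assume J: "J \<noteq> {}" "finite J" and "\<forall>j\<in>J. A j \<in> {Y j -` C \<inter> space M |C. C \<in> sets borel}"
    then have "\<forall>j\<in>J. \<exists>C. A j = Y j -` C \<inter> space M \<and> C \<in> sets borel" by blast
    then obtain C where "\<forall>j\<in>J. A j = Y j -` C j \<inter> space M \<and> C j \<in> sets borel"
      by (rule bchoice[elim_format]) blast
    then have C: "A j = {\<omega>\<in>space M. Y j \<omega> \<in> C j}" "C j \<in> sets borel" if "j \<in> J" for j
      using that by auto
    have "(\<Inter>j\<in>J. A j) = {\<omega>\<in>space M. \<forall>j\<in>J. Y j \<omega> \<in> C j}" using C(1) J(1) by auto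
    then show "prob (\<Inter>j\<in>J. A j) = (\<Prod>j\<in>J. prob (A j))"
      using joint[OF J(2) C(2)] by (simp add: C marginal)
  qed auto
  ultimately show ?thesis unfolding iid_def by blast
qed

context markov
begin

text \<open>The visits are assumed under \<open>path_law\<close> from each point; the Markov
  property at time 0, with the whole space as past, carries them over to an arbitrary initial
  distribution.\<close>

lemma AE_infinitely_often:
  assumes \<alpha> [measurable]: "\<alpha> \<in> sets S"
    and io: "\<And>x. x \<in> space S \<Longrightarrow> AE w in path_law S \<kappa> (return S x). \<exists>\<^sub>\<infinity>n. w n \<in> \<alpha>"
  shows "AE \<omega> in M. \<exists>\<^sub>\<infinity>n. X n \<omega> \<in> \<alpha>"
proof -
  define B where "B = {w\<in>space (paths S). \<exists>\<^sub>\<infinity>n. w n \<in> \<alpha>}"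
  have B: "B \<in> sets (paths S)" unfolding B_def INFM_nat by measurable
  have one: "emeasure (path_law S \<kappa> (return S x)) B = 1" if x: "x \<in> space S" for x
  proof -
    have K: "sets (path_law S \<kappa> (return S x)) = sets (paths S)" "prob_space (path_law S \<kappa> (return S x))"
      using measurable_space[OF measurable_path_law[OF \<kappa>] x] by (simp_all add: space_prob_algebra)
    have "AE w in path_law S \<kappa> (return S x). w \<in> B"
      using io[OF x] AE_space sets_eq_imp_space_eq[OF K(1)] by (auto simp: B_def)
    then show ?thesis using prob_space.emeasure_eq_1_AE[OF K(2)] B K(1) by simp
  qed
  have D: "space M \<in> sets (history M S X 0)" using sets.top[of "history M S X 0"] by simp
  have "emeasure M (space M \<inter> {\<omega>\<in>space M. (\<lambda>i. X (0 + i) \<omega>) \<in> B}) = (\<integral>\<^sup>+\<omega>. 1 \<partial>M)"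
    unfolding markov_property[OF D B]
    by (rule nn_integral_cong) (simp add: one measurable_space[OF X])
  then have "emeasure M {\<omega>\<in>space M. (\<lambda>i. X i \<omega>) \<in> B} = 1"
    by (simp add: emeasure_space_1 Int_def conj_commute)
  moreover have "{\<omega>\<in>space M. (\<lambda>i. X i \<omega>) \<in> B} \<in> sets M"
    using measurable_sets[OF measurable_shift[of 0] B] by (simp add: vimage_def Int_def conj_commute)
  ultimately have "AE \<omega> in M. (\<lambda>i. X i \<omega>) \<in> B"
    using prob_eq_1[of "{\<omega>\<in>space M. (\<lambda>i. X i \<omega>) \<in> B}"] by (simp add: emeasure_eq_measure)
  then show ?thesis by eventually_elim (simp add: B_def)
qed

end

locale markov_atom = markov M S \<kappa> X
  for M :: "'w measure" and S :: "'a measure" and \<kappa> :: "'a \<Rightarrow> 'a measure" and X :: "nat \<Rightarrow> 'w \<Rightarrow> 'a" +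
  fixes \<alpha> :: "'a set" and f :: "'a \<Rightarrow> real"
  assumes \<alpha> [measurable]: "\<alpha> \<in> sets S" and \<alpha>_nonempty: "\<alpha> \<noteq> {}"
    and atom: "\<And>x y. x \<in> \<alpha> \<Longrightarrow> y \<in> \<alpha> \<Longrightarrow> \<kappa> x = \<kappa> y"
    and f [measurable]: "f \<in> borel_measurable S"
    and io: "AE \<omega> in M. \<exists>\<^sub>\<infinity>n. X n \<omega> \<in> \<alpha>"
begin

definition traj :: "'w \<Rightarrow> nat \<Rightarrow> 'a" where "traj \<omega> = (\<lambda>i. X i \<omega>)"

text \<open>Index 0 is the stretch up to the first visit. Its law depends on the initial
  distribution, so the i.i.d. sequence starts at index 1.\<close>

definition Y :: "nat \<Rightarrow> 'w \<Rightarrow> real" where "Y j \<omega> = block_sum f (block \<alpha> (traj \<omega>) j)"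

text \<open>The common law of the \<open>Y j\<close> with \<open>1 \<le> j\<close>, realized as the
  sum over block 0 of a chain started in the atom.\<close>

definition Q :: "real set \<Rightarrow> ennreal" where
  "Q C = emeasure (atom_law S \<kappa> \<alpha>) {w\<in>space (paths S). block_sum f (block \<alpha> w 0) \<in> C}"

lemma traj_measurable [measurable]: "traj \<in> M \<rightarrow>\<^sub>M paths S"
  unfolding traj_def by (rule measurable_paths) simp

lemma Y_measurable [measurable]: "Y j \<in> borel_measurable M"
  unfolding Y_def using measurable_compose[OF traj_measurable measurable_block_sum_block[OF \<alpha> f]] .

lemma sets_block_sum:
  assumes "C \<in> sets borel"
  shows "{w\<in>space (paths S). block_sum f (block \<alpha> w j) \<in> C} \<in> sets (paths S)"
  using measurable_sets[OF measurable_block_sum_block[OF \<alpha> f] assms] by (simp add: vimage_def Int_def conj_commute)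

lemma atom_point: "(SOME x. x \<in> \<alpha>) \<in> \<alpha>" "(SOME x. x \<in> \<alpha>) \<in> space S"
  using \<alpha>_nonempty sets.sets_into_space[OF \<alpha>] some_in_eq[of \<alpha>] by auto

lemma Q_UNIV: "Q UNIV = 1"
proof -
  have "prob_space (atom_law S \<kappa> \<alpha>)" "sets (atom_law S \<kappa> \<alpha>) = sets (paths S)"
    unfolding atom_law_def using measurable_space[OF measurable_path_law[OF \<kappa>] atom_point(2)]
    by (simp_all add: space_prob_algebra)
  then show ?thesis
    unfolding Q_def using prob_space.emeasure_space_1[of "atom_law S \<kappa> \<alpha>"] sets_eq_imp_space_eq[of "atom_law S \<kappa> \<alpha>" "paths S"]
    by simp
qed

text \<open>On \<open>D\<close> the chain sits in the atom at the fixed time \<open>m\<close>. The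
  Markov property gives the law of the next block from \<open>X m \<omega>\<close>, and this law is
  the same for all states of the atom because block 0 ignores its starting state.\<close>

lemma regeneration:
  assumes D: "D \<in> sets (history M S X m)" and sub: "\<And>\<omega>. \<omega> \<in> D \<Longrightarrow> X m \<omega> \<in> \<alpha>" and C: "C \<in> sets borel"
  shows "emeasure M (D \<inter> {\<omega>\<in>space M. block_sum f (block \<alpha> (\<lambda>i. X (m + i) \<omega>) 0) \<in> C}) = emeasure M D * Q C"
proof -
  let ?B = "{w\<in>space (paths S). block_sum f (block \<alpha> w 0) \<in> C}"
  have B: "?B \<in> sets (paths S)" by (rule sets_block_sum[OF C])
  have "{\<omega>\<in>space M. block_sum f (block \<alpha> (\<lambda>i. X (m + i) \<omega>) 0) \<in> C} = {\<omega>\<in>space M. (\<lambda>i. X (m + i) \<omega>) \<in> ?B}"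
    using measurable_space[OF measurable_shift] by auto
  then have "emeasure M (D \<inter> {\<omega>\<in>space M. block_sum f (block \<alpha> (\<lambda>i. X (m + i) \<omega>) 0) \<in> C}) =
      (\<integral>\<^sup>+\<omega>. indicator D \<omega> * emeasure (path_law S \<kappa> (return S (X m \<omega>))) ?B \<partial>M)"
    using markov_property[OF D B] by simp
  also have "\<dots> = (\<integral>\<^sup>+\<omega>. Q C * indicator D \<omega> \<partial>M)"
  proof (rule nn_integral_cong)
    fix \<omega> assume \<omega>: "\<omega> \<in> space M"
    have *: "emeasure (path_law S \<kappa> (return S (X m \<omega>))) ?B = Q C" if "\<omega> \<in> D"
      unfolding Q_def atom_law_def
    proof (rule path_law_atom[OF \<kappa> measurable_space[OF X \<omega>] atom_point(2)])
      show "\<kappa> (X m \<omega>) = \<kappa> (SOME x. x \<in> \<alpha>)" by (rule atom[OF sub[OF that] atom_point(1)])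
      show "?B \<in> sets (paths S)" by (rule B)
    next
      fix w w' assume w: "w \<in> space (paths S)" "w' \<in> space (paths S)" and "\<And>i. 1 \<le> i \<Longrightarrow> w i = w' i"
      then have "block \<alpha> w 0 = block \<alpha> w' 0" by (intro block_0_cong)
      then show "w \<in> ?B \<longleftrightarrow> w' \<in> ?B" using w by simp
    qed
    show "indicator D \<omega> * emeasure (path_law S \<kappa> (return S (X m \<omega>))) ?B = Q C * indicator D \<omega>"
      using * by (cases "\<omega> \<in> D") simp_all
  qed
  also have "\<dots> = Q C * emeasure M D"
    by (rule nn_integral_cmult_indicator) (rule history_sets[OF D])
  finally show ?thesis by (simp add: mult.commute)
qed

end

section \<open>Independence of the successive blocks\<close>

context markov_atom
begin

definition before :: "(nat \<Rightarrow> real set) \<Rightarrow> nat \<Rightarrow> 'w set" where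
  "before C j = {\<omega>\<in>space M. \<forall>i\<in>{1..<j}. Y i \<omega> \<in> C i}"

lemma before_sets [measurable]: "(\<And>i. C i \<in> sets borel) \<Longrightarrow> before C j \<in> sets M"
  unfolding before_def
  by (intro sets.sets_Collect_finite_All) (auto intro: measurable_sets_Collect)

text \<open>If the \<open>j\<close>-th visit happens at time \<open>m\<close>, the blocks 1 to
  \<open>j - 1\<close> are complete by then, so both conditions can be read off from the states up
  to \<open>m\<close>.\<close>

lemma before_history:
  assumes C: "\<And>i. C i \<in> sets borel"
  shows "before C j \<inter> {\<omega>\<in>space M. return_time \<alpha> (traj \<omega>) j = enat m} \<in> sets (history M S X m)"
proof -
  define G where "G w \<longleftrightarrow> return_time \<alpha> w j = enat m \<and> (\<forall>i\<in>{1..<j}. block_sum f (block \<alpha> w i) \<in> C i)" for w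
  have [measurable]: "Measurable.pred (paths S) G"
  proof -
    note [measurable] = measurable_return_time[OF \<alpha>] measurable_block_sum_block[OF \<alpha> f] C
    show ?thesis unfolding G_def by measurable
  qed
  have imp: "G w'" if eq: "\<And>i. i \<le> m \<Longrightarrow> w i = w' i" and G: "G w" for w w'
  proof -
    have v: "visits \<alpha> w n = visits \<alpha> w' n" if "n \<le> m" for n
      using that by (induction n) (auto simp: eq)
    have r: "return_time \<alpha> w j = enat m" using G unfolding G_def by blast
    then have "return_time \<alpha> w' j = enat m" unfolding return_time_eq_iff by (simp add: v)
    moreover have "block \<alpha> w i = block \<alpha> w' i" if "i \<in> {1..<j}" for i
    proof (rule block_local(2)[of m])
      show "i \<in> {1..num_blocks \<alpha> w m}"
        using that r unfolding return_time_eq_iff num_blocks_eq by auto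
    qed (rule eq)
    ultimately show "G w'" using G unfolding G_def by simp
  qed
  have "(\<lambda>\<omega>. G (\<lambda>i. X i \<omega>)) \<in> history M S X m \<rightarrow>\<^sub>M count_space UNIV"
  proof (rule measurable_history[OF X])
    fix w w' :: "nat \<Rightarrow> 'a" assume "\<And>i. i \<le> m \<Longrightarrow> w i = w' i"
    then show "G w = G w'" using imp[of w w'] imp[of w' w] by metis
  qed measurable
  then have "{\<omega>\<in>space (history M S X m). G (\<lambda>i. X i \<omega>)} \<in> sets (history M S X m)" by measurable
  moreover have "{\<omega>\<in>space (history M S X m). G (\<lambda>i. X i \<omega>)} =
      before C j \<inter> {\<omega>\<in>space M. return_time \<alpha> (traj \<omega>) j = enat m}"
    unfolding G_def before_def Y_def traj_def by auto
  ultimately show ?thesis by simp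
qed

text \<open>Return times are almost surely finite, so a random visit time can be replaced by
  countably many constants \<open>m\<close>. This reduces the strong Markov property to the one at
  fixed times.\<close>

lemma emeasure_split_return_time:
  assumes [measurable]: "E \<in> sets M"
  shows "emeasure M E = (\<Sum>m. emeasure M (E \<inter> {\<omega>\<in>space M. return_time \<alpha> (traj \<omega>) j = enat m}))"
proof -
  let ?R = "\<lambda>m. {\<omega>\<in>space M. return_time \<alpha> (traj \<omega>) j = enat m}"
  have [measurable]: "(\<lambda>\<omega>. return_time \<alpha> (traj \<omega>) j) \<in> M \<rightarrow>\<^sub>M count_space UNIV"
    using measurable_compose[OF traj_measurable measurable_return_time[OF \<alpha>]] .
  have "(\<Sum>m. emeasure M (E \<inter> ?R m)) = emeasure M (\<Union>m. E \<inter> ?R m)"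
    by (rule suminf_emeasure) (auto simp: disjoint_family_on_def)
  also have "\<dots> = emeasure M E"
  proof (rule emeasure_eq_AE)
    show "AE \<omega> in M. \<omega> \<in> (\<Union>m. E \<inter> ?R m) \<longleftrightarrow> \<omega> \<in> E"
      using io AE_space
    proof eventually_elim
      case (elim \<omega>)
      then have "return_time \<alpha> (traj \<omega>) j \<noteq> \<infinity>" unfolding traj_def by (rule_tac return_time_finite)
      then show ?case using elim(2) by auto
    qed
  qed auto
  finally show ?thesis ..
qed

text \<open>For each value \<open>m\<close> of the \<open>j\<close>-th return time, the earlier
  blocks form a past event and block \<open>j\<close> is block 0 of the path shifted by
  \<open>m\<close>. \<open>regeneration\<close> splits off a factor that does not depend on
  \<open>m\<close>, so the sum over \<open>m\<close> can be closed again.\<close>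

lemma block_independent_of_past:
  assumes C: "\<And>i. C i \<in> sets borel" and j: "1 \<le> j"
  shows "emeasure M (before C (Suc j)) = emeasure M (before C j) * Q (C j)"
proof -
  let ?R = "\<lambda>m. {\<omega>\<in>space M. return_time \<alpha> (traj \<omega>) j = enat m}"
  have R: "?R m \<in> sets M" for m
    using measurable_compose[OF traj_measurable measurable_return_time[OF \<alpha>]] by measurable
  have eq: "emeasure M (before C (Suc j) \<inter> ?R m) = emeasure M (before C j \<inter> ?R m) * Q (C j)" for m
  proof -
    have hist: "before C j \<inter> ?R m \<in> sets (history M S X m)" by (rule before_history[where C=C, OF C])
    have at: "X m \<omega> \<in> \<alpha>" if "\<omega> \<in> before C j \<inter> ?R m" for \<omega>
    proof -
      \<comment> \<open>Here \<open>1 \<le> j\<close> matters: the return time of index 0 is 0, and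
        at time 0 the chain may be outside the atom.\<close>
      obtain l where l: "j = Suc l" using j by (cases j) auto
      show ?thesis using that return_time_Suc_eq_iff[of \<alpha> "traj \<omega>" l m] unfolding l by (simp add: traj_def)
    qed
    have "emeasure M (before C (Suc j) \<inter> ?R m) =
        emeasure M ((before C j \<inter> ?R m) \<inter> {\<omega>\<in>space M. block_sum f (block \<alpha> (\<lambda>i. X (m + i) \<omega>) 0) \<in> C j})"
    proof (rule emeasure_eq_AE)
      show "AE \<omega> in M. \<omega> \<in> before C (Suc j) \<inter> ?R m \<longleftrightarrow>
          \<omega> \<in> (before C j \<inter> ?R m) \<inter> {\<omega>\<in>space M. block_sum f (block \<alpha> (\<lambda>i. X (m + i) \<omega>) 0) \<in> C j}"
        using io AE_space
      proof eventually_elim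
        case (elim \<omega>)
        then have fin: "return_time \<alpha> (traj \<omega>) (Suc j) \<noteq> \<infinity>" unfolding traj_def by (rule_tac return_time_finite)
        have "Y j \<omega> = block_sum f (block \<alpha> (\<lambda>i. X (m + i) \<omega>) 0)" if "\<omega> \<in> ?R m"
          unfolding Y_def using block_shift[of \<alpha> "traj \<omega>" j m] fin that by (simp add: traj_def)
        moreover have "{1..<Suc j} = insert j {1..<j}" using j by auto
        ultimately show ?case unfolding before_def using elim(2) by auto
      qed
      show "before C (Suc j) \<inter> ?R m \<in> sets M" using before_sets[where C=C, OF C] R by blast
      have "{\<omega>\<in>space M. block_sum f (block \<alpha> (\<lambda>i. X (m + i) \<omega>) 0) \<in> C j} \<in> sets M"
        using measurable_sets[OF measurable_compose[OF measurable_shift measurable_block_sum_block[OF \<alpha> f]] C]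
        by (simp add: vimage_def Int_def conj_commute)
      then show "before C j \<inter> ?R m \<inter> {\<omega>\<in>space M. block_sum f (block \<alpha> (\<lambda>i. X (m + i) \<omega>) 0) \<in> C j} \<in> sets M"
        using before_sets[where C=C, OF C] R by blast
    qed
    also have "\<dots> = emeasure M (before C j \<inter> ?R m) * Q (C j)"
      by (rule regeneration[OF hist at C])
    finally show ?thesis .
  qed
  have "emeasure M (before C (Suc j)) = (\<Sum>m. emeasure M (before C j \<inter> ?R m) * Q (C j))"
    unfolding emeasure_split_return_time[OF before_sets[where C=C, OF C], of "Suc j" j] eq ..
  also have "\<dots> = emeasure M (before C j) * Q (C j)"
    unfolding emeasure_split_return_time[OF before_sets[where C=C, OF C], of j j] by (rule ennreal_suminf_multc)
  finally show ?thesis .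
qed

theorem iid_blocks: "iid (\<lambda>i. Y (Suc i))"
proof (rule iidI)
  show "measure (atom_law S \<kappa> \<alpha>) {w\<in>space (paths S). block_sum f (block \<alpha> w 0) \<in> UNIV} = 1"
    using Q_UNIV unfolding Q_def measure_def by simp
  fix n and C :: "nat \<Rightarrow> real set" assume C: "\<And>i. C i \<in> sets borel"
  let ?q = "\<lambda>C. measure (atom_law S \<kappa> \<alpha>) {w\<in>space (paths S). block_sum f (block \<alpha> w 0) \<in> C}"
  \<comment> \<open>Blocks are numbered from 1 and the sequences of \<open>iid\<close> from 0, hence
    the shift. \<open>C' 0\<close> constrains nothing, since \<open>before\<close> starts at index
    1.\<close>
  define C' where "C' i = C (i - 1)" for i :: nat
  have C': "C' i \<in> sets borel" for i unfolding C'_def by (rule C)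
  have K: "prob_space (atom_law S \<kappa> \<alpha>)"
    unfolding atom_law_def using measurable_space[OF measurable_path_law[OF \<kappa>] atom_point(2)]
    by (simp add: space_prob_algebra)
  have Q: "Q D = ennreal (?q D)" for D
    unfolding Q_def using prob_space.finite_measure[OF K] by (rule finite_measure.emeasure_eq_measure)
  have "emeasure M (before C' (Suc n)) = ennreal (\<Prod>i<n. ?q (C i))"
  proof (induction n)
    case 0
    have "before C' (Suc 0) = space M" unfolding before_def by auto
    then show ?case by (simp add: emeasure_space_1)
  next
    case (Suc n)
    have "emeasure M (before C' (Suc (Suc n))) = ennreal (\<Prod>i<n. ?q (C i)) * Q (C' (Suc n))"
      using block_independent_of_past[OF C', of "Suc n"] Suc by simp
    moreover have "C' (Suc n) = C n" by (simp add: C'_def)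
    ultimately show ?case by (simp add: Q ennreal_mult prod_nonneg)
  qed
  moreover have "before C' (Suc n) = {\<omega>\<in>space M. \<forall>i<n. Y (Suc i) \<omega> \<in> C i}"
  proof -
    have "(\<forall>i\<in>{1..<Suc n}. Y i \<omega> \<in> C' i) \<longleftrightarrow> (\<forall>i<n. Y (Suc i) \<omega> \<in> C i)" for \<omega>
    proof safe
      fix i assume "\<forall>i\<in>{1..<Suc n}. Y i \<omega> \<in> C' i" "i < n"
      then show "Y (Suc i) \<omega> \<in> C i" by (auto simp: C'_def dest!: bspec[of _ _ "Suc i"])
    next
      fix i assume "\<forall>i<n. Y (Suc i) \<omega> \<in> C i" "i \<in> {1..<Suc n}"
      then show "Y i \<omega> \<in> C' i" by (cases i) (auto simp: C'_def)
    qed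
    then show ?thesis unfolding before_def by simp
  qed
  ultimately show "prob {\<omega>\<in>space M. \<forall>i<n. Y (Suc i) \<omega> \<in> C i} = (\<Prod>i<n. ?q (C i))"
    by (simp add: measure_def prod_nonneg)
qed measurable

end

section \<open>The conditional law of the bootstrap statistic\<close>

text \<open>The indicator of \<open>D\<close> can be pulled out of the conditional expectation, so
  an inclusion that holds only inside \<open>D\<close> still compares the conditional probabilities
  on \<open>D\<close>.\<close>

lemma (in finite_measure_subalgebra) real_cond_exp_indicator_mono_on:
  assumes D: "D \<in> sets F" and [measurable]: "A \<in> sets M" "C \<in> sets M" and sub: "D \<inter> C \<subseteq> A"
  shows "AE \<omega> in M. \<omega> \<in> D \<longrightarrow> real_cond_exp M F (indicator C) \<omega> \<le> real_cond_exp M F (indicator A) \<omega>"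
proof -
  have [measurable]: "D \<in> sets M" using D subalg unfolding subalgebra_def by blast
  have int: "integrable M (\<lambda>\<omega>. indicator D \<omega> * indicator E \<omega> :: real)" if "E \<in> sets M" for E
    using that by (simp flip: indicator_inter_arith add: integrable_indicator_iff less_top[symmetric])
  have mult: "AE \<omega> in M. real_cond_exp M F (\<lambda>\<omega>. indicator D \<omega> * indicator E \<omega>) \<omega> = indicator D \<omega> * real_cond_exp M F (indicator E) \<omega>"
    if "E \<in> sets M" for E
    by (rule real_cond_exp_mult) (use D that int in auto)
  have "AE \<omega> in M. real_cond_exp M F (\<lambda>\<omega>. indicator D \<omega> * indicator C \<omega>) \<omega> \<le> real_cond_exp M F (\<lambda>\<omega>. indicator D \<omega> * indicator A \<omega>) \<omega>"
    by (rule real_cond_exp_mono) (use sub int in \<open>auto split: split_indicator\<close>)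
  with mult[OF assms(2)] mult[OF assms(3)] show ?thesis
    by eventually_elim auto
qed

text \<open>Separates the two sources of randomness: the draws stay on the left, and the centring
  and scaling computed from the data move to the right.\<close>

lemma standardized_le_iff:
  fixes F :: "nat \<Rightarrow> real"
  assumes "1 \<le> k" "0 < s"
  shows "sqrt (real k) / s * (1 / real k * (\<Sum>j=1..k. F j - m)) \<le> x \<longleftrightarrow> (\<Sum>j=1..k. F j) \<le> real k * m + x * (s * sqrt (real k))"
proof -
  let ?r = "sqrt (real k)"
  have r: "0 < ?r" using assms(1) by simp
  have k: "real k = ?r * ?r" by simp
  have "(\<Sum>j=1..k. F j - m) = (\<Sum>j=1..k. F j) - real k * m" by (simp add: sum_subtractf)
  moreover have "?r / s * (1 / real k * Z) = Z / (s * ?r)" for Z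
    using r assms(2) by (subst k) (simp add: field_simps del: real_sqrt_mult_self)
  ultimately show ?thesis using r assms(2) by (simp add: pos_divide_le_eq le_diff_eq diff_le_eq add.commute)
qed

text \<open>The sum is left unstandardized, so that for fixed \<open>q\<close> the event is one
  fixed set of block vectors, as \<open>regeneration_bootstrap\<close> requires.\<close>

definition resampled_sum_cdf :: "'b measure \<Rightarrow> (nat \<Rightarrow> 'b) \<Rightarrow> ('b \<Rightarrow> real) \<Rightarrow> nat \<Rightarrow> real \<Rightarrow> real" where
  "resampled_sum_cdf N b F k q =
    measure (PiM {1..k} (\<lambda>_. empirical_law N b k)) {c\<in>space (PiM {1..k} (\<lambda>_. N)). (\<Sum>j=1..k. F (c j)) \<le> q}"

lemma resampled_sum_cdf_mono:
  assumes b: "\<And>j. b j \<in> space N" and [measurable]: "F \<in> borel_measurable N" and k: "1 \<le> k" and "p \<le> q"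
  shows "resampled_sum_cdf N b F k p \<le> resampled_sum_cdf N b F k q"
proof -
  interpret prob_space "PiM {1..k} (\<lambda>_. empirical_law N b k)"
    by (intro prob_space_PiM prob_space_empirical_law b k)
  have s: "sets (PiM {1..k} (\<lambda>_. empirical_law N b k)) = sets (PiM {1..k} (\<lambda>_. N))"
    by (intro sets_PiM_cong refl) (simp add: empirical_law_def)
  show ?thesis
    unfolding resampled_sum_cdf_def
  proof (rule finite_measure_mono)
    show "{c\<in>space (PiM {1..k} (\<lambda>_. N)). (\<Sum>j=1..k. F (c j)) \<le> q} \<in> sets (PiM {1..k} (\<lambda>_. empirical_law N b k))"
      unfolding s by measurable
  qed (use \<open>p \<le> q\<close> in auto)
qed

section \<open>Sandwich for the conditional probability of the bootstrap event\<close>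

context markov_atom
begin

abbreviation T :: "'w \<Rightarrow> nat \<Rightarrow> nat" where "T \<omega> n \<equiv> num_blocks \<alpha> (traj \<omega>) n"

definition threshold :: "nat \<Rightarrow> real \<Rightarrow> 'w \<Rightarrow> real" where
  "threshold n x \<omega> = real (T \<omega> n) * mu_hat \<alpha> f (traj \<omega>) n + x * (sigma_hat \<alpha> f (traj \<omega>) n * sqrt (real (T \<omega> n)))"

context
  fixes B :: "nat \<Rightarrow> nat \<Rightarrow> 'w \<Rightarrow> 'a list"
  assumes B: "regeneration_bootstrap M S \<alpha> X B"
begin

abbreviation event :: "nat \<Rightarrow> real \<Rightarrow> 'w set" where
  "event n x \<equiv> {\<omega>\<in>space M. bootstrap_statistic \<alpha> f (\<lambda>i. X i \<omega>) n (\<lambda>j. B n j \<omega>) \<le> x}"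

lemma measurable_B: "B n j \<in> M \<rightarrow>\<^sub>M block_space S"
  using B unfolding regeneration_bootstrap_def by blast

lemma measurable_B_sum [measurable]: "(\<lambda>\<omega>. block_sum f (B n j \<omega>)) \<in> borel_measurable M"
  by (rule measurable_compose[OF measurable_B measurable_block_sum[OF f]])

lemma history_measurable_statistics:
  shows "(\<lambda>\<omega>. T \<omega> n) \<in> history M S X n \<rightarrow>\<^sub>M count_space UNIV"
    and "(\<lambda>\<omega>. mu_hat \<alpha> f (traj \<omega>) n) \<in> borel_measurable (history M S X n)"
    and "(\<lambda>\<omega>. sigma_hat \<alpha> f (traj \<omega>) n) \<in> borel_measurable (history M S X n)"
  unfolding traj_def
  by (rule measurable_history[OF X measurable_num_blocks[OF \<alpha>]], rule block_local, assumption,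
      rule measurable_history[OF X measurable_hat(1)[OF \<alpha> f]], rule hat_local, assumption,
      rule measurable_history[OF X measurable_hat(2)[OF \<alpha> f]], rule hat_local, assumption)

lemma statistic_le_iff:
  assumes "1 \<le> T \<omega> n" "0 < sigma_hat \<alpha> f (traj \<omega>) n"
  shows "bootstrap_statistic \<alpha> f (\<lambda>i. X i \<omega>) n b \<le> x \<longleftrightarrow> (\<Sum>j=1..T \<omega> n. block_sum f (b j)) \<le> threshold n x \<omega>"
  using assms unfolding bootstrap_statistic_def threshold_def traj_def by (rule standardized_le_iff)

lemma event_sets: "event n x \<in> sets M"
proof -
  note [measurable] = history_measurable_statistics[THEN measurable_from_subalg[OF subalgebra_history[where X=X and n=n, OF X]]]
  have *: "(\<lambda>\<omega>. \<Sum>j=1..k. block_sum f (B n j \<omega>) - mu_hat \<alpha> f (traj \<omega>) n) \<in> borel_measurable M" for k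
    by measurable
  have [measurable]: "(\<lambda>\<omega>. \<Sum>j=1..T \<omega> n. block_sum f (B n j \<omega>) - mu_hat \<alpha> f (traj \<omega>) n) \<in> borel_measurable M"
    by (rule measurable_compose_countable[OF *, where g="\<lambda>\<omega>. T \<omega> n"]) measurable
  have [measurable]: "(\<lambda>\<omega>. real (T \<omega> n)) \<in> borel_measurable M" by measurable
  show ?thesis unfolding bootstrap_statistic_def traj_def[symmetric] by measurable
qed

text \<open>For fixed \<open>q\<close> the event that the draws sum to at most \<open>q\<close> has
  a known conditional probability. Whether the random threshold lies above or below \<open>q\<close>
  is decided by the history, and on each of these two history events one of the sets contains the
  other.\<close>

lemma conditional_sandwich_rational:
  assumes k: "1 \<le> k"
  shows "AE \<omega> in M. T \<omega> n = k \<and> 0 < sigma_hat \<alpha> f (traj \<omega>) n \<longrightarrow>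
    (q \<le> threshold n x \<omega> \<longrightarrow> resampled_sum_cdf (block_space S) (block \<alpha> (traj \<omega>)) (block_sum f) k q
        \<le> real_cond_exp M (history M S X n) (indicator (event n x)) \<omega>) \<and>
    (threshold n x \<omega> \<le> q \<longrightarrow> real_cond_exp M (history M S X n) (indicator (event n x)) \<omega>
        \<le> resampled_sum_cdf (block_space S) (block \<alpha> (traj \<omega>)) (block_sum f) k q)"
proof -
  let ?F = "history M S X n"
  interpret F: finite_measure_subalgebra M ?F
    by unfold_locales (rule subalgebra_history[OF X])
  note [measurable] = history_measurable_statistics[of n] measurable_block_sum[OF f]
  define C where "C = {c\<in>space (PiM {1..k} (\<lambda>_. block_space S)). (\<Sum>j=1..k. block_sum f (c j)) \<le> q}"
  have C: "C \<in> sets (PiM {1..k} (\<lambda>_. block_space S))" unfolding C_def by measurable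
  define A where "A = {\<omega>\<in>space M. (\<lambda>j\<in>{1..k}. B n j \<omega>) \<in> C}"
  have A_eq: "A = {\<omega>\<in>space M. (\<Sum>j=1..k. block_sum f (B n j \<omega>)) \<le> q}"
    unfolding A_def C_def using measurable_space[OF measurable_B] by (auto simp: space_PiM)
  have A: "A \<in> sets M" unfolding A_eq by measurable
  have cond: "AE \<omega> in M. T \<omega> n = k \<longrightarrow> real_cond_exp M ?F (indicator A) \<omega> =
      resampled_sum_cdf (block_space S) (block \<alpha> (traj \<omega>)) (block_sum f) k q"
  proof -
    have "AE \<omega> in M. T \<omega> n = k \<longrightarrow> real_cond_exp M ?F (indicator A) \<omega> =
        measure (PiM {1..k} (\<lambda>_. empirical_block_law S \<alpha> (\<lambda>i. X i \<omega>) n)) C"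
      using B k C unfolding regeneration_bootstrap_def A_def traj_def by blast
    then show ?thesis
      by eventually_elim (auto simp: resampled_sum_cdf_def empirical_block_law_def empirical_law_def traj_def C_def)
  qed
  let ?G = "{\<omega>\<in>space ?F. T \<omega> n = k \<and> 0 < sigma_hat \<alpha> f (traj \<omega>) n}"
  define D1 where "D1 = {\<omega>\<in>space ?F. T \<omega> n = k \<and> 0 < sigma_hat \<alpha> f (traj \<omega>) n \<and> q \<le> threshold n x \<omega>}"
  define D2 where "D2 = {\<omega>\<in>space ?F. T \<omega> n = k \<and> 0 < sigma_hat \<alpha> f (traj \<omega>) n \<and> threshold n x \<omega> \<le> q}"
  have [measurable]: "(\<lambda>\<omega>. real (T \<omega> n)) \<in> borel_measurable ?F"
    by (rule measurable_compose[OF history_measurable_statistics(1)]) simp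
  have [measurable]: "threshold n x \<in> borel_measurable ?F" unfolding threshold_def by measurable
  have D: "D1 \<in> sets ?F" "D2 \<in> sets ?F" unfolding D1_def D2_def by measurable
  have "D1 \<inter> A \<subseteq> event n x" "D2 \<inter> event n x \<subseteq> A"
    using k statistic_le_iff unfolding D1_def D2_def A_eq by auto
  from F.real_cond_exp_indicator_mono_on[OF D(1) event_sets A this(1)]
    F.real_cond_exp_indicator_mono_on[OF D(2) A event_sets this(2)] cond AE_space
  show ?thesis by eventually_elim (auto simp: D1_def D2_def)
qed

text \<open>A positive deviation makes the thresholds at \<open>y\<close> and \<open>x\<close>
  distinct, so a rational fits between them and links the two by monotonicity. All times, sample
  sizes and rationals share one null set; the level \<open>y = x\<close> itself is out of
  reach.\<close>

lemma conditional_sandwich: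
  "AE \<omega> in M. \<forall>n. 1 \<le> T \<omega> n \<and> 0 < sigma_hat \<alpha> f (traj \<omega>) n \<longrightarrow>
    (\<forall>y<x. resampled_sum_cdf (block_space S) (block \<alpha> (traj \<omega>)) (block_sum f) (T \<omega> n) (threshold n y \<omega>)
        \<le> real_cond_exp M (history M S X n) (indicator (event n x)) \<omega>) \<and>
    (\<forall>y>x. real_cond_exp M (history M S X n) (indicator (event n x)) \<omega>
        \<le> resampled_sum_cdf (block_space S) (block \<alpha> (traj \<omega>)) (block_sum f) (T \<omega> n) (threshold n y \<omega>))"
proof -
  have "AE \<omega> in M. \<forall>n k (q::rat). 1 \<le> k \<longrightarrow> T \<omega> n = k \<and> 0 < sigma_hat \<alpha> f (traj \<omega>) n \<longrightarrow>
    (of_rat q \<le> threshold n x \<omega> \<longrightarrow> resampled_sum_cdf (block_space S) (block \<alpha> (traj \<omega>)) (block_sum f) k (of_rat q)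
        \<le> real_cond_exp M (history M S X n) (indicator (event n x)) \<omega>) \<and>
    (threshold n x \<omega> \<le> of_rat q \<longrightarrow> real_cond_exp M (history M S X n) (indicator (event n x)) \<omega>
        \<le> resampled_sum_cdf (block_space S) (block \<alpha> (traj \<omega>)) (block_sum f) k (of_rat q))"
    unfolding AE_all_countable
  proof (intro allI)
    fix n k q
    show "AE \<omega> in M. 1 \<le> k \<longrightarrow> T \<omega> n = k \<and> 0 < sigma_hat \<alpha> f (traj \<omega>) n \<longrightarrow>
    (of_rat q \<le> threshold n x \<omega> \<longrightarrow> resampled_sum_cdf (block_space S) (block \<alpha> (traj \<omega>)) (block_sum f) k (of_rat q)
        \<le> real_cond_exp M (history M S X n) (indicator (event n x)) \<omega>) \<and>
    (threshold n x \<omega> \<le> of_rat q \<longrightarrow> real_cond_exp M (history M S X n) (indicator (event n x)) \<omega>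
        \<le> resampled_sum_cdf (block_space S) (block \<alpha> (traj \<omega>)) (block_sum f) k (of_rat q))"
    proof (cases "1 \<le> k")
      case True
      show ?thesis using conditional_sandwich_rational[OF True, of n "of_rat q" x] by eventually_elim blast
    qed simp
  qed
  then show ?thesis
    using AE_space
  proof eventually_elim
    case (elim \<omega>)
    let ?E = "\<lambda>n. real_cond_exp M (history M S X n) (indicator (event n x)) \<omega>"
    let ?H = "\<lambda>k q. resampled_sum_cdf (block_space S) (block \<alpha> (traj \<omega>)) (block_sum f) k q"
    have bsp: "block \<alpha> (traj \<omega>) j \<in> space (block_space S)" for j
      using measurable_space[OF X elim(2)] by (intro block_in_space) (simp add: traj_def)
    show ?case
    proof (intro allI impI conjI)
      fix n y assume n: "1 \<le> T \<omega> n \<and> 0 < sigma_hat \<alpha> f (traj \<omega>) n"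
      have mono: "?H (T \<omega> n) p \<le> ?H (T \<omega> n) q" if "p \<le> q" for p q
        using n that by (intro resampled_sum_cdf_mono bsp measurable_block_sum f) auto
      have s: "0 < sigma_hat \<alpha> f (traj \<omega>) n * sqrt (real (T \<omega> n))" using n by simp
      { assume "y < x"
        then have "threshold n y \<omega> < threshold n x \<omega>" unfolding threshold_def using s by (intro add_strict_left_mono mult_strict_right_mono)
        then obtain q where q: "threshold n y \<omega> < of_rat q" "of_rat q < threshold n x \<omega>" using of_rat_dense by blast
        have "?H (T \<omega> n) (threshold n y \<omega>) \<le> ?H (T \<omega> n) (of_rat q)" using q by (intro mono) simp
        also have "\<dots> \<le> ?E n" using elim(1) n q by simp
        finally show "?H (T \<omega> n) (threshold n y \<omega>) \<le> ?E n" . }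
      { assume "x < y"
        then have "threshold n x \<omega> < threshold n y \<omega>" unfolding threshold_def using s by (intro add_strict_left_mono mult_strict_right_mono)
        then obtain q where q: "threshold n x \<omega> < of_rat q" "of_rat q < threshold n y \<omega>" using of_rat_dense by blast
        have "?E n \<le> ?H (T \<omega> n) (of_rat q)" using elim(1) n q by simp
        also have "\<dots> \<le> ?H (T \<omega> n) (threshold n y \<omega>)" using q by (intro mono) simp
        finally show "?E n \<le> ?H (T \<omega> n) (threshold n y \<omega>)" . }
    qed
  qed
qed

end

end

section \<open>The almost sure limit\<close>

context markov_atom
begin

lemma empirical_moments:
  assumes int: "integrable M (\<lambda>\<omega>. (Y 1 \<omega>)\<^sup>2)"
  shows "AE \<omega> in M. empirical_mean (\<lambda>j. Y j \<omega>) \<longlonglongrightarrow> expectation (Y 1)"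
    and "AE \<omega> in M. empirical_mean (\<lambda>j. (Y j \<omega>)\<^sup>2) \<longlonglongrightarrow> expectation (\<lambda>\<omega>. (Y 1 \<omega>)\<^sup>2)"
proof -
  have *: "(\<Sum>i<k. y (Suc i)) / real k = empirical_mean y k" for y :: "nat \<Rightarrow> real" and k
    unfolding empirical_mean_def by (simp add: sum.atLeast1_atMost_eq)
  have "integrable M (Y 1)" by (rule square_integrable_imp_integrable[OF _ int]) simp
  then show "AE \<omega> in M. empirical_mean (\<lambda>j. Y j \<omega>) \<longlonglongrightarrow> expectation (Y 1)"
    using strong_law_of_large_numbers[OF iid_blocks] *[of "\<lambda>j. Y j _"] by simp
  have "iid (\<lambda>i \<omega>. (Y (Suc i) \<omega>)\<^sup>2)" by (rule iid_compose[OF iid_blocks]) simp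
  from strong_law_of_large_numbers[OF this] int *[of "\<lambda>j. (Y j _)\<^sup>2"]
  show "AE \<omega> in M. empirical_mean (\<lambda>j. (Y j \<omega>)\<^sup>2) \<longlonglongrightarrow> expectation (\<lambda>\<omega>. (Y 1 \<omega>)\<^sup>2)" by simp
qed

text \<open>Along one path outside the null sets, the limit is first taken in the sample size and
  then composed with \<open>T \<omega>\<close>. As it holds along all sample sizes, the dependence
  between \<open>T\<close> and the block sums does no harm.\<close>

theorem bootstrap_clt:
  assumes B: "regeneration_bootstrap M S \<alpha> X B"
    and int: "integrable M (\<lambda>\<omega>. (Y 1 \<omega>)\<^sup>2)" and var: "0 < variance (Y 1)"
  shows "AE \<omega> in M. (\<lambda>n. real_cond_exp M (history M S X n) (indicator (event B n x)) \<omega>)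
    \<longlonglongrightarrow> cdf std_normal_distribution x"
proof -
  have int1: "integrable M (Y 1)" by (rule square_integrable_imp_integrable[OF _ int]) simp
  have pos: "0 < expectation (\<lambda>\<omega>. (Y 1 \<omega>)\<^sup>2) - (expectation (Y 1))\<^sup>2"
    using var unfolding variance_eq[OF int1 int] .
  show ?thesis
    using empirical_moments[OF int] conditional_sandwich[OF B, of x] io AE_space
  proof eventually_elim
    case (elim \<omega>)
    let ?b = "block \<alpha> (traj \<omega>)" and ?N = "block_space S" and ?F = "block_sum f"
    let ?y = "\<lambda>j. ?F (?b j)"
    have mean: "empirical_mean ?y \<longlonglongrightarrow> expectation (Y 1)"
      "empirical_mean (\<lambda>j. (?y j)\<^sup>2) \<longlonglongrightarrow> expectation (\<lambda>\<omega>. (Y 1 \<omega>)\<^sup>2)"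
      using elim(1,2) unfolding Y_def .
    have bsp: "?b j \<in> space ?N" for j
      using measurable_space[OF X elim(5)] by (intro block_in_space) (simp add: traj_def)
    have T: "filterlim (T \<omega>) at_top sequentially"
      using num_blocks_tendsto_infinity[of "traj \<omega>" \<alpha>] elim(4) unfolding traj_def by simp
    let ?th = "\<lambda>k z. real k * empirical_mean ?y k + z * (empirical_sd ?y k * sqrt (real k))"
    note clt = resampling_clt[OF bsp measurable_block_sum[OF f] mean pos]
    have "0 < sqrt (expectation (\<lambda>\<omega>. (Y 1 \<omega>)\<^sup>2) - (expectation (Y 1))\<^sup>2)" using pos by simp
    from order_tendstoD(1)[OF clt(2) this] eventually_ge_at_top[of 1]
    have good: "\<forall>\<^sub>F k in sequentially. 0 < empirical_sd ?y k \<and> 1 \<le> k"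
      by eventually_elim blast
    have lim: "(\<lambda>n. resampled_sum_cdf ?N ?b ?F (T \<omega> n) (threshold n z \<omega>)) \<longlonglongrightarrow> cdf std_normal_distribution z" for z
    proof -
      have "(\<lambda>k. resampled_sum_cdf ?N ?b ?F k (?th k z)) \<longlonglongrightarrow> cdf std_normal_distribution z"
      proof (rule Lim_transform_eventually[OF clt(1)])
        show "\<forall>\<^sub>F k in sequentially. measure (PiM {1..k} (\<lambda>_. empirical_law ?N ?b k))
          {c\<in>space (PiM {1..k} (\<lambda>_. ?N)). sqrt (real k) / empirical_sd ?y k * (1 / real k * (\<Sum>j=1..k. ?F (c j) - empirical_mean ?y k)) \<le> z}
          = resampled_sum_cdf ?N ?b ?F k (?th k z)"
          using good by eventually_elim (simp only: resampled_sum_cdf_def standardized_le_iff)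
      qed
      from filterlim_compose[OF this T] show ?thesis
        unfolding threshold_def mu_hat_eq sigma_hat_eq .
    qed
    have ev: "\<forall>\<^sub>F n in sequentially. 0 < sigma_hat \<alpha> f (traj \<omega>) n \<and> 1 \<le> T \<omega> n"
      using eventually_compose_filterlim[OF good T] unfolding sigma_hat_eq .
    let ?E = "\<lambda>n. real_cond_exp M (history M S X n) (indicator (event B n x)) \<omega>"
    show "?E \<longlonglongrightarrow> cdf std_normal_distribution x"
    \<comment> \<open>The sandwich reaches only levels other than \<open>x\<close>. Continuity of
      the normal distribution function provides a \<open>z < x\<close> whose value is still above
      \<open>a\<close> for the lower bound, and symmetrically a \<open>z > x\<close> for the upper
      one.\<close>
    proof (rule order_tendstoI)
      fix a assume "a < cdf std_normal_distribution x"
      then have "\<forall>\<^sub>F z in at x. a < cdf std_normal_distribution z"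
        using isCont_cdf_std_normal[of x] unfolding isCont_def by (rule_tac order_tendstoD(1))
      then have "\<forall>\<^sub>F z in at_left x. a < cdf std_normal_distribution z"
        by (simp add: eventually_at_split)
      then obtain l where "l < x" "\<And>z. l < z \<Longrightarrow> z < x \<Longrightarrow> a < cdf std_normal_distribution z"
        unfolding eventually_at_left_field by blast
      then obtain z where z: "z < x" "a < cdf std_normal_distribution z" using dense by blast
      from order_tendstoD(1)[OF lim z(2)] ev
      show "\<forall>\<^sub>F n in sequentially. a < ?E n"
        by eventually_elim (use elim(3) z(1) in \<open>meson order_less_le_trans\<close>)
    next
      fix a assume "cdf std_normal_distribution x < a"
      then have "\<forall>\<^sub>F z in at x. cdf std_normal_distribution z < a"
        using isCont_cdf_std_normal[of x] unfolding isCont_def by (rule_tac order_tendstoD(2))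
      then have "\<forall>\<^sub>F z in at_right x. cdf std_normal_distribution z < a"
        by (simp add: eventually_at_split)
      then obtain l where "x < l" "\<And>z. x < z \<Longrightarrow> z < l \<Longrightarrow> cdf std_normal_distribution z < a"
        unfolding eventually_at_right_field by blast
      then obtain z where z: "x < z" "cdf std_normal_distribution z < a" using dense by blast
      from order_tendstoD(2)[OF lim z(2)] ev
      show "\<forall>\<^sub>F n in sequentially. ?E n < a"
        by eventually_elim (use elim(3) z(1) in \<open>meson order_le_less_trans\<close>)
    qed
  qed
qed

end

theorem theorem3p1:
  fixes M :: "'w measure" and S :: "'a measure" and \<kappa> :: "'a \<Rightarrow> 'a measure"
    and \<psi> :: "'a measure" and \<alpha> :: "'a set" and \<beta> :: real
    and X :: "nat \<Rightarrow> 'w \<Rightarrow> 'a" and f :: "'a \<Rightarrow> real"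
    and B :: "nat \<Rightarrow> nat \<Rightarrow> 'w \<Rightarrow> 'a list"
  assumes "countably_generated S"
    and "markov_chain M S \<kappa> X"
    and "maximal_irreducibility_measure S \<kappa> \<psi>"
    and "aperiodic S \<kappa> \<psi>"
    and "accessible_atom S \<kappa> \<psi> \<alpha>"
    and "recurrent S \<kappa> \<psi>"
    and "\<And>x. x \<in> space S \<Longrightarrow> AE w in path_law S \<kappa> (return S x). \<exists>\<^sub>\<infinity>n. w n \<in> \<alpha>"
    and "beta_null_recurrent \<beta> S \<kappa> \<alpha>"
    and "integrable (invariant_measure S \<kappa> \<alpha>) f"
    and "integrable M (\<lambda>\<omega>. (block_sum f (block \<alpha> (\<lambda>i. X i \<omega>) 1))\<^sup>2)"
    and "prob_space.variance M (\<lambda>\<omega>. block_sum f (block \<alpha> (\<lambda>i. X i \<omega>) 1)) > 0"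
    and "regeneration_bootstrap M S \<alpha> X B"
  shows "\<forall>x. AE \<omega> in M.
    (\<lambda>n. real_cond_exp M (history M S X n)
           (indicator {\<omega>'\<in>space M.
              bootstrap_statistic \<alpha> f (\<lambda>i. X i \<omega>') n (\<lambda>j. B n j \<omega>') \<le> x}) \<omega>)
      \<longlonglongrightarrow> cdf std_normal_distribution x"
proof
  fix x
  interpret markov M S \<kappa> X by (rule markov_chain_imp_markov[OF assms(2)])
  \<comment> \<open>The invariant measure carries the measurable sets of \<open>S\<close>, so
    integrability of \<open>f\<close> supplies its measurability.\<close>
  have sets_inv: "sets (invariant_measure S \<kappa> \<alpha>) = sets S"
    unfolding invariant_measure_def by (simp add: sets.space_closed sets.sigma_sets_eq)
  have f: "f \<in> borel_measurable S"
    using borel_measurable_integrable[OF assms(9)] unfolding measurable_cong_sets[OF sets_inv refl] .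
  have atom: "\<alpha> \<in> sets S" "0 < emeasure \<psi> \<alpha>" "\<forall>x\<in>\<alpha>. \<forall>y\<in>\<alpha>. \<kappa> x = \<kappa> y"
    using assms(5) unfolding accessible_atom_def by blast+
  interpret markov_atom M S \<kappa> X \<alpha> f
  proof (intro markov_atom.intro markov_atom_axioms.intro)
    show "\<alpha> \<noteq> {}" using atom(2) by force
    show "AE \<omega> in M. \<exists>\<^sub>\<infinity>n. X n \<omega> \<in> \<alpha>" by (rule AE_infinitely_often[OF atom(1) assms(7)])
    show "\<kappa> x = \<kappa> y" if "x \<in> \<alpha>" "y \<in> \<alpha>" for x y using atom(3) that by blast
  qed (rule markov_axioms atom(1) f)+
  have Y: "Y 1 = (\<lambda>\<omega>. block_sum f (block \<alpha> (\<lambda>i. X i \<omega>) 1))"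
    unfolding Y_def traj_def ..
  show "AE \<omega> in M. (\<lambda>n. real_cond_exp M (history M S X n)
           (indicator {\<omega>'\<in>space M.
              bootstrap_statistic \<alpha> f (\<lambda>i. X i \<omega>') n (\<lambda>j. B n j \<omega>') \<le> x}) \<omega>)
      \<longlonglongrightarrow> cdf std_normal_distribution x"
    by (rule bootstrap_clt[OF assms(12)]) (unfold Y, rule assms(10), rule assms(11))
qed

end
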